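(* Let $p$ be a prime and let $R$ be a nilperfect ring. Then the map ${}^{s}W(R)\to R$ exhibits the sheared Witt vectors ${}^{s}W(R)$ as the cofree $\delta$-nilperfect $\delta$-ring on $R$. That is, for any $\delta$-nilperfect $\delta$-ring $A$, composition with ${}^{s}W(R)\to R$ gives a bijection $$\mathrm{Hom}_{\delta\text{-}\mathrm{Ring}}(A,{}^{s}W(R))\longrightarrow \mathrm{Hom}_{\mathrm{Ring}}(A,R).$$
   Context: All rings are commutative with unit; $p$ is a fixed prime. A $\delta$-ring is a ring $A$ with a map $\delta:A\to A$ such that $\delta(0)=\delta(1)=0$, $\delta(x+y)=\delta(x)+\delta(y)-\sum_{i=1}^{p-1}\frac1p\binom pi x^iy^{p-i}$ and $\delta(xy)=x^p\delta(y)+y^p\delta(x)+p\delta(x)\delta(y)$; its Frobenius is the ring endomorphism $\phi(a)=a^p+p\delta(a)$. A $\delta$-ring is perfect if $\phi$ is an isomorphism. A ring $R$ is nilperfect if its reduction $R_{\mathrm{red}}$ is a perfect $\mathbb F_p$-algebra. $W(R)$ is the ring of $p$-typical Witt vectors with Frobenius $F$ and Verschiebung $V$; it is naturally a $\delta$-ring with $\phi=F$. Let $\widehat W(R)\subset W(R)$ be the set of Witt vectors $\sum_{i\ge 0}V^i[x_i]$ with all $x_i\in R$ nilpotent and all but finitely many $x_i$ equal to $0$; it is an ideal stable under $F$, $V$ and $\delta$. For $R$ nilperfect put $Q(R)=W(R)/\widehat W(R)$ and define the $\delta$-ring of sheared Witt vectors $${}^{s}W(R)=W(R)\times_{Q(R)}\varprojlim_F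 Q(R),$$ where $\varprojlim_F Q(R)$ is the limit of $\cdots\xrightarrow{F}Q(R)\xrightarrow{F}Q(R)$, mapping to $Q(R)$ by projection to the last term. The map ${}^{s}W(R)\to R$ is the composite ${}^{s}W(R)\to W(R)\to R$ (projection, then zeroth Witt component). An element $a$ of a $\delta$-ring $A$ is $\delta$-nilpotent if $\delta^i(a)$ is nilpotent for all $i\ge0$ and $\delta^i(a)=0$ for $i\gg0$. The $\delta$-nilpotent elements form an ideal $\sqrt[\delta]{A}\subset A$ stable under $\delta$. The $\delta$-ring $A$ is $\delta$-nilperfect if $A/\sqrt[\delta]{A}$ is a perfect $\delta$-ring. *)

theory Defs
  imports
    "HOL-Computational_Algebra.Primes"
    "HOL-Library.Poly_Mapping"
    "HOL-Algebra.QuotRing"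
begin

section \<open>Nilpotent elements and nilperfect rings\<close>

definition nilpotent :: "('a, 'm) ring_scheme \<Rightarrow> 'a \<Rightarrow> bool" where
  "nilpotent R x \<longleftrightarrow> x \<in> carrier R \<and> (\<exists>n::nat. x [^]\<^bsub>R\<^esub> n = \<zero>\<^bsub>R\<^esub>)"

definition reduction :: "('a, 'm) ring_scheme \<Rightarrow> 'a set ring" where
  "reduction R = R Quot {x. nilpotent R x}"

definition perfect_Fp_algebra :: "nat \<Rightarrow> ('a, 'm) ring_scheme \<Rightarrow> bool" where
  "perfect_Fp_algebra p S \<longleftrightarrow>
     cring S \<and> [p] \<cdot>\<^bsub>S\<^esub> \<one>\<^bsub>S\<^esub> = \<zero>\<^bsub>S\<^esub> \<and> bij_betw (\<lambda>x. x [^]\<^bsub>S\<^esub> p) (carrier S) (carrier S)"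

definition nilperfect :: "nat \<Rightarrow> ('a, 'm) ring_scheme \<Rightarrow> bool" where
  "nilperfect p R \<longleftrightarrow> cring R \<and> perfect_Fp_algebra p (reduction R)"


section \<open>\<open>\<delta>\<close>-rings\<close>

record 'a dring = "'a ring" +
  delta :: "'a \<Rightarrow> 'a" (\<open>\<delta>\<index>\<close>)

text \<open>The division \<open>(p choose i) div p\<close> of natural numbers is exact for \<open>0 < i < p\<close>.\<close>

locale delta_ring = cring A for p :: nat and A :: "('a, 'm) dring_scheme" (structure) +
  assumes prime_p: "prime p"
    and delta_closed: "x \<in> carrier A \<Longrightarrow> \<delta> x \<in> carrier A"
    and delta_zero: "\<delta> \<zero> = \<zero>"
    and delta_one: "\<delta> \<one> = \<zero>"
    and delta_add: "\<lbrakk>x \<in> carrier A; y \<in> carrier A\<rbrakk> \<Longrightarrow>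
      \<delta> (x \<oplus> y) =
        \<delta> x \<oplus> \<delta> y \<ominus> (\<Oplus>i\<in>{1..p-1}. [((p choose i) div p)] \<cdot> (x [^] i \<otimes> y [^] (p - i)))"
    and delta_mult: "\<lbrakk>x \<in> carrier A; y \<in> carrier A\<rbrakk> \<Longrightarrow>
      \<delta> (x \<otimes> y) = x [^] p \<otimes> \<delta> y \<oplus> y [^] p \<otimes> \<delta> x \<oplus> [p] \<cdot> (\<delta> x \<otimes> \<delta> y)"

definition frobenius :: "nat \<Rightarrow> ('a, 'm) dring_scheme \<Rightarrow> 'a \<Rightarrow> 'a" where
  "frobenius p A a = a [^]\<^bsub>A\<^esub> p \<oplus>\<^bsub>A\<^esub> [p] \<cdot>\<^bsub>A\<^esub> (\<delta>\<^bsub>A\<^esub> a)"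

definition perfect_delta_ring :: "nat \<Rightarrow> ('a, 'm) dring_scheme \<Rightarrow> bool" where
  "perfect_delta_ring p A \<longleftrightarrow> delta_ring p A \<and> frobenius p A \<in> ring_iso A A"

text \<open>
  The self-map of the quotient by \<open>I\<close> that \<open>f\<close> induces. If \<open>f\<close> respects congruence modulo \<open>I\<close>,
  then the image below is a singleton for every coset \<open>X\<close>.
\<close>

definition coset_map :: "('a, 'm) ring_scheme \<Rightarrow> 'a set \<Rightarrow> ('a \<Rightarrow> 'a) \<Rightarrow> 'a set \<Rightarrow> 'a set" where
  "coset_map A I f X = the_elem ((\<lambda>x. I +>\<^bsub>A\<^esub> f x) ` X)"

definition delta_quot :: "('a, 'm) dring_scheme \<Rightarrow> 'a set \<Rightarrow> 'a set dring" where
  "delta_quot A I = ring.extend (A Quot I) \<lparr>delta = coset_map A I (delta A)\<rparr>"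

definition delta_nilpotent :: "('a, 'm) dring_scheme \<Rightarrow> 'a \<Rightarrow> bool" where
  "delta_nilpotent A a \<longleftrightarrow>
     (\<forall>i. nilpotent A ((delta A ^^ i) a)) \<and> (\<exists>N. \<forall>i\<ge>N. (delta A ^^ i) a = \<zero>\<^bsub>A\<^esub>)"

definition delta_nilradical :: "('a, 'm) dring_scheme \<Rightarrow> 'a set" where
  "delta_nilradical A = {a \<in> carrier A. delta_nilpotent A a}"

definition delta_nilperfect :: "nat \<Rightarrow> ('a, 'm) dring_scheme \<Rightarrow> bool" where
  "delta_nilperfect p A \<longleftrightarrow>
     delta_ring p A \<and> perfect_delta_ring p (delta_quot A (delta_nilradical A))"

text \<open>
  Homomorphisms only matter on the carrier, so Hom-sets consist of functions that are
  \<^term>\<open>undefined\<close> outside of it; otherwise composition could not be bijective on them.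
\<close>

definition Hom_Ring :: "('a, 'm) ring_scheme \<Rightarrow> ('b, 'n) ring_scheme \<Rightarrow> ('a \<Rightarrow> 'b) set" where
  "Hom_Ring A B = ring_hom A B \<inter> extensional (carrier A)"

definition Hom_delta_Ring :: "('a, 'm) dring_scheme \<Rightarrow> ('b, 'n) dring_scheme \<Rightarrow> ('a \<Rightarrow> 'b) set" where
  "Hom_delta_Ring A B = {h \<in> Hom_Ring A B. \<forall>x\<in>carrier A. h (\<delta>\<^bsub>A\<^esub> x) = \<delta>\<^bsub>B\<^esub> (h x)}"


section \<open>Witt vectors\<close>

text \<open>
  Integer polynomials in variables indexed by \<open>'v\<close>: finitely supported integer functions on
  monomials, a monomial being a finitely supported function from variables to exponents.
\<close>

type_synonym 'v zpoly = "('v \<Rightarrow>\<^sub>0 nat) \<Rightarrow>\<^sub>0 int"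

definition zvar :: "'v \<Rightarrow> 'v zpoly" where
  "zvar i = Poly_Mapping.single (Poly_Mapping.single i 1) 1"

definition zpoly_eval :: "('a, 'm) ring_scheme \<Rightarrow> ('v \<Rightarrow> 'a) \<Rightarrow> 'v zpoly \<Rightarrow> 'a" where
  "zpoly_eval R x P =
     (\<Oplus>\<^bsub>R\<^esub>m\<in>Poly_Mapping.keys P. [(Poly_Mapping.lookup P m)] \<cdot>\<^bsub>R\<^esub>
        (\<Otimes>\<^bsub>R\<^esub>i\<in>Poly_Mapping.keys m. x i [^]\<^bsub>R\<^esub> Poly_Mapping.lookup m i))"

definition ghost :: "nat \<Rightarrow> nat \<Rightarrow> (nat \<Rightarrow> 'c::comm_ring_1) \<Rightarrow> 'c" where
  "ghost p n x = (\<Sum>i\<le>n. of_nat (p ^ i) * x i ^ (p ^ (n - i)))"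

text \<open>
  The universal polynomials for the operations on Witt vectors: the unique sequences of integer
  polynomials with the prescribed ghost components (the two summands of the variable type index
  the components of the two arguments). The last sequence expresses
  \<open>F x = x\<^sup>p + p \<delta>(x)\<close>; it is unique since integer polynomials have no \<open>p\<close>-torsion.
\<close>

definition witt_add_poly :: "nat \<Rightarrow> nat \<Rightarrow> (nat + nat) zpoly" where
  "witt_add_poly p = (THE S. \<forall>n. ghost p n S =
     ghost p n (\<lambda>i. zvar (Inl i)) + ghost p n (\<lambda>i. zvar (Inr i)))"

definition witt_mult_poly :: "nat \<Rightarrow> nat \<Rightarrow> (nat + nat) zpoly" where
  "witt_mult_poly p = (THE S. \<forall>n. ghost p n S =
     ghost p n (\<lambda>i. zvar (Inl i)) * ghost p n (\<lambda>i. zvar (Inr i)))"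

definition witt_F_poly :: "nat \<Rightarrow> nat \<Rightarrow> nat zpoly" where
  "witt_F_poly p = (THE S. \<forall>n. ghost p n S = ghost p (Suc n) zvar)"

definition witt_delta_poly :: "nat \<Rightarrow> nat \<Rightarrow> nat zpoly" where
  "witt_delta_poly p = (THE S. \<forall>n.
     ghost p (Suc n) zvar = ghost p n zvar ^ p + of_nat p * ghost p n S)"

definition witt :: "nat \<Rightarrow> ('a, 'm) ring_scheme \<Rightarrow> (nat \<Rightarrow> 'a) dring" where
  "witt p R =
     \<lparr>carrier = {x. \<forall>n. x n \<in> carrier R},
      monoid.mult = (\<lambda>x y n. zpoly_eval R (case_sum x y) (witt_mult_poly p n)),
      one = (\<lambda>n. if n = 0 then \<one>\<^bsub>R\<^esub> else \<zero>\<^bsub>R\<^esub>),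
      zero = (\<lambda>n. \<zero>\<^bsub>R\<^esub>),
      add = (\<lambda>x y n. zpoly_eval R (case_sum x y) (witt_add_poly p n)),
      delta = (\<lambda>x n. zpoly_eval R x (witt_delta_poly p n))\<rparr>"

definition witt_F :: "nat \<Rightarrow> ('a, 'm) ring_scheme \<Rightarrow> (nat \<Rightarrow> 'a) \<Rightarrow> (nat \<Rightarrow> 'a)" where
  "witt_F p R x = (\<lambda>n. zpoly_eval R x (witt_F_poly p n))"

definition witt_V :: "('a, 'm) ring_scheme \<Rightarrow> (nat \<Rightarrow> 'a) \<Rightarrow> (nat \<Rightarrow> 'a)" where
  "witt_V R x = (\<lambda>n. case n of 0 \<Rightarrow> \<zero>\<^bsub>R\<^esub> | Suc k \<Rightarrow> x k)"

definition teichmuller :: "('a, 'm) ring_scheme \<Rightarrow> 'a \<Rightarrow> (nat \<Rightarrow> 'a)" where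
  "teichmuller R a = (\<lambda>n. if n = 0 then a else \<zero>\<^bsub>R\<^esub>)"

definition witt_hat :: "nat \<Rightarrow> ('a, 'm) ring_scheme \<Rightarrow> (nat \<Rightarrow> 'a) set" where
  "witt_hat p R =
     {(\<Oplus>\<^bsub>witt p R\<^esub>i\<in>{i. x i \<noteq> \<zero>\<^bsub>R\<^esub>}. (witt_V R ^^ i) (teichmuller R (x i))) | x.
        (\<forall>i. nilpotent R (x i)) \<and> finite {i. x i \<noteq> \<zero>\<^bsub>R\<^esub>}}"


section \<open>Sheared Witt vectors\<close>

definition witt_Q :: "nat \<Rightarrow> ('a, 'm) ring_scheme \<Rightarrow> (nat \<Rightarrow> 'a) set dring" where
  "witt_Q p R = delta_quot (witt p R) (witt_hat p R)"

definition witt_Q_F :: "nat \<Rightarrow> ('a, 'm) ring_scheme \<Rightarrow> (nat \<Rightarrow> 'a) set \<Rightarrow> (nat \<Rightarrow> 'a) set" where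
  "witt_Q_F p R = coset_map (witt p R) (witt_hat p R) (witt_F p R)"

text \<open>
  The limit of \<open>\<dots> \<rightarrow> Q \<rightarrow> Q \<rightarrow> Q\<close> with all transition maps \<open>f\<close>; the index \<open>0\<close> belongs to the last
  (rightmost) term.
\<close>

definition delta_tower_limit ::
    "('a, 'm) dring_scheme \<Rightarrow> ('a \<Rightarrow> 'a) \<Rightarrow> (nat \<Rightarrow> 'a) dring" where
  "delta_tower_limit Q f =
     \<lparr>carrier = {q. \<forall>n. q n \<in> carrier Q \<and> f (q (Suc n)) = q n},
      monoid.mult = (\<lambda>q r n. q n \<otimes>\<^bsub>Q\<^esub> r n),
      one = (\<lambda>n. \<one>\<^bsub>Q\<^esub>),
      zero = (\<lambda>n. \<zero>\<^bsub>Q\<^esub>),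
      add = (\<lambda>q r n. q n \<oplus>\<^bsub>Q\<^esub> r n),
      delta = (\<lambda>q n. \<delta>\<^bsub>Q\<^esub> (q n))\<rparr>"

definition delta_fibre_product ::
    "('a, 'm) dring_scheme \<Rightarrow> ('b, 'n) dring_scheme \<Rightarrow> ('a \<Rightarrow> 'c) \<Rightarrow> ('b \<Rightarrow> 'c) \<Rightarrow> ('a \<times> 'b) dring"
  where
  "delta_fibre_product B C f g =
     \<lparr>carrier = {(b, c). b \<in> carrier B \<and> c \<in> carrier C \<and> f b = g c},
      monoid.mult = (\<lambda>(b, c) (b', c'). (b \<otimes>\<^bsub>B\<^esub> b', c \<otimes>\<^bsub>C\<^esub> c')),
      one = (\<one>\<^bsub>B\<^esub>, \<one>\<^bsub>C\<^esub>),
      zero = (\<zero>\<^bsub>B\<^esub>, \<zero>\<^bsub>C\<^esub>),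
      add = (\<lambda>(b, c) (b', c'). (b \<oplus>\<^bsub>B\<^esub> b', c \<oplus>\<^bsub>C\<^esub> c')),
      delta = (\<lambda>(b, c). (\<delta>\<^bsub>B\<^esub> b, \<delta>\<^bsub>C\<^esub> c))\<rparr>"

definition sheared_witt ::
    "nat \<Rightarrow> ('a, 'm) ring_scheme \<Rightarrow> ((nat \<Rightarrow> 'a) \<times> (nat \<Rightarrow> (nat \<Rightarrow> 'a) set)) dring" where
  "sheared_witt p R =
     delta_fibre_product (witt p R) (delta_tower_limit (witt_Q p R) (witt_Q_F p R))
       (\<lambda>x. witt_hat p R +>\<^bsub>witt p R\<^esub> x) (\<lambda>q. q 0)"

definition sheared_witt_proj :: "(nat \<Rightarrow> 'a) \<times> (nat \<Rightarrow> (nat \<Rightarrow> 'a) set) \<Rightarrow> 'a" where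
  "sheared_witt_proj z = fst z 0"

end

theory Submission
  imports Defs
begin

text \<open>
  Witt vectors are cofree \<open>\<delta>\<close>-rings. Over a ring \<open>P\<close> of integer polynomials there is no \<open>p\<close>-torsion,
  so a Witt vector is determined by its ghost components, and Dwork's congruences say which
  sequences occur as ghost components (\<open>ghost_ex1\<close>). This yields the universal polynomials, the
  \<open>\<delta>\<close>-ring axioms for \<open>W(P)\<close>, and a map \<open>P \<rightarrow> W(P)\<close> with ghost components \<open>f \<mapsto> \<phi>\<^sup>n(f)\<close> if \<open>P\<close> is a
  free \<open>\<delta>\<close>-ring. Every ring and every \<open>\<delta>\<close>-ring is a quotient of such a \<open>P\<close>, and all these
  structures are given by polynomials and descend. As a result a ring homomorphism \<open>f: A \<rightarrow> R\<close> from
  a \<open>\<delta>\<close>-ring has exactly one lift to a \<open>\<delta>\<close>-homomorphism \<open>A \<rightarrow> W(R)\<close>: its component \<open>n\<close> at \<open>a\<close> is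
  \<open>\<theta>\<^sub>n(f(a), f(\<delta> a), f(\<delta>\<^sup>2 a), \<dots>)\<close> for universal polynomials \<open>\<theta>\<^sub>n\<close> (\<open>witt_lift_delta_hom\<close>,
  \<open>witt_eq_theta\<close>).

  Finiteness comes from weights. If variable \<open>i\<close> has weight \<open>p\<^sup>i\<close>, then the polynomials number \<open>n\<close>
  for addition, multiplication, \<open>\<delta>\<close> and \<open>\<theta>\<close> are homogeneous of a weight proportional to \<open>p\<^sup>n\<close>, while
  every monomial of large weight vanishes at finitely many nilpotent values
  (\<open>homogeneous_eval_eventually_zero\<close>). Write \<open>I(R)\<close> for the ideal \<^const>\<open>witt_hat\<close>, so
  that \<open>Q(R) = W(R)/I(R)\<close>. By weights \<open>I(R)\<close> is indeed an ideal, and it is the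
  \<open>\<delta>\<close>-nilradical of \<open>W(R)\<close> (\<open>delta_nilradical_witt\<close>); the \<open>\<delta>\<close>-nilradical of any \<open>\<delta>\<close>-ring \<open>A\<close> is the
  preimage of \<open>I(A)\<close> under \<open>A \<rightarrow> W(A)\<close>, so it is an ideal too; and \<open>Q(R)\<close> has no \<open>\<delta>\<close>-nilpotent element
  except \<open>0\<close> (\<open>witt_Q_delta_reduced\<close>).

  Therefore the \<open>\<delta>\<close>-nilradical of the sheared Witt vectors consists of the pairs \<open>(x, 0)\<close> with \<open>x\<close> in
  \<open>I(R)\<close>, and modulo these pairs only the limit of \<open>Q(R)\<close> along \<open>F\<close> is left, on which
  shifting sequences inverts \<open>F\<close> (\<open>sheared_delta_nilperfect\<close>).

  Let \<open>A\<close> be \<open>\<delta>\<close>-nilperfect with \<open>\<delta>\<close>-nilradical \<open>N\<close>. The lift \<open>A \<rightarrow> W(R)\<close> of \<open>f\<close> maps \<open>N\<close> into \<open>I(R)\<close> and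
  so induces a map \<open>A/N \<rightarrow> Q(R)\<close> that commutes with the Frobenius maps. As the Frobenius of \<open>A/N\<close> is
  bijective, the map extends to the limit: \<open>a\<close> goes to the sequence of the images of \<open>\<phi>\<^sup>-\<^sup>n(a)\<close>
  (\<open>lift_delta_hom\<close>). No other extension exists, since the components \<open>A \<rightarrow> Q(R)\<close> of a
  \<open>\<delta>\<close>-homomorphism kill the \<open>\<delta>\<close>-nilpotent elements (\<open>delta_hom_determined\<close>).
\<close>

section \<open>Type class rings as ring records\<close>

text \<open>
  With this record, evaluation of integer polynomials can also take values in a type class ring,
  where commutative ring identities are a matter of simplification.
\<close>

definition type_ring :: "'c::comm_ring_1 ring" where
  "type_ring = \<lparr>carrier = UNIV, monoid.mult = (*), one = 1, zero = 0, add = (+)\<rparr>"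

lemma type_ring_simps [simp]:
  "carrier type_ring = UNIV" "x \<otimes>\<^bsub>type_ring\<^esub> y = x * y" "\<one>\<^bsub>type_ring\<^esub> = 1"
  "\<zero>\<^bsub>type_ring\<^esub> = 0" "x \<oplus>\<^bsub>type_ring\<^esub> y = x + y"
  by (simp_all add: type_ring_def)

lemma cring_type_ring [simp, intro]: "cring (type_ring :: 'c::comm_ring_1 ring)"
proof -
  have "\<exists>y::'c. y + x = 0" for x
    by (rule exI[of _ "- x"]) simp
  then show ?thesis
    by (intro cringI abelian_groupI comm_monoidI) (auto simp: algebra_simps)
qed

lemma type_ring_pow [simp]: "x [^]\<^bsub>type_ring\<^esub> (n::nat) = x ^ n"
proof -
  interpret cring "type_ring :: 'a ring" ..
  show ?thesis by (induction n) (auto simp: mult.commute)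
qed

lemma type_ring_a_inv [simp]: "\<ominus>\<^bsub>type_ring\<^esub> x = - x"
proof -
  interpret cring "type_ring :: 'a ring" ..
  show ?thesis by (rule minus_equality) auto
qed

lemma type_ring_a_minus [simp]: "x \<ominus>\<^bsub>type_ring\<^esub> y = x - y"
  by (simp add: a_minus_def)

lemma type_ring_finsum [simp]: "finsum type_ring f S = sum f S"
proof -
  interpret cring "type_ring :: 'a ring" ..
  show ?thesis by (induction S rule: infinite_finite_induct) auto
qed

lemma type_ring_finprod [simp]: "finprod type_ring f S = prod f S"
proof -
  interpret cring "type_ring :: 'a ring" ..
  show ?thesis by (induction S rule: infinite_finite_induct) auto
qed

lemma type_ring_add_pow [simp]: "[(n::nat)] \<cdot>\<^bsub>type_ring\<^esub> x = of_nat n * x"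
proof -
  interpret cring "type_ring :: 'a ring" ..
  show ?thesis by (induction n) (auto simp: algebra_simps)
qed

lemma type_ring_add_pow_int [simp]: "[(n::int)] \<cdot>\<^bsub>type_ring\<^esub> x = of_int n * x"
  by (cases "n \<ge> 0") (auto simp: add_pow_int_ge add_pow_int_lt)

context ring_hom_cring
begin

lemma hom_nat_power [simp]: "x \<in> carrier R \<Longrightarrow> h (x [^] (n::nat)) = h x [^]\<^bsub>S\<^esub> n"
  by (induction n) auto

lemma hom_add_pow [simp]: "x \<in> carrier R \<Longrightarrow> h ([(n::nat)] \<cdot> x) = [n] \<cdot>\<^bsub>S\<^esub> h x"
  by (induction n) auto

lemma hom_a_minus [simp]:
  "x \<in> carrier R \<Longrightarrow> y \<in> carrier R \<Longrightarrow> h (x \<ominus> y) = h x \<ominus>\<^bsub>S\<^esub> h y"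
  by (simp add: a_minus_def)

end

section \<open>Integer polynomials and their evaluation\<close>

lemma poly_mapping_induct [case_names single add]:
  fixes f :: "'k \<Rightarrow>\<^sub>0 'c::comm_monoid_add"
  assumes single: "\<And>k v. P (Poly_Mapping.single k v)" and add: "\<And>f g. P f \<Longrightarrow> P g \<Longrightarrow> P (f + g)"
  shows "P f"
proof (induction f rule: Poly_Mapping.update_induct)
  case const
  show ?case using single[of undefined 0] by simp
next
  case (update f a b)
  have "Poly_Mapping.update a b f = Poly_Mapping.single a b + f"
    using update(1)
    by (intro poly_mapping_eqI) (auto simp: lookup_update lookup_add lookup_single in_keys_iff)
  then show ?case by (simp add: add single update)
qed

lemma of_int_zpoly: "of_int c = (Poly_Mapping.single 0 c :: 'v zpoly)"
  by (metis id_apply of_int_eq_id single_of_int)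

text \<open>
  Consequently two ring homomorphisms on integer polynomials agree if they agree on the variables.
\<close>

lemma zpoly_induct [case_names var one add minus mult]:
  fixes f :: "'v zpoly"
  assumes var: "\<And>i. P (zvar i)" and one: "P 1"
    and add: "\<And>f g. P f \<Longrightarrow> P g \<Longrightarrow> P (f + g)" and minus: "\<And>f. P f \<Longrightarrow> P (- f)"
    and mult: "\<And>f g. P f \<Longrightarrow> P g \<Longrightarrow> P (f * g)"
  shows "P f"
proof -
  have zero: "P 0" using add[OF one minus[OF one]] by simp
  have nat: "P (of_nat n)" for n by (induction n) (auto intro: zero one add)
  have int: "P (of_int c)" for c by (cases c) (auto simp del: of_nat_Suc intro: nat minus)
  have pow: "P (zvar i ^ n)" for i n by (induction n) (auto intro: one var mult)
  have zvar_power: "zvar i ^ n = Poly_Mapping.single (Poly_Mapping.single i n) 1" for n and i :: 'v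
    by (induction n) (auto simp: zvar_def mult_single single_add[symmetric])
  have mon: "P (Poly_Mapping.single m 1)" for m
  proof (induction m rule: poly_mapping_induct)
    case (single i n) then show ?case using pow[of i n] by (simp add: zvar_power)
  next
    case (add m m')
    then show ?case using mult[of "Poly_Mapping.single m 1" "Poly_Mapping.single m' 1"]
      by (simp add: mult_single)
  qed
  have "P (Poly_Mapping.single m c)" for m c
    using mult[OF int[of c] mon[of m]] by (simp add: of_int_zpoly mult_single)
  then show ?thesis by (induction f rule: poly_mapping_induct) (auto intro: add)
qed

context cring
begin

lemma add_pow_int_add:
  "x \<in> carrier R \<Longrightarrow> [(a + b :: int)] \<cdot> x = [a] \<cdot> x \<oplus> [b] \<cdot> x"
  using add.int_pow_mult by simp

lemma add_pow_int_mult: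
  assumes "x \<in> carrier R" "y \<in> carrier R"
  shows "[(a * b :: int)] \<cdot> (x \<otimes> y) = [a] \<cdot> x \<otimes> [b] \<cdot> y"
  using assms by (simp add: add_pow_ldistr_int add_pow_rdistr_int add.int_pow_pow mult.commute)

definition mon_eval :: "('v \<Rightarrow> 'a) \<Rightarrow> ('v \<Rightarrow>\<^sub>0 nat) \<Rightarrow> 'a" where
  "mon_eval x m = (\<Otimes>i\<in>Poly_Mapping.keys m. x i [^] Poly_Mapping.lookup m i)"

context
  fixes x :: "'v \<Rightarrow> 'a"
  assumes x: "\<And>i. x i \<in> carrier R"
begin

lemma mon_eval_closed [simp]: "mon_eval x m \<in> carrier R"
  unfolding mon_eval_def by (rule finprod_closed) (auto simp: x)

lemma mon_eval_superset:
  assumes "finite S" "Poly_Mapping.keys m \<subseteq> S"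
  shows "mon_eval x m = (\<Otimes>i\<in>S. x i [^] Poly_Mapping.lookup m i)"
  unfolding mon_eval_def
  by (rule finprod_mono_neutral_cong_left) (use assms in \<open>auto simp: x in_keys_iff\<close>)

lemma mon_eval_add: "mon_eval x (m + m') = mon_eval x m \<otimes> mon_eval x m'"
proof -
  let ?S = "Poly_Mapping.keys m \<union> Poly_Mapping.keys m'"
  have "mon_eval x (m + m') = (\<Otimes>i\<in>?S. x i [^] Poly_Mapping.lookup (m + m') i)"
    by (rule mon_eval_superset) (auto simp: Poly_Mapping.keys_add)
  also have "\<dots> = (\<Otimes>i\<in>?S. x i [^] Poly_Mapping.lookup m i \<otimes> x i [^] Poly_Mapping.lookup m' i)"
    by (simp add: lookup_add nat_pow_mult x)
  also have "\<dots> = (\<Otimes>i\<in>?S. x i [^] Poly_Mapping.lookup m i) \<otimes> (\<Otimes>i\<in>?S. x i [^] Poly_Mapping.lookup m' i)"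
    by (rule finprod_multf) (auto simp: x)
  also have "\<dots> = mon_eval x m \<otimes> mon_eval x m'"
    by (simp add: mon_eval_superset[symmetric])
  finally show ?thesis .
qed

lemma zpoly_eval_closed [simp]: "zpoly_eval R x f \<in> carrier R"
  unfolding zpoly_eval_def mon_eval_def[symmetric] by (rule finsum_closed) auto

lemma zpoly_eval_superset:
  assumes "finite S" "Poly_Mapping.keys f \<subseteq> S"
  shows "zpoly_eval R x f = (\<Oplus>m\<in>S. [Poly_Mapping.lookup f m] \<cdot> mon_eval x m)"
  unfolding zpoly_eval_def mon_eval_def[symmetric]
  by (rule add.finprod_mono_neutral_cong_left) (use assms in \<open>auto simp: x in_keys_iff add_pow_int_ge\<close>)

lemma zpoly_eval_add: "zpoly_eval R x (f + g) = zpoly_eval R x f \<oplus> zpoly_eval R x g"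
proof -
  let ?S = "Poly_Mapping.keys f \<union> Poly_Mapping.keys g"
  have "zpoly_eval R x (f + g) = (\<Oplus>m\<in>?S. [Poly_Mapping.lookup (f + g) m] \<cdot> mon_eval x m)"
    by (rule zpoly_eval_superset) (auto simp: Poly_Mapping.keys_add)
  also have "\<dots> = (\<Oplus>m\<in>?S. [Poly_Mapping.lookup f m] \<cdot> mon_eval x m \<oplus> [Poly_Mapping.lookup g m] \<cdot> mon_eval x m)"
    by (simp add: lookup_add add_pow_int_add)
  also have "\<dots> = (\<Oplus>m\<in>?S. [Poly_Mapping.lookup f m] \<cdot> mon_eval x m) \<oplus> (\<Oplus>m\<in>?S. [Poly_Mapping.lookup g m] \<cdot> mon_eval x m)"
    by (rule finsum_addf) auto
  also have "\<dots> = zpoly_eval R x f \<oplus> zpoly_eval R x g"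
    by (simp add: zpoly_eval_superset[symmetric])
  finally show ?thesis .
qed

lemma zpoly_eval_single: "zpoly_eval R x (Poly_Mapping.single m c) = [c] \<cdot> mon_eval x m"
  by (simp add: zpoly_eval_superset[of "{m}"])

lemma zpoly_eval_mult: "zpoly_eval R x (f * g) = zpoly_eval R x f \<otimes> zpoly_eval R x g"
proof (induction f rule: poly_mapping_induct)
  case (single m c)
  show ?case
    by (induction g rule: poly_mapping_induct)
      (simp_all add: mult_single zpoly_eval_single mon_eval_add add_pow_int_mult
        distrib_left zpoly_eval_add r_distr)
qed (simp add: distrib_right zpoly_eval_add l_distr)

lemma zpoly_eval_one: "zpoly_eval R x 1 = \<one>"
  using zpoly_eval_single[of 0 1] by (simp add: mon_eval_def)

lemma zpoly_eval_zvar: "zpoly_eval R x (zvar i) = x i"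
  using x[of i] by (simp add: zvar_def zpoly_eval_single mon_eval_def)

lemma ring_hom_zpoly_eval: "ring_hom_cring type_ring R (zpoly_eval R x)"
  by (intro ring_hom_cring.intro ring_hom_cring_axioms.intro cring_type_ring is_cring ring_hom_memI)
    (auto simp: zpoly_eval_add zpoly_eval_mult zpoly_eval_one)

end

end


text \<open>Both sides are ring homomorphisms in \<open>f\<close> that agree on the variables.\<close>

lemma zpoly_eval_natural:
  fixes x :: "'v \<Rightarrow> 'a" and R (structure) and S (structure)
  assumes "ring_hom_cring R S h" and x: "\<And>i. x i \<in> carrier R"
  shows "h (zpoly_eval R x f) = zpoly_eval S (\<lambda>i. h (x i)) f"
proof -
  interpret h: ring_hom_cring R S h by fact
  interpret ex: ring_hom_cring type_ring R "zpoly_eval R x"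
    by (rule h.R.ring_hom_zpoly_eval) (rule x)
  interpret ehx: ring_hom_cring type_ring S "zpoly_eval S (\<lambda>i. h (x i))"
    by (rule h.S.ring_hom_zpoly_eval) (simp add: x)
  have hx: "h (x i) \<in> carrier S" for i by (simp add: x)
  show ?thesis
  proof (induction f rule: zpoly_induct)
    case (var i)
    then show ?case by (simp add: h.R.zpoly_eval_zvar h.S.zpoly_eval_zvar x hx)
  next
    case one
    then show ?case using ex.hom_one ehx.hom_one by simp
  next
    case (add f g)
    then show ?case using ex.hom_add[of f g] ehx.hom_add[of f g] by (simp add: x)
  next
    case (minus f)
    then show ?case using ex.hom_a_inv[of f] ehx.hom_a_inv[of f] by (simp add: x)
  next
    case (mult f g)
    then show ?case using ex.hom_mult[of f g] ehx.hom_mult[of f g] by (simp add: x)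
  qed
qed

abbreviation zsubst :: "('v \<Rightarrow> 'c::comm_ring_1) \<Rightarrow> 'v zpoly \<Rightarrow> 'c" where
  "zsubst \<equiv> zpoly_eval type_ring"

lemma ring_hom_zsubst: "ring_hom_cring type_ring type_ring (zsubst x)"
  by (rule cring.ring_hom_zpoly_eval) auto

lemma zsubst_simps [simp]:
  "zsubst x (zvar i) = x i"
  "zsubst x 0 = 0" "zsubst x 1 = 1"
  "zsubst x (f + g) = zsubst x f + zsubst x g"
  "zsubst x (f * g) = zsubst x f * zsubst x g"
  "zsubst x (- f) = - zsubst x f"
  "zsubst x (f - g) = zsubst x f - zsubst x g"
  "zsubst x (f ^ n) = zsubst x f ^ n"
  "zsubst x (of_nat n) = of_nat n"
proof -
  interpret ring_hom_cring type_ring type_ring "zsubst x" by (rule ring_hom_zsubst)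
  show "zsubst x (zvar i) = x i" by (rule cring.zpoly_eval_zvar) auto
  show "zsubst x 0 = 0" "zsubst x 1 = 1" using hom_zero hom_one by simp_all
  show "zsubst x (f + g) = zsubst x f + zsubst x g" using hom_add[of f g] by simp
  show "zsubst x (f * g) = zsubst x f * zsubst x g" using hom_mult[of f g] by simp
  show "zsubst x (- f) = - zsubst x f" using hom_a_inv[of f] by simp
  show "zsubst x (f - g) = zsubst x f - zsubst x g" using hom_a_minus[of f g] by simp
  show "zsubst x (f ^ n) = zsubst x f ^ n" using hom_nat_power[of f n] by simp
  show "zsubst x (of_nat n) = of_nat n" using hom_add_pow[of 1 n] hom_one by simp
qed

lemma zsubst_natural:
  "ring_hom_cring type_ring S h \<Longrightarrow> h (zsubst x f) = zpoly_eval S (\<lambda>i. h (x i)) f"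
  by (rule zpoly_eval_natural) auto

subsection \<open>Absence of torsion\<close>

lemma lookup_of_nat_mult:
  "Poly_Mapping.lookup (of_nat n * f) m = int n * Poly_Mapping.lookup (f :: 'v zpoly) m"
  by (induction n) (auto simp: lookup_add algebra_simps)

lemma zpoly_mult_cancel: "n > 0 \<Longrightarrow> of_nat n * f = of_nat n * g \<longleftrightarrow> f = (g :: 'v zpoly)"
  by (auto simp: poly_mapping_eq_iff fun_eq_iff lookup_of_nat_mult)

subsection \<open>Weights\<close>

definition mon_weight :: "('v \<Rightarrow> nat) \<Rightarrow> ('v \<Rightarrow>\<^sub>0 nat) \<Rightarrow> nat" where
  "mon_weight w m = (\<Sum>i\<in>Poly_Mapping.keys m. Poly_Mapping.lookup m i * w i)"

definition homogeneous :: "('v \<Rightarrow> nat) \<Rightarrow> nat \<Rightarrow> 'v zpoly \<Rightarrow> bool" where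
  "homogeneous w k f \<longleftrightarrow> (\<forall>m\<in>Poly_Mapping.keys f. mon_weight w m = k)"

lemma mon_weight_superset:
  assumes "finite S" "Poly_Mapping.keys m \<subseteq> S"
  shows "mon_weight w m = (\<Sum>i\<in>S. Poly_Mapping.lookup m i * w i)"
  unfolding mon_weight_def
  by (rule sum.mono_neutral_left) (use assms in \<open>auto simp: in_keys_iff\<close>)

lemma mon_weight_add: "mon_weight w (m + m') = mon_weight w m + mon_weight w m'"
proof -
  let ?S = "Poly_Mapping.keys m \<union> Poly_Mapping.keys m'"
  have "mon_weight w (m + m') = (\<Sum>i\<in>?S. Poly_Mapping.lookup (m + m') i * w i)"
    by (rule mon_weight_superset) (auto simp: Poly_Mapping.keys_add)
  then show ?thesis
    by (simp add: lookup_add algebra_simps sum.distrib mon_weight_superset[of ?S])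
qed

lemma homogeneous_zero [simp]: "homogeneous w k 0"
  by (simp add: homogeneous_def)

lemma homogeneous_one: "homogeneous w 0 1"
  by (simp add: homogeneous_def mon_weight_def)

lemma homogeneous_zvar: "homogeneous w (w i) (zvar i)"
  by (simp add: homogeneous_def mon_weight_def zvar_def)

lemma homogeneous_add: "homogeneous w k f \<Longrightarrow> homogeneous w k g \<Longrightarrow> homogeneous w k (f + g)"
  using Poly_Mapping.keys_add[of f g] by (auto simp: homogeneous_def)

lemma homogeneous_minus: "homogeneous w k f \<Longrightarrow> homogeneous w k (- f)"
  by (auto simp: homogeneous_def in_keys_iff)

lemma homogeneous_diff: "homogeneous w k f \<Longrightarrow> homogeneous w k g \<Longrightarrow> homogeneous w k (f - g)"
  using homogeneous_add[OF _ homogeneous_minus] by fastforce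

lemma homogeneous_mult:
  "homogeneous w k f \<Longrightarrow> homogeneous w l g \<Longrightarrow> homogeneous w (k + l) (f * g)"
  using Poly_Mapping.keys_mult[of f g]
  by (fastforce simp: homogeneous_def mon_weight_add)

lemma homogeneous_power: "homogeneous w k f \<Longrightarrow> homogeneous w (n * k) (f ^ n)"
  by (induction n) (auto intro: homogeneous_one homogeneous_mult)

lemma homogeneous_sum:
  "(\<And>i. i \<in> S \<Longrightarrow> homogeneous w k (f i)) \<Longrightarrow> homogeneous w k (\<Sum>i\<in>S. f i)"
  by (induction S rule: infinite_finite_induct) (auto intro: homogeneous_add)

lemma homogeneous_of_nat_mult:
  "n > 0 \<Longrightarrow> homogeneous w k (of_nat n * f) \<longleftrightarrow> homogeneous w k f"
  by (auto simp: homogeneous_def in_keys_iff lookup_of_nat_mult)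

lemma homogeneous_scale: "homogeneous w k f \<Longrightarrow> homogeneous (\<lambda>i. c * w i) (c * k) f"
  by (simp add: homogeneous_def mon_weight_def sum_distrib_left[symmetric] mult.left_commute)

lemma homogeneous_zsubst:
  assumes f: "homogeneous v k f" and g: "\<And>i. homogeneous w (v i) (g i)"
  shows "homogeneous w k (zsubst g f)"
proof -
  have prod: "homogeneous w (\<Sum>i\<in>S. h i * v i) (\<Prod>i\<in>S. g i ^ h i)" for S h
    by (induction S rule: infinite_finite_induct)
      (auto intro: homogeneous_one homogeneous_mult homogeneous_power g)
  have nat: "homogeneous w k (of_nat n * f)" if "homogeneous w k f" for n and f :: "'b zpoly"
    using that homogeneous_of_nat_mult[of n w k f] by (cases "n = 0") auto
  have "homogeneous w k (of_int c * f)" if "homogeneous w k f" for c and f :: "'b zpoly"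
  proof (cases c)
    case (neg n)
    then have "of_int c * f = - (of_nat (Suc n) * f)" by (simp del: of_nat_Suc)
    then show ?thesis using homogeneous_minus[OF nat[OF that]] by metis
  qed (simp add: nat that)
  then show ?thesis
    using f prod unfolding zpoly_eval_def
    by (auto intro!: homogeneous_sum simp: homogeneous_def[of v] mon_weight_def)
qed

text \<open>
  A monomial of large weight contains one of the finitely many nonzero values to a large exponent,
  or else one of the values \<open>0\<close>. The values at variables of weight \<open>0\<close> are arbitrary, which is what
  the ideal property of nilpotent Witt vectors needs.
\<close>

lemma (in cring) homogeneous_eval_eventually_zero:
  fixes x :: "'v \<Rightarrow> 'a"
  assumes x: "\<And>i. x i \<in> carrier R"
    and nil: "\<And>i. w i > 0 \<Longrightarrow> nilpotent R (x i)"
    and fin: "finite {i. w i > 0 \<and> x i \<noteq> \<zero>}"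
  shows "\<exists>K. \<forall>k\<ge>K. \<forall>f. homogeneous w k f \<longrightarrow> zpoly_eval R x f = \<zero>"
proof -
  define J where "J = {i. w i > 0 \<and> x i \<noteq> \<zero>}"
  have "\<exists>e. w i > 0 \<longrightarrow> x i [^] (e::nat) = \<zero>" for i
    using nil[of i] by (auto simp: nilpotent_def)
  then obtain e where e: "\<And>i. w i > 0 \<Longrightarrow> x i [^] (e i :: nat) = \<zero>"
    by metis
  \<comment> \<open>A monomial with all exponents on \<open>J\<close> at most \<open>e\<close>, and no other weighted variable, has smaller weight.\<close>
  define K where "K = Suc (\<Sum>i\<in>J. e i * w i)"
  have mon: "mon_eval x m = \<zero>" if "mon_weight w m \<ge> K" for m
  proof -
    have "\<exists>i\<in>Poly_Mapping.keys m. x i [^] Poly_Mapping.lookup m i = \<zero>"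
    proof (rule ccontr)
      assume *: "\<not> ?thesis"
      have J: "i \<in> J" if "i \<in> Poly_Mapping.keys m" "w i > 0" for i
      proof (rule ccontr)
        assume "i \<notin> J"
        then have "x i = \<zero>" using that by (auto simp: J_def)
        then have "x i [^] Poly_Mapping.lookup m i = \<zero>"
          using that by (simp add: in_keys_iff nat_pow_zero)
        with * that show False by blast
      qed
      have le: "Poly_Mapping.lookup m i \<le> e i" if "i \<in> J" for i
      proof (rule ccontr)
        assume "\<not> ?thesis"
        then have l: "Poly_Mapping.lookup m i = e i + (Poly_Mapping.lookup m i - e i)"
          and "i \<in> Poly_Mapping.keys m" by (auto simp: in_keys_iff)
        moreover have "x i [^] Poly_Mapping.lookup m i = \<zero>"
          by (subst l, subst nat_pow_mult[symmetric])
            (use that e x in \<open>auto simp: J_def\<close>)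
        ultimately show False using * by blast
      qed
      have "mon_weight w m = (\<Sum>i\<in>Poly_Mapping.keys m \<inter> {i. w i > 0}. Poly_Mapping.lookup m i * w i)"
        unfolding mon_weight_def by (rule sum.mono_neutral_right) auto
      also have "\<dots> \<le> (\<Sum>i\<in>J. Poly_Mapping.lookup m i * w i)"
        by (rule sum_mono2) (use J fin in \<open>auto simp: J_def\<close>)
      also have "\<dots> \<le> (\<Sum>i\<in>J. e i * w i)"
        by (rule sum_mono) (simp add: le)
      finally show False using that by (simp add: K_def)
    qed
    then obtain i where i: "i \<in> Poly_Mapping.keys m" "x i [^] Poly_Mapping.lookup m i = \<zero>"
      by blast
    have "mon_eval x m = (\<Otimes>j\<in>insert i (Poly_Mapping.keys m - {i}). x j [^] Poly_Mapping.lookup m j)"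
      using i by (simp add: mon_eval_def insert_absorb)
    also have "\<dots> = \<zero>"
      by (subst finprod_insert) (use i x in auto)
    finally show ?thesis .
  qed
  have "zpoly_eval R x f = \<zero>" if "homogeneous w k f" "k \<ge> K" for k f
    unfolding zpoly_eval_def mon_eval_def[symmetric]
    by (rule add.finprod_one_eqI) (use that mon in \<open>auto simp: homogeneous_def\<close>)
  then show ?thesis by blast
qed

subsection \<open>Lifts of the Frobenius\<close>

lemma binomial_prime_expansion:
  fixes x y :: "'c::comm_ring_1"
  assumes "prime p"
  shows "(x + y) ^ p = x ^ p + y ^ p
    + of_nat p * (\<Sum>i\<in>{1..p-1}. of_nat ((p choose i) div p) * (x ^ i * y ^ (p - i)))"
proof -
  have p: "p > 1" using assms by (rule prime_gt_1_nat)
  have "{..p} = insert 0 (insert p {1..p-1})" using p by auto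
  then have "(x + y) ^ p = x ^ p + y ^ p + (\<Sum>i\<in>{1..p-1}. of_nat (p choose i) * x ^ i * y ^ (p - i))"
    using p by (simp add: binomial_ring)
  moreover have "of_nat (p choose i) = (of_nat p * of_nat ((p choose i) div p) :: 'c)"
    if "i \<in> {1..p-1}" for i
  proof -
    have "p dvd (p choose i)"
      using that p by (intro dvd_choose_prime[OF _ _ _ assms]) auto
    then show ?thesis by (metis dvd_mult_div_cancel of_nat_mult)
  qed
  ultimately show ?thesis
    by (simp add: sum_distrib_left mult.assoc)
qed

text \<open>
  Each \<open>p\<close>-th power gains a factor \<open>p\<close>: in the expansion of \<open>(b + (a - b))\<^sup>p\<close>, every term except \<open>b\<^sup>p\<close>
  contains \<open>a - b\<close> together with a factor \<open>p\<close>, or else is \<open>(a - b)\<^sup>p\<close>.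
\<close>

lemma power_prime_power_cong:
  fixes a b :: "'c::comm_ring_1"
  assumes "prime p" and "of_nat p ^ Suc j dvd a - b"
  shows "of_nat p ^ Suc (j + k) dvd a ^ (p ^ k) - b ^ (p ^ k)"
proof (induction k)
  case 0
  then show ?case using assms by simp
next
  case (Suc k)
  let ?q = "of_nat p :: 'c" and ?a = "a ^ (p ^ k)" and ?b = "b ^ (p ^ k)"
  obtain c where c: "?a - ?b = ?q ^ Suc (j + k) * c" using Suc by (auto elim: dvdE)
  have p: "p > 1" using assms(1) by (rule prime_gt_1_nat)
  have "?a ^ p = (?b + (?a - ?b)) ^ p" by simp
  also have "\<dots> - ?b ^ p = (?a - ?b) ^ p + ?q * (\<Sum>i\<in>{1..p-1}. of_nat ((p choose i) div p) * (?b ^ i * (?a - ?b) ^ (p - i)))"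
    by (subst binomial_prime_expansion[OF assms(1)]) simp
  also have "?q ^ Suc (j + Suc k) dvd \<dots>"
  proof (rule dvd_add)
    have "?q ^ Suc (j + Suc k) dvd ?q ^ (Suc (j + k) * p)"
    proof (rule le_imp_power_dvd)
      have "Suc (j + k) * 2 \<le> Suc (j + k) * p" using p by (intro mult_le_mono) auto
      then show "Suc (j + Suc k) \<le> Suc (j + k) * p" by simp
    qed
    also have "\<dots> dvd (?a - ?b) ^ p" by (simp add: c power_mult_distrib power_mult[symmetric] del: power_Suc)
    finally show "?q ^ Suc (j + Suc k) dvd (?a - ?b) ^ p" .
    have "?q ^ Suc (j + k) dvd (\<Sum>i\<in>{1..p-1}. of_nat ((p choose i) div p) * (?b ^ i * (?a - ?b) ^ (p - i)))"
    proof (rule dvd_sum)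
      fix i assume "i \<in> {1..p-1}"
      then have "p - i = Suc (p - i - 1)" using p by auto
      then have "?a - ?b dvd (?a - ?b) ^ (p - i)" by (metis dvd_triv_left power_Suc)
      moreover have "?q ^ Suc (j + k) dvd ?a - ?b" using c by simp
      ultimately show "?q ^ Suc (j + k) dvd of_nat ((p choose i) div p) * (?b ^ i * (?a - ?b) ^ (p - i))"
        by (meson dvd_mult dvd_trans)
    qed
    then show "?q ^ Suc (j + Suc k) dvd ?q * (\<Sum>i\<in>{1..p-1}. of_nat ((p choose i) div p) * (?b ^ i * (?a - ?b) ^ (p - i)))"
      by (simp add: mult_dvd_mono)
  qed
  finally show ?case by (simp add: power_mult[symmetric] mult.commute)
qed

definition frobenius_lift :: "nat \<Rightarrow> ('c::comm_ring_1 \<Rightarrow> 'c) \<Rightarrow> bool" where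
  "frobenius_lift p \<sigma> \<longleftrightarrow> ring_hom_cring type_ring type_ring \<sigma> \<and> (\<forall>f. of_nat p dvd \<sigma> f - f ^ p)"

text \<open>
  The congruence between \<open>f\<^sup>p\<close> and the image of \<open>f\<close> survives sums, since \<open>p\<close> divides the inner binomial
  coefficients, and products; so it only has to be known for variables.
\<close>

lemma frobenius_lift_zsubst:
  fixes s :: "'v \<Rightarrow> 'v zpoly"
  assumes p: "prime p" and s: "\<And>i. of_nat p dvd s i - zvar i ^ p"
  shows "frobenius_lift p (zsubst s)"
proof -
  have add: "of_nat p dvd (f + g) ^ p - (f ^ p + g ^ p)" for f g :: "'v zpoly"
    by (simp add: binomial_prime_expansion[OF p])
  have "of_nat p dvd zsubst s f - f ^ p" for f
  proof (induction f rule: zpoly_induct)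
    case (var i)
    then show ?case by (simp add: s)
  next
    case one
    then show ?case by simp
  next
    case (add f g)
    have "zsubst s (f + g) - (f + g) ^ p
      = (zsubst s f - f ^ p) + (zsubst s g - g ^ p) - ((f + g) ^ p - (f ^ p + g ^ p))" by simp
    then show ?case using add \<open>\<And>f g. of_nat p dvd (f + g) ^ p - (f ^ p + g ^ p)\<close>
      by (metis dvd_add dvd_diff)
  next
    case (minus f)
    have "of_nat p dvd f ^ p + (- f) ^ p"
      using add[of f "- f"] p dvd_minus_iff[of "of_nat p" "f ^ p + (- f) ^ p"]
      by (simp add: zero_power prime_gt_0_nat)
    moreover have "zsubst s (- f) - (- f) ^ p = - (zsubst s f - f ^ p) - (f ^ p + (- f) ^ p)" by simp
    ultimately show ?case using minus by (metis dvd_diff dvd_minus_iff)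
  next
    case (mult f g)
    have "zsubst s (f * g) - (f * g) ^ p
      = (zsubst s f - f ^ p) * zsubst s g + f ^ p * (zsubst s g - g ^ p)"
      by (simp add: algebra_simps power_mult_distrib)
    then show ?case using mult by (metis dvd_add dvd_mult dvd_mult2)
  qed
  then show ?thesis by (simp add: frobenius_lift_def ring_hom_zsubst)
qed


section \<open>Ghost components\<close>

lemma ghost_0 [simp]: "ghost p 0 x = x 0"
  by (simp add: ghost_def)

lemma ghost_cong: "(\<And>i. i \<le> n \<Longrightarrow> x i = y i) \<Longrightarrow> ghost p n x = ghost p n y"
  by (simp add: ghost_def)

lemma ghost_split_last: "ghost p n x = (\<Sum>i<n. of_nat (p ^ i) * x i ^ (p ^ (n - i))) + of_nat (p ^ n) * x n"
  by (simp add: ghost_def lessThan_Suc_atMost[symmetric])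

lemma ghost_Suc: "ghost p (Suc n) x = ghost p n (\<lambda>i. x i ^ p) + of_nat (p ^ Suc n) * x (Suc n)"
  unfolding ghost_split_last[of p "Suc n"] lessThan_Suc_atMost ghost_def
  by (simp add: Suc_diff_le power_mult[symmetric] mult.commute)

lemma type_ring_hom_ghost:
  assumes "ring_hom_cring type_ring type_ring h"
  shows "h (ghost p n x) = ghost p n (\<lambda>i. h (x i))"
proof -
  interpret ring_hom_cring type_ring type_ring h by fact
  have mult: "h (a * b) = h a * h b" and pow: "h (a ^ k) = h a ^ k" and nat: "h (of_nat k) = of_nat k"
    for a b and k :: nat
    using hom_mult[of a b] hom_nat_power[of a k] hom_add_pow[of 1 k] hom_one by simp_all
  have sum: "h (sum f I) = (\<Sum>i\<in>I. h (f i))" for f and I :: "nat set"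
    using hom_finsum[of f I] by (simp add: comp_def)
  show ?thesis by (simp add: ghost_def sum mult pow nat del: of_nat_power)
qed

lemma zsubst_ghost: "zsubst y (ghost p n S) = ghost p n (\<lambda>i. zsubst y (S i))"
  by (rule type_ring_hom_ghost) (rule ring_hom_zsubst)

text \<open>
  Once the earlier components agree, ghost component \<open>n\<close> determines \<open>p\<^sup>n\<close> times component \<open>n\<close>, and
  integer polynomials have no \<open>p\<close>-torsion.
\<close>

lemma ghost_inj:
  fixes x y :: "nat \<Rightarrow> 'v zpoly"
  assumes "prime p" and eq: "\<And>n. ghost p n x = ghost p n y"
  shows "x = y"
proof
  have p: "p > 0" using assms(1) by (rule prime_gt_0_nat)
  fix n
  show "x n = y n"
  proof (induction n rule: less_induct)
    case (less n)
    then have "(\<Sum>i<n. of_nat (p ^ i) * x i ^ (p ^ (n - i))) = (\<Sum>i<n. of_nat (p ^ i) * y i ^ (p ^ (n - i)))"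
      by simp
    with eq[of n] have "of_nat (p ^ n) * x n = of_nat (p ^ n) * y n"
      unfolding ghost_split_last by simp
    then show ?case using p by (subst (asm) zpoly_mult_cancel) auto
  qed
qed

text \<open>
  Dwork's congruences: for a Frobenius lift \<open>\<sigma>\<close> they hold exactly for the sequences of ghost
  components.
\<close>

definition dwork :: "nat \<Rightarrow> ('c::comm_ring_1 \<Rightarrow> 'c) \<Rightarrow> (nat \<Rightarrow> 'c) \<Rightarrow> bool" where
  "dwork p \<sigma> w \<longleftrightarrow> (\<forall>n. of_nat p ^ Suc n dvd w (Suc n) - \<sigma> (w n))"

text \<open>
  The elements \<open>\<sigma>(x\<^sub>i)\<close> and \<open>x\<^sub>i\<^sup>p\<close> agree modulo \<open>p\<close>, so their powers in the sum agree modulo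
  \<open>p\<^sup>n\<^sup>-\<^sup>i\<^sup>+\<^sup>1\<close>; the coefficient \<open>p\<^sup>i\<close> supplies the rest.
\<close>

lemma ghost_Suc_cong:
  fixes x :: "nat \<Rightarrow> 'c::comm_ring_1"
  assumes p: "prime p" and \<sigma>: "frobenius_lift p \<sigma>"
  shows "of_nat p ^ Suc n dvd ghost p n (\<lambda>i. x i ^ p) - \<sigma> (ghost p n x)"
proof -
  have "\<sigma> (ghost p n x) = ghost p n (\<lambda>i. \<sigma> (x i))"
    using \<sigma> by (intro type_ring_hom_ghost) (auto simp: frobenius_lift_def)
  then have eq: "ghost p n (\<lambda>i. x i ^ p) - \<sigma> (ghost p n x)
    = (\<Sum>i\<le>n. of_nat p ^ i * ((x i ^ p) ^ (p ^ (n - i)) - \<sigma> (x i) ^ (p ^ (n - i))))"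
    by (simp add: ghost_def sum_subtractf algebra_simps)
  show ?thesis unfolding eq
  proof (rule dvd_sum)
    fix i assume i: "i \<in> {..n}"
    have "of_nat p dvd x i ^ p - \<sigma> (x i)"
      using \<sigma> dvd_minus_iff[of "of_nat p" "\<sigma> (x i) - x i ^ p"] by (simp add: frobenius_lift_def)
    then have "of_nat p ^ Suc (n - i) dvd (x i ^ p) ^ (p ^ (n - i)) - \<sigma> (x i) ^ (p ^ (n - i))"
      using power_prime_power_cong[OF p, of 0 "x i ^ p" "\<sigma> (x i)" "n - i"] by simp
    then have "of_nat p ^ i * of_nat p ^ Suc (n - i) dvd of_nat p ^ i * ((x i ^ p) ^ (p ^ (n - i)) - \<sigma> (x i) ^ (p ^ (n - i)))"
      by (rule mult_dvd_mono[OF dvd_refl])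
    then show "of_nat p ^ Suc n dvd of_nat p ^ i * ((x i ^ p) ^ (p ^ (n - i)) - \<sigma> (x i) ^ (p ^ (n - i)))"
      using i by (simp add: power_add[symmetric] del: power_Suc)
  qed
qed

lemma dwork_ghost:
  assumes "prime p" "frobenius_lift p \<sigma>"
  shows "dwork p \<sigma> (\<lambda>n. ghost p n x)"
  unfolding dwork_def
proof
  fix n
  have "ghost p (Suc n) x - \<sigma> (ghost p n x)
    = (ghost p n (\<lambda>i. x i ^ p) - \<sigma> (ghost p n x)) + of_nat p ^ Suc n * x (Suc n)"
    by (simp add: ghost_Suc)
  then show "of_nat p ^ Suc n dvd ghost p (Suc n) x - \<sigma> (ghost p n x)"
    using ghost_Suc_cong[OF assms] by (metis dvd_add dvd_triv_left)
qed

text \<open>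
  The components are found one at a time: Dwork's congruence is the solvability of the linear
  equation for the next component, whose coefficient is \<open>p\<^sup>n\<^sup>+\<^sup>1\<close>.
\<close>

lemma dwork_imp_ghost:
  assumes p: "prime p" and \<sigma>: "frobenius_lift p \<sigma>" and w: "dwork p \<sigma> w"
  shows "\<exists>x. \<forall>n. ghost p n x = w n"
proof -
  have "\<exists>f. \<forall>n. (\<forall>m\<le>n. ghost p m (f n) = w m) \<and> (\<forall>i\<le>n. f (Suc n) i = f n i)"
  proof (rule dependent_nat_choice)
    show "\<exists>x. \<forall>m\<le>0. ghost p m x = w m" by (rule exI[of _ "\<lambda>_. w 0"]) simp
    fix x n assume IH: "\<forall>m\<le>n. ghost p m x = w m"
    have "w (Suc n) - ghost p n (\<lambda>i. x i ^ p)
      = (w (Suc n) - \<sigma> (w n)) - (ghost p n (\<lambda>i. x i ^ p) - \<sigma> (ghost p n x))"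
      using IH by simp
    then have "of_nat p ^ Suc n dvd w (Suc n) - ghost p n (\<lambda>i. x i ^ p)"
      using w ghost_Suc_cong[OF p \<sigma>, of n x] unfolding dwork_def by (metis dvd_diff)
    then obtain c where c: "w (Suc n) - ghost p n (\<lambda>i. x i ^ p) = of_nat p ^ Suc n * c"
      by (auto elim: dvdE)
    define y where "y = x(Suc n := c)"
    have "ghost p m y = w m" if "m \<le> Suc n" for m
    proof (cases "m = Suc n")
      case True
      have "ghost p n (\<lambda>i. y i ^ p) = ghost p n (\<lambda>i. x i ^ p)"
        by (rule ghost_cong) (simp add: y_def)
      then have "ghost p (Suc n) y = ghost p n (\<lambda>i. x i ^ p) + of_nat p ^ Suc n * c"
        by (simp add: ghost_Suc y_def)
      then show ?thesis using True c by (simp add: algebra_simps)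
    next
      case False
      then have "ghost p m y = ghost p m x" using that by (intro ghost_cong) (simp add: y_def)
      then show ?thesis using IH False that by simp
    qed
    moreover have "\<forall>i\<le>n. y i = x i" by (simp add: y_def)
    ultimately show "\<exists>y. (\<forall>m\<le>Suc n. ghost p m y = w m) \<and> (\<forall>i\<le>n. y i = x i)" by blast
  qed
  then obtain f where "\<forall>n. (\<forall>m\<le>n. ghost p m (f n) = w m) \<and> (\<forall>i\<le>n. f (Suc n) i = f n i)" ..
  then have f: "\<And>n m. m \<le> n \<Longrightarrow> ghost p m (f n) = w m" "\<And>n i. i \<le> n \<Longrightarrow> f (Suc n) i = f n i"
    by simp_all
  have "f (i + k) i = f i i" for i k by (induction k) (simp_all add: f(2))
  then have diag: "f n i = f i i" if "i \<le> n" for n i using that by (metis le_add_diff_inverse)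
  \<comment> \<open>The partial solutions \<open>f n\<close> agree where they overlap, so the diagonal solves all equations.\<close>
  have "ghost p n (\<lambda>i. f i i) = ghost p n (f n)" for n
    by (rule ghost_cong) (rule diag[symmetric])
  then show ?thesis using f(1) by (intro exI[of _ "\<lambda>i. f i i"]) simp
qed

lemma ghost_ex1:
  fixes w :: "nat \<Rightarrow> 'v zpoly"
  assumes "prime p" "frobenius_lift p \<sigma>" "dwork p \<sigma> w"
  shows "\<exists>!x. \<forall>n. ghost p n x = w n"
  using dwork_imp_ghost[OF assms] ghost_inj[OF assms(1)] by metis

context
  fixes p :: nat and \<sigma> :: "'c::comm_ring_1 \<Rightarrow> 'c"
  assumes p: "prime p" and \<sigma>: "frobenius_lift p \<sigma>"
begin

interpretation ring_hom_cring type_ring type_ring \<sigma>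
  using \<sigma> by (simp add: frobenius_lift_def)

lemma frobenius_lift_simps:
  "\<sigma> (a + b) = \<sigma> a + \<sigma> b" "\<sigma> (a * b) = \<sigma> a * \<sigma> b" "\<sigma> (- a) = - \<sigma> a" "\<sigma> (a - b) = \<sigma> a - \<sigma> b"
  "\<sigma> (a ^ n) = \<sigma> a ^ n" "\<sigma> (of_nat n) = of_nat n" "\<sigma> 0 = 0" "\<sigma> 1 = 1"
  using hom_add[of a b] hom_mult[of a b] hom_a_inv[of a] hom_nat_power[of a n] hom_add_pow[of 1 n]
    hom_one hom_zero hom_a_minus[of a b] by simp_all

lemma dwork_add:
  assumes "dwork p \<sigma> v" "dwork p \<sigma> w"
  shows "dwork p \<sigma> (\<lambda>n. v n + w n)"
  unfolding dwork_def frobenius_lift_simps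
proof
  fix n
  have "v (Suc n) + w (Suc n) - (\<sigma> (v n) + \<sigma> (w n)) = (v (Suc n) - \<sigma> (v n)) + (w (Suc n) - \<sigma> (w n))"
    by simp
  then show "of_nat p ^ Suc n dvd v (Suc n) + w (Suc n) - (\<sigma> (v n) + \<sigma> (w n))"
    using assms unfolding dwork_def by (metis dvd_add)
qed

lemma dwork_minus:
  assumes "dwork p \<sigma> w"
  shows "dwork p \<sigma> (\<lambda>n. - w n)"
  unfolding dwork_def frobenius_lift_simps
proof
  fix n
  have "- w (Suc n) - - \<sigma> (w n) = - (w (Suc n) - \<sigma> (w n))"
    by simp
  then show "of_nat p ^ Suc n dvd - w (Suc n) - - \<sigma> (w n)"
    using assms unfolding dwork_def by (metis dvd_minus_iff)
qed

lemma dwork_mult: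
  assumes "dwork p \<sigma> v" "dwork p \<sigma> w"
  shows "dwork p \<sigma> (\<lambda>n. v n * w n)"
  unfolding dwork_def frobenius_lift_simps
proof
  fix n
  have "v (Suc n) * w (Suc n) - \<sigma> (v n) * \<sigma> (w n)
    = v (Suc n) * (w (Suc n) - \<sigma> (w n)) + (v (Suc n) - \<sigma> (v n)) * \<sigma> (w n)"
    by (simp add: algebra_simps)
  then show "of_nat p ^ Suc n dvd v (Suc n) * w (Suc n) - \<sigma> (v n) * \<sigma> (w n)"
    using assms unfolding dwork_def by (metis dvd_add dvd_mult dvd_mult2)
qed

lemma dwork_Suc: "dwork p \<sigma> w \<Longrightarrow> dwork p \<sigma> (\<lambda>n. w (Suc n))"
  unfolding dwork_def by (meson dvd_trans le_imp_power_dvd le_SucI order_refl)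

text \<open>
  The sequence \<open>(w\<^sub>n\<^sub>+\<^sub>1 - w\<^sub>n\<^sup>p) / p\<close> is what \<open>\<delta>\<close> does to ghost components. The division by \<open>p\<close> costs one power
  of \<open>p\<close> in the congruences, and taking \<open>p\<close>-th powers gains it back.
\<close>

lemma dwork_delta:
  assumes w: "dwork p \<sigma> w" and cancel: "\<And>a b :: 'c. of_nat p * a = of_nat p * b \<Longrightarrow> a = b"
  shows "\<exists>v. dwork p \<sigma> v \<and> (\<forall>n. w (Suc n) = w n ^ p + of_nat p * v n)"
proof -
  have "\<exists>c. w (Suc n) = w n ^ p + of_nat p * c" for n
  proof -
    have "of_nat p dvd w (Suc n) - \<sigma> (w n)"
      using w unfolding dwork_def by (metis dvd_mult_left power_Suc)
    moreover have "of_nat p dvd \<sigma> (w n) - w n ^ p" using \<sigma> by (simp add: frobenius_lift_def)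
    ultimately have "of_nat p dvd w (Suc n) - w n ^ p" by (metis dvd_add diff_add_cancel add_diff_eq)
    then obtain c where "w (Suc n) - w n ^ p = of_nat p * c" by (auto elim: dvdE)
    then show ?thesis by (metis add.commute diff_add_cancel)
  qed
  then obtain v where v: "\<And>n. w (Suc n) = w n ^ p + of_nat p * v n" by metis
  have "of_nat p ^ Suc n dvd v (Suc n) - \<sigma> (v n)" for n
  proof -
    obtain a where a: "w (Suc (Suc n)) - \<sigma> (w (Suc n)) = of_nat p ^ Suc (Suc n) * a"
      using w unfolding dwork_def by (blast elim: dvdE)
    have "of_nat p ^ Suc n dvd w (Suc n) - \<sigma> (w n)" using w by (simp add: dwork_def)
    then have "of_nat p ^ Suc (n + 1) dvd w (Suc n) ^ (p ^ 1) - \<sigma> (w n) ^ (p ^ 1)"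
      by (rule power_prime_power_cong[OF p])
    then obtain b where b: "w (Suc n) ^ p - \<sigma> (w n) ^ p = of_nat p ^ Suc (Suc n) * b"
      by (auto elim: dvdE)
    have "of_nat p * (v (Suc n) - \<sigma> (v n))
      = (w (Suc (Suc n)) - w (Suc n) ^ p) - (\<sigma> (w (Suc n)) - \<sigma> (w n) ^ p)"
      using v[of "Suc n"] arg_cong[OF v[of n], of \<sigma>] by (simp add: frobenius_lift_simps algebra_simps)
    also have "\<dots> = (w (Suc (Suc n)) - \<sigma> (w (Suc n))) - (w (Suc n) ^ p - \<sigma> (w n) ^ p)" by simp
    also have "\<dots> = of_nat p * (of_nat p ^ Suc n * (a - b))"
      unfolding a b by (simp add: algebra_simps)
    finally have "v (Suc n) - \<sigma> (v n) = of_nat p ^ Suc n * (a - b)" by (rule cancel)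
    then show ?thesis by simp
  qed
  then show ?thesis using v unfolding dwork_def by blast
qed

end

lemma frobenius_lift_zvar_power:
  "prime p \<Longrightarrow> frobenius_lift p (zsubst (\<lambda>i. zvar i ^ p) :: 'v zpoly \<Rightarrow> 'v zpoly)"
  by (rule frobenius_lift_zsubst) auto

text \<open>
  Solving for the components takes sums, powers and division by powers of \<open>p\<close>, all of which respect
  weights.
\<close>

lemma homogeneous_of_ghost:
  fixes S :: "nat \<Rightarrow> 'v zpoly"
  assumes "prime p" and S: "\<And>n. homogeneous w (c * p ^ n) (ghost p n S)"
  shows "homogeneous w (c * p ^ n) (S n)"
proof (induction n rule: less_induct)
  case (less n)
  have p: "p > 0" using assms(1) by (rule prime_gt_0_nat)
  have "homogeneous w (c * p ^ n) (of_nat (p ^ i) * S i ^ (p ^ (n - i)))" if "i < n" for i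
  proof -
    have "homogeneous w (p ^ (n - i) * (c * p ^ i)) (S i ^ (p ^ (n - i)))"
      by (rule homogeneous_power) (rule less[OF that])
    moreover have "p ^ (n - i) * (c * p ^ i) = c * p ^ n"
      using that by (simp add: mult.left_commute power_add[symmetric])
    ultimately show ?thesis using p by (subst homogeneous_of_nat_mult) auto
  qed
  then have "homogeneous w (c * p ^ n) (ghost p n S - (\<Sum>i<n. of_nat (p ^ i) * S i ^ (p ^ (n - i))))"
    by (intro homogeneous_diff S homogeneous_sum) auto
  then have "homogeneous w (c * p ^ n) (of_nat (p ^ n) * S n)"
    unfolding ghost_split_last by simp
  then show ?case using p by (subst (asm) homogeneous_of_nat_mult) auto
qed

lemma homogeneous_ghost:
  fixes S :: "nat \<Rightarrow> 'v zpoly"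
  assumes p: "p > 0" and S: "\<And>n. homogeneous w (c * p ^ n) (S n)"
  shows "homogeneous w (c * p ^ n) (ghost p n S)"
  unfolding ghost_def
proof (rule homogeneous_sum)
  fix i assume i: "i \<in> {..n}"
  have "homogeneous w (p ^ (n - i) * (c * p ^ i)) (S i ^ (p ^ (n - i)))"
    by (rule homogeneous_power) (rule S)
  moreover have "p ^ (n - i) * (c * p ^ i) = c * p ^ n"
    using i by (simp add: mult.left_commute power_add[symmetric])
  ultimately show "homogeneous w (c * p ^ n) (of_nat (p ^ i) * S i ^ (p ^ (n - i)))"
    using p by (subst homogeneous_of_nat_mult) auto
qed

section \<open>The universal polynomials\<close>

context
  fixes p :: nat
  assumes p: "prime p"
begin

lemma dwork_ghost_zpoly: "dwork p (zsubst (\<lambda>i. zvar i ^ p)) (\<lambda>n. ghost p n (x :: nat \<Rightarrow> 'v zpoly))"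
  by (rule dwork_ghost) (auto intro: p frobenius_lift_zvar_power)

lemma ghost_witt_add_poly:
  "ghost p n (witt_add_poly p) = ghost p n (\<lambda>i. zvar (Inl i)) + ghost p n (\<lambda>i. zvar (Inr i))"
proof -
  have "\<exists>!S. \<forall>n. ghost p n S = ghost p n (\<lambda>i. zvar (Inl i)) + ghost p n (\<lambda>i. zvar (Inr i) :: (nat + nat) zpoly)"
    by (rule ghost_ex1[OF p frobenius_lift_zvar_power[OF p]])
      (intro dwork_add p frobenius_lift_zvar_power dwork_ghost_zpoly)
  from theI'[OF this] show ?thesis unfolding witt_add_poly_def by blast
qed

lemma ghost_witt_mult_poly:
  "ghost p n (witt_mult_poly p) = ghost p n (\<lambda>i. zvar (Inl i)) * ghost p n (\<lambda>i. zvar (Inr i))"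
proof -
  have "\<exists>!S. \<forall>n. ghost p n S = ghost p n (\<lambda>i. zvar (Inl i)) * ghost p n (\<lambda>i. zvar (Inr i) :: (nat + nat) zpoly)"
    by (rule ghost_ex1[OF p frobenius_lift_zvar_power[OF p]])
      (intro dwork_mult p frobenius_lift_zvar_power dwork_ghost_zpoly)
  from theI'[OF this] show ?thesis unfolding witt_mult_poly_def by blast
qed

lemma ghost_witt_F_poly: "ghost p n (witt_F_poly p) = ghost p (Suc n) zvar"
proof -
  have "\<exists>!S. \<forall>n. ghost p n S = ghost p (Suc n) (zvar :: nat \<Rightarrow> _)"
    by (rule ghost_ex1[OF p frobenius_lift_zvar_power[OF p]])
      (intro dwork_Suc p frobenius_lift_zvar_power dwork_ghost_zpoly)
  from theI'[OF this] show ?thesis unfolding witt_F_poly_def by blast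
qed

lemma ghost_witt_delta_poly:
  "ghost p (Suc n) zvar = ghost p n zvar ^ p + of_nat p * ghost p n (witt_delta_poly p)"
proof -
  have cancel: "of_nat p * a = of_nat p * b \<Longrightarrow> a = b" for a b :: "nat zpoly"
    using zpoly_mult_cancel prime_gt_0_nat[OF p] by blast
  obtain v where v: "dwork p (zsubst (\<lambda>i. zvar i ^ p)) v"
    "\<And>n. ghost p (Suc n) (zvar :: nat \<Rightarrow> _) = ghost p n zvar ^ p + of_nat p * v n"
    using dwork_delta[OF p frobenius_lift_zvar_power[OF p] dwork_ghost_zpoly cancel, of zvar] by blast
  have "(\<forall>n. ghost p (Suc n) zvar = ghost p n zvar ^ p + of_nat p * ghost p n S) \<longleftrightarrow> (\<forall>n. ghost p n S = v n)" for S
    unfolding v(2) using cancel by auto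
  then have "\<exists>!S. \<forall>n. ghost p (Suc n) (zvar :: nat \<Rightarrow> _) = ghost p n zvar ^ p + of_nat p * ghost p n S"
    using ghost_ex1[OF p frobenius_lift_zvar_power[OF p] v(1)] by simp
  from theI'[OF this] show ?thesis unfolding witt_delta_poly_def by blast
qed

text \<open>
  The Frobenius map of the free \<open>\<delta>\<close>-ring on one generator \<open>a\<close>; variable \<open>k\<close> stands for \<open>\<delta>\<^sup>k(a)\<close>.
\<close>

definition generic_frob :: "nat zpoly \<Rightarrow> nat zpoly" where
  "generic_frob = zsubst (\<lambda>k. zvar k ^ p + of_nat p * zvar (Suc k))"

text \<open>
  The components of the Witt vector that lifts \<open>a\<close>, in terms of \<open>a\<close>, \<open>\<delta>(a)\<close>, \<open>\<delta>\<^sup>2(a)\<close>, and so on: its ghost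
  component \<open>n\<close> has to be \<open>\<phi>\<^sup>n(a)\<close>.
\<close>

definition theta :: "nat \<Rightarrow> nat zpoly" where
  "theta = (THE S. \<forall>n. ghost p n S = (generic_frob ^^ n) (zvar 0))"

lemma ghost_theta_poly: "ghost p n theta = (generic_frob ^^ n) (zvar 0)"
proof -
  have "frobenius_lift p generic_frob"
    unfolding generic_frob_def by (rule frobenius_lift_zsubst) (auto intro: p)
  then have "\<exists>!S. \<forall>n. ghost p n S = (generic_frob ^^ n) (zvar 0)"
    by (rule ghost_ex1[OF p]) (auto simp: dwork_def)
  from theI'[OF this] show ?thesis unfolding theta_def by blast
qed

lemma theta_0: "theta 0 = zvar 0"
  using ghost_theta_poly[of 0] by simp

text \<open>
  The hypothesis is the relation \<open>\<phi>(x) = x\<^sup>p + p \<delta>(x)\<close> for an array whose entry \<open>(n, k)\<close> is either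
  \<open>\<phi>\<^sup>n(\<delta>\<^sup>k(a))\<close> in a \<open>\<delta>\<close>-ring, or the ghost component \<open>n\<close> of \<open>\<delta>\<^sup>k(x)\<close> for a Witt vector \<open>x\<close>.
\<close>

lemma ghost_theta:
  assumes e: "\<And>n k. e (Suc n) k = e n k ^ p + of_nat p * e n (Suc k)"
  shows "ghost p n (\<lambda>i. zsubst (e 0) (theta i)) = e n 0"
proof -
  have "zsubst (e n) (generic_frob f) = zsubst (e (Suc n)) f" for n f
  proof -
    have "e (Suc n) = (\<lambda>k. e n k ^ p + of_nat p * e n (Suc k))" by (rule ext) (rule e)
    then show ?thesis
      unfolding generic_frob_def by (subst zsubst_natural[OF ring_hom_zsubst]) simp
  qed
  then have "zsubst (e 0) ((generic_frob ^^ n) f) = zsubst (e n) f" for n f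
    by (induction n arbitrary: f) (auto simp: funpow_Suc_right simp del: funpow.simps)
  then show ?thesis by (simp add: zsubst_ghost[symmetric] ghost_theta_poly)
qed

lemma homogeneous_witt_add_poly:
  "homogeneous (case_sum (\<lambda>i. p ^ i) (\<lambda>i. p ^ i)) (p ^ n) (witt_add_poly p n)"
proof -
  let ?w = "case_sum (\<lambda>i. p ^ i) (\<lambda>i. p ^ i)"
  have "homogeneous ?w (1 * p ^ n) (ghost p n (\<lambda>i. zvar (Inl i)))"
    "homogeneous ?w (1 * p ^ n) (ghost p n (\<lambda>i. zvar (Inr i)))" for n
  proof -
    show "homogeneous ?w (1 * p ^ n) (ghost p n (\<lambda>i. zvar (Inl i)))"
      by (rule homogeneous_ghost[OF prime_gt_0_nat[OF p]]) (use homogeneous_zvar[of ?w "Inl _"] in simp)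
    show "homogeneous ?w (1 * p ^ n) (ghost p n (\<lambda>i. zvar (Inr i)))"
      by (rule homogeneous_ghost[OF prime_gt_0_nat[OF p]]) (use homogeneous_zvar[of ?w "Inr _"] in simp)
  qed
  then have "homogeneous ?w (1 * p ^ n) (ghost p n (witt_add_poly p))" for n
    by (simp only: ghost_witt_add_poly homogeneous_add)
  then have "homogeneous ?w (1 * p ^ n) (witt_add_poly p n)"
    by (rule homogeneous_of_ghost[OF p])
  then show ?thesis by simp
qed

text \<open>
  The case \<open>b = 0\<close>, where only the first factor carries weight, serves to multiply nilpotent by
  arbitrary Witt vectors; the case \<open>b = 1\<close> serves to bound powers.
\<close>

lemma homogeneous_witt_mult_poly:
  "homogeneous (case_sum (\<lambda>i. a * p ^ i) (\<lambda>i. b * p ^ i)) ((a + b) * p ^ n) (witt_mult_poly p n)"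
proof -
  let ?w = "case_sum (\<lambda>i. a * p ^ i) (\<lambda>i. b * p ^ i)"
  have "homogeneous ?w (a * p ^ n) (ghost p n (\<lambda>i. zvar (Inl i)))"
    "homogeneous ?w (b * p ^ n) (ghost p n (\<lambda>i. zvar (Inr i)))" for n
  proof -
    show "homogeneous ?w (a * p ^ n) (ghost p n (\<lambda>i. zvar (Inl i)))"
      by (rule homogeneous_ghost[OF prime_gt_0_nat[OF p]]) (use homogeneous_zvar[of ?w "Inl _"] in simp)
    show "homogeneous ?w (b * p ^ n) (ghost p n (\<lambda>i. zvar (Inr i)))"
      by (rule homogeneous_ghost[OF prime_gt_0_nat[OF p]]) (use homogeneous_zvar[of ?w "Inr _"] in simp)
  qed
  then have "homogeneous ?w ((a + b) * p ^ n) (ghost p n (witt_mult_poly p))" for n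
    by (simp only: ghost_witt_mult_poly homogeneous_mult distrib_right)
  then show ?thesis by (rule homogeneous_of_ghost[OF p])
qed

lemma homogeneous_ghost_zvar: "homogeneous (\<lambda>i. p ^ i) (p ^ n) (ghost p n zvar)"
  using homogeneous_ghost[OF prime_gt_0_nat[OF p], of "\<lambda>i. p ^ i" 1 zvar n]
    homogeneous_zvar[of "\<lambda>i. p ^ i"] by simp

lemma homogeneous_witt_delta_poly: "homogeneous (\<lambda>i. p ^ i) (p ^ Suc n) (witt_delta_poly p n)"
proof -
  have "homogeneous (\<lambda>i. p ^ i) (p * p ^ n) (of_nat p * ghost p n (witt_delta_poly p))" for n
  proof -
    have "of_nat p * ghost p n (witt_delta_poly p) = ghost p (Suc n) zvar - ghost p n zvar ^ p"
      by (simp add: ghost_witt_delta_poly)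
    then show ?thesis
      using homogeneous_diff[OF homogeneous_ghost_zvar[of "Suc n"] homogeneous_power[OF homogeneous_ghost_zvar[of n], of p, folded power_Suc]]
      by simp
  qed
  then have "homogeneous (\<lambda>i. p ^ i) (p * p ^ n) (ghost p n (witt_delta_poly p))" for n
    using homogeneous_of_nat_mult[OF prime_gt_0_nat[OF p]] by blast
  then show ?thesis using homogeneous_of_ghost[OF p, of "\<lambda>i. p ^ i" p] by simp
qed

lemma homogeneous_theta: "homogeneous (\<lambda>i. p ^ i) (p ^ n) (theta n)"
proof -
  have "homogeneous (\<lambda>i. p ^ i) (p * k) (generic_frob f)" if "homogeneous (\<lambda>i. p ^ i) k f" for k f
    unfolding generic_frob_def
  proof (rule homogeneous_zsubst)
    show "homogeneous (\<lambda>i. p * p ^ i) (p * k) f"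
      using that by (rule homogeneous_scale)
    show "homogeneous (\<lambda>i. p ^ i) (p * p ^ i) (zvar i ^ p + of_nat p * zvar (Suc i))" for i
      using homogeneous_power[OF homogeneous_zvar[of "\<lambda>i. p ^ i" i], of p] homogeneous_zvar[of "\<lambda>i. p ^ i" "Suc i"]
        prime_gt_0_nat[OF p]
      by (intro homogeneous_add) (auto simp: homogeneous_of_nat_mult)
  qed
  then have "homogeneous (\<lambda>i. p ^ i) (p ^ n) ((generic_frob ^^ n) (zvar 0))" for n
    using homogeneous_zvar[of "\<lambda>i. p ^ i" 0] by (induction n) auto
  then show ?thesis
    using homogeneous_of_ghost[OF p, of "\<lambda>i. p ^ i" 1] by (simp add: ghost_theta_poly)
qed

end


section \<open>Homomorphisms of \<open>\<delta>\<close>-rings\<close>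

text \<open>
  Unlike \<^const>\<open>Hom_delta_Ring\<close>, this prescribes no values outside of the carrier and is closed under
  composition of functions.
\<close>

definition delta_hom :: "('a, 'm) dring_scheme \<Rightarrow> ('b, 'n) dring_scheme \<Rightarrow> ('a \<Rightarrow> 'b) set" where
  "delta_hom A B = {h \<in> ring_hom A B. \<forall>x\<in>carrier A. h (\<delta>\<^bsub>A\<^esub> x) = \<delta>\<^bsub>B\<^esub> (h x)}"

text \<open>
  The quotient \<open>((x + y)\<^sup>p - x\<^sup>p - y\<^sup>p) / p\<close>, written without division.
\<close>

definition frob_defect :: "nat \<Rightarrow> ('a, 'm) ring_scheme \<Rightarrow> 'a \<Rightarrow> 'a \<Rightarrow> 'a" where
  "frob_defect p A x y =
    (\<Oplus>\<^bsub>A\<^esub>i\<in>{1..p-1}. [((p choose i) div p)] \<cdot>\<^bsub>A\<^esub> (x [^]\<^bsub>A\<^esub> i \<otimes>\<^bsub>A\<^esub> y [^]\<^bsub>A\<^esub> (p - i)))"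

lemma (in cring) frob_defect_closed [simp]:
  "x \<in> carrier R \<Longrightarrow> y \<in> carrier R \<Longrightarrow> frob_defect p R x y \<in> carrier R"
  unfolding frob_defect_def by (rule finsum_closed) auto

lemma (in ring_hom_cring) hom_frob_defect:
  assumes "x \<in> carrier R" "y \<in> carrier R"
  shows "h (frob_defect p R x y) = frob_defect p S (h x) (h y)"
proof -
  have "h (frob_defect p R x y)
    = (\<Oplus>\<^bsub>S\<^esub>i\<in>{1..p-1}. h ([((p choose i) div p)] \<cdot> (x [^] i \<otimes> y [^] (p - i))))"
    unfolding frob_defect_def using assms by (subst hom_finsum) (auto simp: comp_def)
  also have "\<dots> = frob_defect p S (h x) (h y)"
    unfolding frob_defect_def using assms by (intro S.finsum_cong') auto
  finally show ?thesis .
qed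

lemma (in delta_ring) delta_add_defect:
  "x \<in> carrier A \<Longrightarrow> y \<in> carrier A \<Longrightarrow> \<delta> (x \<oplus> y) = \<delta> x \<oplus> \<delta> y \<ominus> frob_defect p A x y"
  unfolding frob_defect_def by (rule delta_add)

text \<open>
  This carries identities from polynomial rings, where they can be checked after multiplication by
  \<open>p\<close>, to arbitrary rings, and from a \<open>\<delta>\<close>-ring to its quotients.
\<close>

lemma delta_ring_of_surj:
  fixes A (structure) and B (structure)
  assumes A: "delta_ring p A" and surj: "h ` carrier A = carrier B"
    and mult: "\<And>x y. x \<in> carrier A \<Longrightarrow> y \<in> carrier A \<Longrightarrow> h (x \<otimes>\<^bsub>A\<^esub> y) = h x \<otimes>\<^bsub>B\<^esub> h y"
    and add: "\<And>x y. x \<in> carrier A \<Longrightarrow> y \<in> carrier A \<Longrightarrow> h (x \<oplus>\<^bsub>A\<^esub> y) = h x \<oplus>\<^bsub>B\<^esub> h y"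
    and one: "h \<one>\<^bsub>A\<^esub> = \<one>\<^bsub>B\<^esub>" and zero: "h \<zero>\<^bsub>A\<^esub> = \<zero>\<^bsub>B\<^esub>"
    and delta: "\<And>x. x \<in> carrier A \<Longrightarrow> h (\<delta>\<^bsub>A\<^esub> x) = \<delta>\<^bsub>B\<^esub> (h x)"
  shows "delta_ring p B" "h \<in> delta_hom A B"
proof -
  interpret A: delta_ring p A by fact
  have B: thesis if "y \<in> carrier B" "\<And>x. x \<in> carrier A \<Longrightarrow> y = h x \<Longrightarrow> thesis" for y thesis
    using that surj by auto
  have closed: "h x \<in> carrier B" if "x \<in> carrier A" for x using that surj by auto
  note pull = mult[symmetric] add[symmetric] one[symmetric] zero[symmetric]
  have "cring B"
  proof (intro cringI abelian_groupI comm_monoidI)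
    fix x assume "x \<in> carrier B"
    then obtain a where a: "a \<in> carrier A" "x = h a" by (rule B)
    then have "h (\<ominus>\<^bsub>A\<^esub> a) \<oplus>\<^bsub>B\<^esub> x = \<zero>\<^bsub>B\<^esub>" by (simp add: pull A.l_neg)
    then show "\<exists>y\<in>carrier B. y \<oplus>\<^bsub>B\<^esub> x = \<zero>\<^bsub>B\<^esub>" using a by (auto intro: closed)
  qed (auto elim!: B simp: pull closed A.a_ac A.m_ac A.l_distr A.r_distr)
  then have hom: "ring_hom_cring A B h"
    by (intro ring_hom_cring.intro ring_hom_cring_axioms.intro ring_hom_memI)
      (auto intro: closed A.is_cring simp: mult add one)
  interpret h: ring_hom_cring A B h by (rule hom)
  show "h \<in> delta_hom A B" by (simp add: delta_hom_def delta)
  show "delta_ring p B"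
  proof (intro delta_ring.intro delta_ring_axioms.intro \<open>cring B\<close> A.prime_p)
    show "\<delta>\<^bsub>B\<^esub> x \<in> carrier B" if "x \<in> carrier B" for x
      using that by (auto elim!: B simp: delta[symmetric] closed A.delta_closed)
    show "\<delta>\<^bsub>B\<^esub> \<zero>\<^bsub>B\<^esub> = \<zero>\<^bsub>B\<^esub>" using delta[of "\<zero>\<^bsub>A\<^esub>"] A.delta_zero zero by simp
    show "\<delta>\<^bsub>B\<^esub> \<one>\<^bsub>B\<^esub> = \<zero>\<^bsub>B\<^esub>" using delta[of "\<one>\<^bsub>A\<^esub>"] A.delta_one zero one by simp
    fix x y assume "x \<in> carrier B" "y \<in> carrier B"
    then obtain a b where a: "a \<in> carrier A" "x = h a" and b: "b \<in> carrier A" "y = h b"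
      by (metis B)
    have "\<delta>\<^bsub>B\<^esub> (x \<oplus>\<^bsub>B\<^esub> y) = h (\<delta>\<^bsub>A\<^esub> (a \<oplus>\<^bsub>A\<^esub> b))" using a b by (simp add: delta)
    also have "\<dots> = \<delta>\<^bsub>B\<^esub> x \<oplus>\<^bsub>B\<^esub> \<delta>\<^bsub>B\<^esub> y \<ominus>\<^bsub>B\<^esub> frob_defect p B x y"
      using a b by (simp add: A.delta_add_defect h.hom_frob_defect A.delta_closed delta)
    finally show "\<delta>\<^bsub>B\<^esub> (x \<oplus>\<^bsub>B\<^esub> y) = \<delta>\<^bsub>B\<^esub> x \<oplus>\<^bsub>B\<^esub> \<delta>\<^bsub>B\<^esub> y \<ominus>\<^bsub>B\<^esub>
      (\<Oplus>\<^bsub>B\<^esub>i\<in>{1..p-1}. [((p choose i) div p)] \<cdot>\<^bsub>B\<^esub> (x [^]\<^bsub>B\<^esub> i \<otimes>\<^bsub>B\<^esub> y [^]\<^bsub>B\<^esub> (p - i)))"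
      unfolding frob_defect_def .
    have "\<delta>\<^bsub>B\<^esub> (x \<otimes>\<^bsub>B\<^esub> y) = h (\<delta>\<^bsub>A\<^esub> (a \<otimes>\<^bsub>A\<^esub> b))" using a b by (simp add: delta)
    also have "\<dots> = x [^]\<^bsub>B\<^esub> p \<otimes>\<^bsub>B\<^esub> \<delta>\<^bsub>B\<^esub> y \<oplus>\<^bsub>B\<^esub> y [^]\<^bsub>B\<^esub> p \<otimes>\<^bsub>B\<^esub> \<delta>\<^bsub>B\<^esub> x \<oplus>\<^bsub>B\<^esub> [p] \<cdot>\<^bsub>B\<^esub> (\<delta>\<^bsub>B\<^esub> x \<otimes>\<^bsub>B\<^esub> \<delta>\<^bsub>B\<^esub> y)"
      using a b by (simp add: A.delta_mult A.delta_closed delta[symmetric])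
    finally show "\<delta>\<^bsub>B\<^esub> (x \<otimes>\<^bsub>B\<^esub> y) = x [^]\<^bsub>B\<^esub> p \<otimes>\<^bsub>B\<^esub> \<delta>\<^bsub>B\<^esub> y \<oplus>\<^bsub>B\<^esub> y [^]\<^bsub>B\<^esub> p \<otimes>\<^bsub>B\<^esub> \<delta>\<^bsub>B\<^esub> x \<oplus>\<^bsub>B\<^esub> [p] \<cdot>\<^bsub>B\<^esub> (\<delta>\<^bsub>B\<^esub> x \<otimes>\<^bsub>B\<^esub> \<delta>\<^bsub>B\<^esub> y)" .
  qed
qed

lemma (in delta_ring) delta_funpow_closed:
  "x \<in> carrier A \<Longrightarrow> (delta A ^^ k) x \<in> carrier A"
  by (induction k) (auto simp: delta_closed)

lemma delta_hom_funpow: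
  assumes "delta_ring p A" "h \<in> delta_hom A B" "x \<in> carrier A"
  shows "h ((delta A ^^ k) x) = (delta B ^^ k) (h x)"
  using assms delta_ring.delta_funpow_closed[OF assms(1,3)]
  by (induction k) (auto simp: delta_hom_def)

lemma delta_hom_frobenius:
  assumes "delta_ring p A" "delta_ring p B" "h \<in> delta_hom A B" "x \<in> carrier A"
  shows "h (frobenius p A x) = frobenius p B (h x)"
proof -
  interpret A: delta_ring p A by fact
  interpret B: delta_ring p B by fact
  interpret h: ring_hom_cring A B h
    using assms(3) by unfold_locales (simp add: delta_hom_def)
  show ?thesis
    using assms(3,4) by (simp add: frobenius_def A.delta_closed delta_hom_def)
qed

section \<open>The ring of Witt vectors\<close>

lemma witt_carrier: "x \<in> carrier (witt p R) \<longleftrightarrow> (\<forall>n. x n \<in> carrier R)"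
  by (simp add: witt_def)

lemma witt_mult: "x \<otimes>\<^bsub>witt p R\<^esub> y = (\<lambda>n. zpoly_eval R (case_sum x y) (witt_mult_poly p n))"
  by (simp add: witt_def)

lemma witt_add: "x \<oplus>\<^bsub>witt p R\<^esub> y = (\<lambda>n. zpoly_eval R (case_sum x y) (witt_add_poly p n))"
  by (simp add: witt_def)

lemma witt_one: "\<one>\<^bsub>witt p R\<^esub> = (\<lambda>n. if n = 0 then \<one>\<^bsub>R\<^esub> else \<zero>\<^bsub>R\<^esub>)"
  by (simp add: witt_def)

lemma witt_zero: "\<zero>\<^bsub>witt p R\<^esub> = (\<lambda>n. \<zero>\<^bsub>R\<^esub>)"
  by (simp add: witt_def)

lemma witt_delta: "\<delta>\<^bsub>witt p R\<^esub> x = (\<lambda>n. zpoly_eval R x (witt_delta_poly p n))"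
  by (simp add: witt_def)

context ring_hom_cring
begin

lemma witt_map_binary:
  assumes "x \<in> carrier (witt p R)" "y \<in> carrier (witt p R)"
  shows "h \<circ> (x \<otimes>\<^bsub>witt p R\<^esub> y) = (h \<circ> x) \<otimes>\<^bsub>witt p S\<^esub> (h \<circ> y)"
    and "h \<circ> (x \<oplus>\<^bsub>witt p R\<^esub> y) = (h \<circ> x) \<oplus>\<^bsub>witt p S\<^esub> (h \<circ> y)"
proof -
  have xy: "case_sum x y i \<in> carrier R" for i
    using assms by (auto simp: witt_carrier split: sum.split)
  have "(\<lambda>i. h (case_sum x y i)) = case_sum (\<lambda>i. h (x i)) (\<lambda>i. h (y i))"
    by (auto simp: fun_eq_iff split: sum.split)
  then have "h (zpoly_eval R (case_sum x y) f) = zpoly_eval S (case_sum (\<lambda>i. h (x i)) (\<lambda>i. h (y i))) f" for f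
    using zpoly_eval_natural[OF ring_hom_cring_axioms, of "case_sum x y"] xy by simp
  then show "h \<circ> (x \<otimes>\<^bsub>witt p R\<^esub> y) = (h \<circ> x) \<otimes>\<^bsub>witt p S\<^esub> (h \<circ> y)"
    "h \<circ> (x \<oplus>\<^bsub>witt p R\<^esub> y) = (h \<circ> x) \<oplus>\<^bsub>witt p S\<^esub> (h \<circ> y)"
    by (simp_all add: fun_eq_iff witt_mult witt_add comp_def)
qed

lemma witt_map_unary:
  assumes "x \<in> carrier (witt p R)"
  shows "h \<circ> (\<delta>\<^bsub>witt p R\<^esub> x) = \<delta>\<^bsub>witt p S\<^esub> (h \<circ> x)"
    and "h \<circ> (witt_F p R x) = witt_F p S (h \<circ> x)"
    and "h \<circ> x \<in> carrier (witt p S)"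
  using assms zpoly_eval_natural[OF ring_hom_cring_axioms, of x]
  by (simp_all add: fun_eq_iff witt_delta witt_F_def witt_carrier comp_def)

lemma witt_map_consts:
  "h \<circ> \<one>\<^bsub>witt p R\<^esub> = \<one>\<^bsub>witt p S\<^esub>" "h \<circ> \<zero>\<^bsub>witt p R\<^esub> = \<zero>\<^bsub>witt p S\<^esub>"
  by (simp_all add: fun_eq_iff witt_one witt_zero)

end

text \<open>
  The variables are indexed by the elements of the ring. The section \<open>l\<close> preserves \<open>0\<close> in order that
  Witt vectors with disjoint supports have lifts with disjoint supports.
\<close>

lemma (in cring) zpoly_cover:
  obtains \<pi> :: "'a zpoly \<Rightarrow> 'a" and l :: "'a \<Rightarrow> 'a zpoly"
  where "ring_hom_cring type_ring R \<pi>" "\<And>a. a \<in> carrier R \<Longrightarrow> \<pi> (l a) = a" "l \<zero> = 0"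
proof
  let ?x = "\<lambda>a. if a \<in> carrier R then a else \<zero>"
  show hom: "ring_hom_cring type_ring R (zpoly_eval R ?x)"
    by (rule ring_hom_zpoly_eval) auto
  interpret \<pi>: ring_hom_cring type_ring R "zpoly_eval R ?x" by (rule hom)
  show "zpoly_eval R ?x ((\<lambda>a. if a = \<zero> then 0 else zvar a) a) = a" if "a \<in> carrier R" for a
    using that \<pi>.hom_zero by (auto simp: zpoly_eval_zvar)
qed simp

context
  fixes p :: nat
  assumes p: "prime p"
begin

lemma ghost_witt:
  fixes x y :: "nat \<Rightarrow> 'c::comm_ring_1"
  shows "ghost p n (x \<otimes>\<^bsub>witt p type_ring\<^esub> y) = ghost p n x * ghost p n y"
    and "ghost p n (x \<oplus>\<^bsub>witt p type_ring\<^esub> y) = ghost p n x + ghost p n y"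
    and "ghost p n \<one>\<^bsub>witt p type_ring\<^esub> = (1 :: 'c)"
    and "ghost p n \<zero>\<^bsub>witt p type_ring\<^esub> = (0 :: 'c)"
    and "ghost p (Suc n) x = ghost p n x ^ p + of_nat p * ghost p n (\<delta>\<^bsub>witt p type_ring\<^esub> x)"
    and "ghost p n (witt_F p type_ring x) = ghost p (Suc n) x"
proof -
  show "ghost p n (x \<otimes>\<^bsub>witt p type_ring\<^esub> y) = ghost p n x * ghost p n y"
    by (simp add: witt_mult zsubst_ghost[symmetric] ghost_witt_mult_poly[OF p]) (simp add: zsubst_ghost)
  show "ghost p n (x \<oplus>\<^bsub>witt p type_ring\<^esub> y) = ghost p n x + ghost p n y"
    by (simp add: witt_add zsubst_ghost[symmetric] ghost_witt_add_poly[OF p]) (simp add: zsubst_ghost)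
  show "ghost p n \<zero>\<^bsub>witt p type_ring\<^esub> = (0 :: 'c)"
    using prime_gt_0_nat[OF p] by (simp add: ghost_def witt_zero zero_power)
  show "ghost p n (witt_F p type_ring x) = ghost p (Suc n) x"
    by (simp add: witt_F_def zsubst_ghost[symmetric] ghost_witt_F_poly[OF p]) (simp add: zsubst_ghost)
  show "ghost p (Suc n) x = ghost p n x ^ p + of_nat p * ghost p n (\<delta>\<^bsub>witt p type_ring\<^esub> x)"
    using arg_cong[OF ghost_witt_delta_poly[OF p, of n], of "zsubst x"]
    by (simp add: witt_delta zsubst_ghost)
  have "ghost p n (\<lambda>n. if n = 0 then 1 else 0) = (\<Sum>i\<in>{..n}. if i = 0 then (1::'c) else 0)"
    unfolding ghost_def by (rule sum.cong) (use prime_gt_0_nat[OF p] in \<open>auto simp: zero_power\<close>)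
  then show "ghost p n \<one>\<^bsub>witt p type_ring\<^esub> = (1 :: 'c)"
    by (simp add: witt_one cong: if_cong)
qed

text \<open>
  Every axiom is an identity between ghost components, after multiplication by \<open>p\<close> if \<open>\<delta>\<close> occurs.
  Dwork's congruences are stable under negation, which provides additive inverses.
\<close>

lemma delta_ring_witt_zpoly: "delta_ring p (witt p (type_ring :: 'v zpoly ring))"
proof -
  let ?W = "witt p (type_ring :: 'v zpoly ring)"
  have C [simp]: "x \<in> carrier ?W" for x by (simp add: witt_carrier)
  note inj = ghost_inj[OF p]
  have neg: "\<exists>y. y \<oplus>\<^bsub>?W\<^esub> x = \<zero>\<^bsub>?W\<^esub>" for x
  proof -
    have "dwork p (zsubst (\<lambda>i. zvar i ^ p)) (\<lambda>n. - ghost p n x)"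
      by (intro dwork_minus p frobenius_lift_zvar_power dwork_ghost_zpoly)
    then obtain y where "\<And>n. ghost p n y = - ghost p n x"
      using dwork_imp_ghost[OF p frobenius_lift_zvar_power[OF p]] by blast
    then have "y \<oplus>\<^bsub>?W\<^esub> x = \<zero>\<^bsub>?W\<^esub>" by (intro inj) (simp add: ghost_witt)
    then show ?thesis by blast
  qed
  have W: "cring ?W"
  proof (intro cringI abelian_groupI comm_monoidI)
    show "\<exists>y\<in>carrier ?W. y \<oplus>\<^bsub>?W\<^esub> x = \<zero>\<^bsub>?W\<^esub>" for x
      using neg[of x] C by metis
  qed (auto intro!: inj simp: ghost_witt algebra_simps)
  have hom: "ring_hom_cring ?W type_ring (ghost p n)" for n
    by (intro ring_hom_cring.intro ring_hom_cring_axioms.intro ring_hom_memI W cring_type_ring)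
      (auto simp: ghost_witt)
  have cancel: "of_nat p * a = of_nat p * b \<Longrightarrow> a = b" for a b :: "'v zpoly"
    using zpoly_mult_cancel prime_gt_0_nat[OF p] by blast
  have delta: "of_nat p * ghost p n (\<delta>\<^bsub>?W\<^esub> x) = ghost p (Suc n) x - ghost p n x ^ p" for n x
    by (simp add: ghost_witt(5))
  show ?thesis
  proof (intro delta_ring.intro delta_ring_axioms.intro W p)
    show "\<delta>\<^bsub>?W\<^esub> \<zero>\<^bsub>?W\<^esub> = \<zero>\<^bsub>?W\<^esub>"
      by (rule inj, rule cancel) (use prime_gt_0_nat[OF p] in \<open>simp add: delta ghost_witt(1-4) zero_power\<close>)
    show "\<delta>\<^bsub>?W\<^esub> \<one>\<^bsub>?W\<^esub> = \<zero>\<^bsub>?W\<^esub>"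
      by (rule inj, rule cancel) (simp add: delta ghost_witt(1-4))
    fix x y
    show "\<delta>\<^bsub>?W\<^esub> (x \<oplus>\<^bsub>?W\<^esub> y) = \<delta>\<^bsub>?W\<^esub> x \<oplus>\<^bsub>?W\<^esub> \<delta>\<^bsub>?W\<^esub> y \<ominus>\<^bsub>?W\<^esub>
      (\<Oplus>\<^bsub>?W\<^esub>i\<in>{1..p-1}. [((p choose i) div p)] \<cdot>\<^bsub>?W\<^esub> (x [^]\<^bsub>?W\<^esub> i \<otimes>\<^bsub>?W\<^esub> y [^]\<^bsub>?W\<^esub> (p - i)))"
      (is "?l = ?r")
    proof (rule inj, rule cancel)
      fix n
      interpret g: ring_hom_cring ?W type_ring "ghost p n" by (rule hom)
      have "of_nat p * ghost p n ?r = of_nat p * ghost p n (\<delta>\<^bsub>?W\<^esub> x) + of_nat p * ghost p n (\<delta>\<^bsub>?W\<^esub> y)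
        - of_nat p * (\<Sum>i\<in>{1..p-1}. of_nat ((p choose i) div p) * (ghost p n x ^ i * ghost p n y ^ (p - i)))"
        by (simp add: comp_def algebra_simps)
      also have "\<dots> = ghost p (Suc n) x + ghost p (Suc n) y - (ghost p n x + ghost p n y) ^ p"
        unfolding delta binomial_prime_expansion[OF p] by simp
      also have "\<dots> = of_nat p * ghost p n ?l"
        unfolding delta by (simp add: ghost_witt(2))
      finally show "of_nat p * ghost p n ?l = of_nat p * ghost p n ?r" ..
    qed
    show "\<delta>\<^bsub>?W\<^esub> (x \<otimes>\<^bsub>?W\<^esub> y) = x [^]\<^bsub>?W\<^esub> p \<otimes>\<^bsub>?W\<^esub> \<delta>\<^bsub>?W\<^esub> y \<oplus>\<^bsub>?W\<^esub> y [^]\<^bsub>?W\<^esub> p \<otimes>\<^bsub>?W\<^esub> \<delta>\<^bsub>?W\<^esub> x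
      \<oplus>\<^bsub>?W\<^esub> [p] \<cdot>\<^bsub>?W\<^esub> (\<delta>\<^bsub>?W\<^esub> x \<otimes>\<^bsub>?W\<^esub> \<delta>\<^bsub>?W\<^esub> y)" (is "?l = ?r")
    proof (rule inj, rule cancel)
      fix n
      interpret g: ring_hom_cring ?W type_ring "ghost p n" by (rule hom)
      have "of_nat p * ghost p n ?r = ghost p n x ^ p * (of_nat p * ghost p n (\<delta>\<^bsub>?W\<^esub> y))
        + ghost p n y ^ p * (of_nat p * ghost p n (\<delta>\<^bsub>?W\<^esub> x))
        + (of_nat p * ghost p n (\<delta>\<^bsub>?W\<^esub> x)) * (of_nat p * ghost p n (\<delta>\<^bsub>?W\<^esub> y))"
        by (simp add: algebra_simps)
      also have "\<dots> = of_nat p * ghost p n ?l"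
        unfolding delta by (simp add: ghost_witt(1) power_mult_distrib algebra_simps)
      finally show "of_nat p * ghost p n ?l = of_nat p * ghost p n ?r" ..
    qed
  qed auto
qed

context
  fixes R :: "('a, 'm) ring_scheme" (structure)
  assumes R: "cring R"
begin

interpretation R: cring R by (rule R)

text \<open>
  The operations on Witt vectors are given by polynomials, so a surjection of rings induces a
  surjection of Witt vectors that respects them.
\<close>

lemma witt_cover:
  obtains \<pi> :: "'a zpoly \<Rightarrow> 'a" and l :: "'a \<Rightarrow> 'a zpoly"
  where "ring_hom_cring type_ring R \<pi>" "\<And>x. x \<in> carrier (witt p R) \<Longrightarrow> \<pi> \<circ> (l \<circ> x) = x" "l \<zero> = 0"
    "(\<circ>) \<pi> ` carrier (witt p type_ring) = carrier (witt p R)"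
    "delta_ring p (witt p R)" "(\<circ>) \<pi> \<in> delta_hom (witt p type_ring) (witt p R)"
proof -
  obtain \<pi> :: "'a zpoly \<Rightarrow> 'a" and l :: "'a \<Rightarrow> 'a zpoly"
    where hom: "ring_hom_cring type_ring R \<pi>" and l: "\<And>a. a \<in> carrier R \<Longrightarrow> \<pi> (l a) = a" "l \<zero> = 0"
    by (rule R.zpoly_cover) blast
  interpret \<pi>: ring_hom_cring type_ring R \<pi> by (rule hom)
  have lift: "\<pi> \<circ> (l \<circ> x) = x" if "x \<in> carrier (witt p R)" for x
    using that by (auto simp: witt_carrier l fun_eq_iff)
  have surj: "(\<circ>) \<pi> ` carrier (witt p type_ring) = carrier (witt p R)"
  proof (intro equalityI subsetI)
    show "x \<in> (\<circ>) \<pi> ` carrier (witt p type_ring)" if "x \<in> carrier (witt p R)" for x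
      using lift[OF that] by (intro image_eqI[of _ _ "l \<circ> x"]) (auto simp: witt_carrier)
  qed (auto intro: \<pi>.witt_map_unary)
  have W: "delta_ring p (witt p R)" "(\<circ>) \<pi> \<in> delta_hom (witt p type_ring) (witt p R)"
    by (rule delta_ring_of_surj[OF delta_ring_witt_zpoly surj];
        simp add: \<pi>.witt_map_binary \<pi>.witt_map_consts \<pi>.witt_map_unary)+
  show thesis
    by (rule that[OF hom lift l(2) surj W])
qed

lemma delta_ring_witt: "delta_ring p (witt p R)"
  by (rule witt_cover)

interpretation W: delta_ring p "witt p R" by (rule delta_ring_witt)

lemma frobenius_witt:
  assumes x: "x \<in> carrier (witt p R)"
  shows "frobenius p (witt p R) x = witt_F p R x"
proof -
  obtain \<pi> l where \<pi>: "ring_hom_cring type_ring R \<pi>" "\<pi> \<circ> (l \<circ> x) = x"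
    "(\<circ>) \<pi> \<in> delta_hom (witt p (type_ring :: 'a zpoly ring)) (witt p R)"
    by (rule witt_cover) (use x in blast)
  let ?W = "witt p (type_ring :: 'a zpoly ring)" and ?y = "l \<circ> x"
  interpret WC: delta_ring p ?W by (rule delta_ring_witt_zpoly)
  have y: "?y \<in> carrier ?W" by (simp add: witt_carrier)
  have "frobenius p ?W ?y = witt_F p type_ring ?y"
  proof (rule ghost_inj[OF p])
    fix n
    interpret g: ring_hom_cring ?W type_ring "ghost p n"
      by (intro ring_hom_cring.intro ring_hom_cring_axioms.intro ring_hom_memI WC.is_cring cring_type_ring)
        (auto simp: ghost_witt)
    show "ghost p n (frobenius p ?W ?y) = ghost p n (witt_F p type_ring ?y)"
      using y by (simp add: frobenius_def WC.delta_closed ghost_witt(6) ghost_witt(5)[of n ?y])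
  qed
  then have "\<pi> \<circ> frobenius p ?W ?y = \<pi> \<circ> witt_F p type_ring ?y" by simp
  then show ?thesis
    using delta_hom_frobenius[OF delta_ring_witt_zpoly delta_ring_witt \<pi>(3) y]
      ring_hom_cring.witt_map_unary(2)[OF \<pi>(1) y] \<pi>(2)
    by simp
qed

lemma witt_zeroth_hom: "(\<lambda>x. x 0) \<in> ring_hom (witt p R) R"
proof (rule ring_hom_memI)
  fix x y assume x: "x \<in> carrier (witt p R)" and y: "y \<in> carrier (witt p R)"
  show "x 0 \<in> carrier R" using x by (simp add: witt_carrier)
  have xy: "case_sum x y i \<in> carrier R" for i
    using x y by (auto simp: witt_carrier split: sum.split)
  note e = R.zpoly_eval_zvar[of "case_sum x y", OF xy] R.zpoly_eval_add[of "case_sum x y", OF xy]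
    R.zpoly_eval_mult[of "case_sum x y", OF xy]
  show "(x \<otimes>\<^bsub>witt p R\<^esub> y) 0 = x 0 \<otimes> y 0"
    using ghost_witt_mult_poly[OF p, of 0] by (simp add: witt_mult e)
  show "(x \<oplus>\<^bsub>witt p R\<^esub> y) 0 = x 0 \<oplus> y 0"
    using ghost_witt_add_poly[OF p, of 0] by (simp add: witt_add e)
qed (simp add: witt_one)

text \<open>
  Over integer polynomials, the ghost components of the iterates \<open>\<delta>\<^sup>k(x)\<close> form an array as in
  \<open>ghost_theta\<close>; the general case is a specialisation. As a consequence, a \<open>\<delta>\<close>-homomorphism to Witt vectors is determined by its composite with the zeroth component.
\<close>

lemma witt_eq_theta:
  assumes x: "x \<in> carrier (witt p R)"
  shows "x n = zpoly_eval R (\<lambda>k. (delta (witt p R) ^^ k) x 0) (theta p n)"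
proof -
  obtain \<pi> l where \<pi>: "ring_hom_cring type_ring R \<pi>" "\<pi> \<circ> (l \<circ> x) = x"
    "(\<circ>) \<pi> \<in> delta_hom (witt p (type_ring :: 'a zpoly ring)) (witt p R)"
    by (rule witt_cover) (use x in blast)
  let ?W = "witt p (type_ring :: 'a zpoly ring)" and ?y = "l \<circ> x"
  have y: "?y \<in> carrier ?W" by (simp add: witt_carrier)
  let ?e = "\<lambda>n k. ghost p n ((delta ?W ^^ k) ?y)"
  have "?e (Suc n) k = ?e n k ^ p + of_nat p * ?e n (Suc k)" for n k
    by (simp add: ghost_witt(5)[of n])
  then have "ghost p n (\<lambda>i. zsubst (?e 0) (theta p i)) = ?e n 0" for n
    by (rule ghost_theta[OF p])
  then have "(\<lambda>i. zsubst (?e 0) (theta p i)) = ?y"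
    by (intro ghost_inj[OF p]) simp
  from fun_cong[OF this, of n] have "?y n = zsubst (\<lambda>k. (delta ?W ^^ k) ?y 0) (theta p n)"
    by simp
  then have "\<pi> (?y n) = \<pi> (zsubst (\<lambda>k. (delta ?W ^^ k) ?y 0) (theta p n))" by (rule arg_cong)
  moreover have "\<pi> (?y n) = x n" using fun_cong[OF \<pi>(2), of n] by simp
  ultimately have "x n = \<pi> (zsubst (\<lambda>k. (delta ?W ^^ k) ?y 0) (theta p n))" by (rule trans[OF sym, rotated])
  also have "\<dots> = zpoly_eval R (\<lambda>k. (\<pi> \<circ> (delta ?W ^^ k) ?y) 0) (theta p n)"
    using zsubst_natural[OF \<pi>(1)] by simp
  also have "(\<lambda>k. (\<pi> \<circ> (delta ?W ^^ k) ?y) 0) = (\<lambda>k. (delta (witt p R) ^^ k) x 0)"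
    using delta_hom_funpow[OF delta_ring_witt_zpoly \<pi>(3) y] \<pi>(2) by simp
  finally show ?thesis .
qed

text \<open>
  If one of \<open>x\<^sub>i\<close> and \<open>y\<^sub>i\<close> is \<open>0\<close>, then powers of \<open>x\<^sub>i + y\<^sub>i\<close> are sums of powers, so the ghost components of
  the componentwise sum are the sums of the ghost components.
\<close>

lemma witt_add_disjoint:
  assumes x: "x \<in> carrier (witt p R)" and y: "y \<in> carrier (witt p R)"
    and disj: "\<And>n. x n = \<zero> \<or> y n = \<zero>"
  shows "x \<oplus>\<^bsub>witt p R\<^esub> y = (\<lambda>n. x n \<oplus> y n)"
proof -
  obtain \<pi> :: "'a zpoly \<Rightarrow> 'a" and l where \<pi>: "ring_hom_cring type_ring R \<pi>" "\<pi> \<circ> (l \<circ> x) = x" "\<pi> \<circ> (l \<circ> y) = y"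
    "l \<zero> = 0"
    by (rule witt_cover) (use x y in blast)
  interpret \<pi>: ring_hom_cring type_ring R \<pi> by (rule \<pi>)
  let ?W = "witt p (type_ring :: 'a zpoly ring)" and ?x = "l \<circ> x" and ?y = "l \<circ> y"
  have C: "z \<in> carrier ?W" for z by (simp add: witt_carrier)
  have "?x \<oplus>\<^bsub>?W\<^esub> ?y = (\<lambda>n. ?x n + ?y n)"
  proof (rule ghost_inj[OF p])
    fix n
    have "(l (x i) + l (y i)) ^ p ^ k = l (x i) ^ p ^ k + l (y i) ^ p ^ k" for i k
      using disj[of i] \<pi>(4) prime_gt_0_nat[OF p] by (auto simp: zero_power)
    then show "ghost p n (?x \<oplus>\<^bsub>?W\<^esub> ?y) = ghost p n (\<lambda>n. ?x n + ?y n)"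
      unfolding ghost_witt(2) by (simp add: ghost_def sum.distrib algebra_simps)
  qed
  then have "\<pi> \<circ> (?x \<oplus>\<^bsub>?W\<^esub> ?y) = (\<lambda>n. (\<pi> \<circ> ?x) n \<oplus> (\<pi> \<circ> ?y) n)"
    using \<pi>.hom_add by (auto simp: fun_eq_iff)
  then show ?thesis using \<pi>.witt_map_binary(2)[OF C C] \<pi>(2,3) by simp
qed

end

end


section \<open>Nilpotent Witt vectors of finite length\<close>

lemma (in ring_hom_cring) nilpotent_hom: "nilpotent R x \<Longrightarrow> nilpotent S (h x)"
  by (auto simp: nilpotent_def) (metis hom_nat_power hom_zero)

lemma witt_V_teichmuller:
  "(witt_V R ^^ i) (teichmuller R a) = (\<lambda>n. if n = i then a else \<zero>\<^bsub>R\<^esub>)"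
  by (induction i) (auto simp: teichmuller_def witt_V_def fun_eq_iff split: nat.split)

context
  fixes p :: nat and R :: "('a, 'm) ring_scheme" (structure)
  assumes p: "prime p" and R: "cring R"
begin

interpretation R: cring R by (rule R)
interpretation W: delta_ring p "witt p R" by (rule delta_ring_witt[OF p R])

text \<open>
  The summands \<open>V\<^sup>i[x\<^sub>i]\<close> have disjoint supports, so their sum is formed componentwise.
\<close>

lemma witt_hat_iff:
  "x \<in> witt_hat p R \<longleftrightarrow> (\<forall>n. nilpotent R (x n)) \<and> finite {n. x n \<noteq> \<zero>}"
proof -
  have sum: "(\<Oplus>\<^bsub>witt p R\<^esub>i\<in>J. (witt_V R ^^ i) (teichmuller R (x i))) = (\<lambda>n. if n \<in> J then x n else \<zero>)"
    if "finite J" and x: "\<And>i. x i \<in> carrier R" for J x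
    using \<open>finite J\<close>
  proof induction
    case empty
    then show ?case by (simp add: witt_zero)
  next
    case (insert i J)
    have "(\<lambda>n. if n = i then x i else \<zero>) \<oplus>\<^bsub>witt p R\<^esub> (\<lambda>n. if n \<in> J then x n else \<zero>)
      = (\<lambda>n. if n \<in> insert i J then x n else \<zero>)"
      using insert.hyps x by (subst witt_add_disjoint[OF p R]) (auto simp: witt_carrier)
    then show ?case
      using insert x by (subst W.finsum_insert) (auto simp: witt_V_teichmuller witt_carrier)
  qed
  define t where "t x = (\<Oplus>\<^bsub>witt p R\<^esub>i\<in>{i. x i \<noteq> \<zero>}. (witt_V R ^^ i) (teichmuller R (x i)))" for x
  have t: "t x = x" if "\<forall>i. nilpotent R (x i)" "finite {i. x i \<noteq> \<zero>}" for x
    unfolding t_def using that by (subst sum) (auto simp: nilpotent_def)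
  have "witt_hat p R = {t x | x. (\<forall>i. nilpotent R (x i)) \<and> finite {i. x i \<noteq> \<zero>}}"
    by (simp add: witt_hat_def t_def)
  also have "\<dots> = {x. (\<forall>i. nilpotent R (x i)) \<and> finite {i. x i \<noteq> \<zero>}}"
  proof (intro Collect_cong iffI)
    fix x :: "nat \<Rightarrow> 'a" assume x: "(\<forall>i. nilpotent R (x i)) \<and> finite {i. x i \<noteq> \<zero>}"
    then show "\<exists>y. x = t y \<and> (\<forall>i. nilpotent R (y i)) \<and> finite {i. y i \<noteq> \<zero>}"
      using t[of x] by (intro exI[of _ x]) simp
  next
    fix x :: "nat \<Rightarrow> 'a" assume "\<exists>y. x = t y \<and> (\<forall>i. nilpotent R (y i)) \<and> finite {i. y i \<noteq> \<zero>}"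
    then obtain y where y: "x = t y" "\<forall>i. nilpotent R (y i)" "finite {i. y i \<noteq> \<zero>}" by blast
    then show "(\<forall>i. nilpotent R (x i)) \<and> finite {i. x i \<noteq> \<zero>}" unfolding y(1) t[OF y(2,3)] by blast
  qed
  finally show ?thesis by simp
qed

text \<open>
  For large \<open>n\<close> the weight of \<open>g n\<close> is so large that its value vanishes; for fixed \<open>n\<close> the same happens
  to a high power of \<open>g n\<close>.
\<close>

lemma homogeneous_eval_hat:
  assumes x: "\<And>i. x i \<in> carrier R"
    and nil: "\<And>i. w i > 0 \<Longrightarrow> nilpotent R (x i)"
    and fin: "finite {i. w i > 0 \<and> x i \<noteq> \<zero>}"
    and g: "\<And>n. homogeneous w (c * p ^ n) (g n)" and c: "c > 0"
  shows "(\<lambda>n. zpoly_eval R x (g n)) \<in> witt_hat p R"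
proof -
  obtain K where K: "\<And>k f. k \<ge> K \<Longrightarrow> homogeneous w k f \<Longrightarrow> zpoly_eval R x f = \<zero>"
    using R.homogeneous_eval_eventually_zero[OF x nil fin] by blast
  interpret e: ring_hom_cring type_ring R "zpoly_eval R x" by (rule R.ring_hom_zpoly_eval[OF x])
  have p1: "p > 1" using p by (rule prime_gt_1_nat)
  have "nilpotent R (zpoly_eval R x (g n))" for n
  proof -
    have "K * 1 \<le> K * (c * p ^ n)" using c p1 by (intro mult_le_mono) auto
    then have "K \<le> K * (c * p ^ n)" by (simp only: mult_1_right)
    then have "zpoly_eval R x (g n ^ K) = \<zero>" by (rule K) (rule homogeneous_power[OF g])
    then show ?thesis
      using e.hom_nat_power[of "g n" K] by (auto simp: nilpotent_def x)
  qed
  moreover have zero: "zpoly_eval R x (g n) = \<zero>" if "n \<ge> K" for n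
  proof (rule K[OF _ g])
    have "n < p ^ n" using p1 by (intro power_gt_expt) simp
    also have "\<dots> \<le> c * p ^ n" using c by simp
    finally show "K \<le> c * p ^ n" using that by simp
  qed
  have "{n. zpoly_eval R x (g n) \<noteq> \<zero>} \<subseteq> {..<K}"
  proof
    fix n assume "n \<in> {n. zpoly_eval R x (g n) \<noteq> \<zero>}"
    then have "\<not> n \<ge> K" using zero[of n] by blast
    then show "n \<in> {..<K}" by simp
  qed
  then have "finite {n. zpoly_eval R x (g n) \<noteq> \<zero>}" by (rule finite_subset) simp
  ultimately show ?thesis by (simp add: witt_hat_iff)
qed

lemma witt_hat_carrier: "x \<in> witt_hat p R \<Longrightarrow> x \<in> carrier (witt p R)"
  by (auto simp: witt_hat_iff witt_carrier nilpotent_def)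

lemma witt_hat_add:
  assumes "x \<in> witt_hat p R" "y \<in> witt_hat p R"
  shows "x \<oplus>\<^bsub>witt p R\<^esub> y \<in> witt_hat p R"
  unfolding witt_add
proof (rule homogeneous_eval_hat[where w = "case_sum (\<lambda>i. p ^ i) (\<lambda>i. p ^ i)" and c = 1])
  have "{i. case_sum x y i \<noteq> \<zero>} \<subseteq> Inl ` {n. x n \<noteq> \<zero>} \<union> Inr ` {n. y n \<noteq> \<zero>}"
  proof
    fix i assume "i \<in> {i. case_sum x y i \<noteq> \<zero>}"
    then show "i \<in> Inl ` {n. x n \<noteq> \<zero>} \<union> Inr ` {n. y n \<noteq> \<zero>}" by (cases i) auto
  qed
  then have "finite {i. case_sum x y i \<noteq> \<zero>}"
    by (rule finite_subset) (use assms in \<open>auto simp: witt_hat_iff\<close>)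
  then show "finite {i. 0 < (case i of Inl i \<Rightarrow> p ^ i | Inr i \<Rightarrow> p ^ i) \<and> case_sum x y i \<noteq> \<zero>}"
    by (rule rev_finite_subset) auto
qed (use assms homogeneous_witt_add_poly[OF p] in \<open>auto simp: witt_hat_iff nilpotent_def split: sum.split\<close>)

lemma witt_hat_mult:
  assumes "x \<in> witt_hat p R" "y \<in> carrier (witt p R)"
  shows "x \<otimes>\<^bsub>witt p R\<^esub> y \<in> witt_hat p R"
  unfolding witt_mult
proof (rule homogeneous_eval_hat[where w = "case_sum (\<lambda>i. 1 * p ^ i) (\<lambda>i. 0 * p ^ i)" and c = "1 + 0"])
  have "{i. 0 < (case i of Inl i \<Rightarrow> 1 * p ^ i | Inr i \<Rightarrow> 0 * p ^ i) \<and> case_sum x y i \<noteq> \<zero>} \<subseteq> Inl ` {n. x n \<noteq> \<zero>}"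
  proof
    fix i assume "i \<in> {i. 0 < (case i of Inl i \<Rightarrow> 1 * p ^ i | Inr i \<Rightarrow> 0 * p ^ i) \<and> case_sum x y i \<noteq> \<zero>}"
    then show "i \<in> Inl ` {n. x n \<noteq> \<zero>}" by (cases i) auto
  qed
  then show "finite {i. 0 < (case i of Inl i \<Rightarrow> 1 * p ^ i | Inr i \<Rightarrow> 0 * p ^ i) \<and> case_sum x y i \<noteq> \<zero>}"
    by (rule finite_subset) (use assms in \<open>auto simp: witt_hat_iff\<close>)
  show "homogeneous (case_sum (\<lambda>i. 1 * p ^ i) (\<lambda>i. 0 * p ^ i)) ((1 + 0) * p ^ n) (witt_mult_poly p n)" for n
    by (rule homogeneous_witt_mult_poly[OF p])
qed (use assms in \<open>auto simp: witt_hat_iff nilpotent_def witt_carrier split: sum.splits\<close>)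

lemma witt_hat_delta:
  assumes "x \<in> witt_hat p R"
  shows "\<delta>\<^bsub>witt p R\<^esub> x \<in> witt_hat p R"
  unfolding witt_delta
  by (rule homogeneous_eval_hat[where w = "\<lambda>i. p ^ i" and c = p])
    (use assms homogeneous_witt_delta_poly[OF p] prime_gt_0_nat[OF p] in \<open>auto simp: witt_hat_iff nilpotent_def\<close>)

lemma ideal_witt_hat: "ideal (witt_hat p R) (witt p R)"
proof (rule idealI)
  show "subgroup (witt_hat p R) (add_monoid (witt p R))"
  proof (rule subgroup.intro)
    fix x assume x: "x \<in> witt_hat p R"
    have "\<ominus>\<^bsub>witt p R\<^esub> x = x \<otimes>\<^bsub>witt p R\<^esub> (\<ominus>\<^bsub>witt p R\<^esub> \<one>\<^bsub>witt p R\<^esub>)"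
      using witt_hat_carrier[OF x] by (simp add: W.r_minus)
    then show "inv\<^bsub>add_monoid (witt p R)\<^esub> x \<in> witt_hat p R"
      using witt_hat_mult[OF x, of "\<ominus>\<^bsub>witt p R\<^esub> \<one>\<^bsub>witt p R\<^esub>"] by (simp add: a_inv_def)
  qed (auto simp: witt_hat_add witt_hat_carrier, auto simp: witt_hat_iff witt_zero nilpotent_def intro: exI[of _ "1::nat"])
  show "y \<otimes>\<^bsub>witt p R\<^esub> x \<in> witt_hat p R" if "x \<in> witt_hat p R" "y \<in> carrier (witt p R)" for x y
    using witt_hat_mult[OF that] W.m_comm witt_hat_carrier that by simp
qed (auto intro: witt_hat_mult W.ring_axioms)

lemma witt_map_delta_hom:
  assumes "ring_hom_cring S R h"
  shows "(\<circ>) h \<in> delta_hom (witt p S) (witt p R)"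
proof -
  interpret h: ring_hom_cring S R h by fact
  show ?thesis
    by (auto simp: delta_hom_def intro!: ring_hom_memI
        simp: h.witt_map_binary h.witt_map_unary h.witt_map_consts)
qed

text \<open>
  Specialising the generic Witt vector, whose components are the variables, reduces the claim to
  weights: component \<open>n\<close> of its \<open>m\<close>-th power is homogeneous of weight \<open>m p\<^sup>n\<close>, hence of weight at least
  \<open>m\<close> for all \<open>n\<close> at once.
\<close>

lemma nilpotent_witt_hat:
  assumes x: "x \<in> witt_hat p R"
  shows "nilpotent (witt p R) x"
proof -
  let ?Z = "witt p (type_ring :: nat zpoly ring)" and ?e = "zpoly_eval R x"
  interpret Z: delta_ring p ?Z by (rule delta_ring_witt[OF p cring_type_ring])
  have xc: "x i \<in> carrier R" for i using witt_hat_carrier[OF x] by (simp add: witt_carrier)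
  interpret e: ring_hom_cring type_ring R ?e by (rule R.ring_hom_zpoly_eval[OF xc])
  interpret We: ring_hom_cring ?Z "witt p R" "(\<circ>) ?e"
    using witt_map_delta_hom[OF e.ring_hom_cring_axioms] by unfold_locales (simp add: delta_hom_def)
  have X: "?e \<circ> zvar = x" using R.zpoly_eval_zvar[of x, OF xc] by auto
  obtain K where K: "\<And>k f. k \<ge> K \<Longrightarrow> homogeneous (\<lambda>i. p ^ i) k f \<Longrightarrow> ?e f = \<zero>"
    using R.homogeneous_eval_eventually_zero[of x "\<lambda>i. p ^ i"] x xc by (auto simp: witt_hat_iff)
  have hom_pow: "homogeneous (\<lambda>i. p ^ i) (m * p ^ n) ((zvar [^]\<^bsub>?Z\<^esub> m) n)" for m n
  proof (induction m arbitrary: n)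
    case 0
    then show ?case by (simp add: witt_one homogeneous_one)
  next
    case (Suc m)
    have "homogeneous (case_sum (\<lambda>i. m * p ^ i) (\<lambda>i. 1 * p ^ i)) ((m + 1) * p ^ n) (witt_mult_poly p n)"
      by (rule homogeneous_witt_mult_poly[OF p])
    then have "homogeneous (\<lambda>i. p ^ i) ((m + 1) * p ^ n) (zsubst (case_sum (zvar [^]\<^bsub>?Z\<^esub> m) zvar) (witt_mult_poly p n))"
      by (rule homogeneous_zsubst) (use Suc homogeneous_zvar[of "\<lambda>i. p ^ i"] in \<open>auto split: sum.split\<close>)
    then show ?case by (simp add: witt_mult)
  qed
  have "?e ((zvar [^]\<^bsub>?Z\<^esub> K) n) = \<zero>" for n
    by (rule K[OF _ hom_pow]) (use prime_gt_0_nat[OF p] in simp)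
  then have "?e \<circ> (zvar [^]\<^bsub>?Z\<^esub> K) = \<zero>\<^bsub>witt p R\<^esub>" by (auto simp: witt_zero)
  then have "x [^]\<^bsub>witt p R\<^esub> K = \<zero>\<^bsub>witt p R\<^esub>"
    using We.hom_nat_power[of zvar K] X by (simp add: witt_carrier)
  then show ?thesis using witt_hat_carrier[OF x] by (auto simp: nilpotent_def)
qed

text \<open>
  Component \<open>n\<close> of the \<open>k\<close>-th iterate of \<open>\<delta>\<close> on the generic Witt vector is homogeneous of weight
  \<open>p\<^sup>k\<^sup>+\<^sup>n\<close>, which exceeds every bound for large \<open>k\<close>, for all \<open>n\<close> at once.
\<close>

lemma delta_nilpotent_witt_hat:
  assumes x: "x \<in> witt_hat p R"
  shows "delta_nilpotent (witt p R) x"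
proof -
  let ?Z = "witt p (type_ring :: nat zpoly ring)" and ?e = "zpoly_eval R x"
  interpret Z: delta_ring p ?Z by (rule delta_ring_witt[OF p cring_type_ring])
  have xc: "x i \<in> carrier R" for i using witt_hat_carrier[OF x] by (simp add: witt_carrier)
  interpret e: ring_hom_cring type_ring R ?e by (rule R.ring_hom_zpoly_eval[OF xc])
  have We: "(\<circ>) ?e \<in> delta_hom ?Z (witt p R)" by (rule witt_map_delta_hom) (rule e.ring_hom_cring_axioms)
  interpret We: ring_hom_cring ?Z "witt p R" "(\<circ>) ?e"
    using We by unfold_locales (simp add: delta_hom_def)
  have C: "y \<in> carrier ?Z" for y by (simp add: witt_carrier)
  have X: "?e \<circ> zvar = x" using R.zpoly_eval_zvar[of x, OF xc] by auto
  obtain K where K: "\<And>k f. k \<ge> K \<Longrightarrow> homogeneous (\<lambda>i. p ^ i) k f \<Longrightarrow> ?e f = \<zero>"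
    using R.homogeneous_eval_eventually_zero[of x "\<lambda>i. p ^ i"] x xc by (auto simp: witt_hat_iff)
  have p1: "p > 1" using p by (rule prime_gt_1_nat)
  have hom_delta: "homogeneous (\<lambda>i. p ^ i) (p ^ (k + n)) ((delta ?Z ^^ k) zvar n)" for k n
  proof (induction k arbitrary: n)
    case 0
    then show ?case using homogeneous_zvar[of "\<lambda>i. p ^ i" n] by simp
  next
    case (Suc k)
    have "homogeneous (\<lambda>i. p ^ k * p ^ i) (p ^ k * p ^ Suc n) (witt_delta_poly p n)"
      by (rule homogeneous_scale) (rule homogeneous_witt_delta_poly[OF p])
    then have "homogeneous (\<lambda>i. p ^ i) (p ^ k * p ^ Suc n) (zsubst ((delta ?Z ^^ k) zvar) (witt_delta_poly p n))"
      by (rule homogeneous_zsubst) (use Suc in \<open>simp add: power_add\<close>)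
    then show ?case by (simp add: witt_delta[of p _ "(delta ?Z ^^ k) zvar"] power_add mult_ac)
  qed
  have "(delta (witt p R) ^^ k) x = \<zero>\<^bsub>witt p R\<^esub>" if "k \<ge> K" for k
  proof -
    have "?e ((delta ?Z ^^ k) zvar n) = \<zero>" for n
    proof (rule K[OF _ hom_delta])
      have "k + n < p ^ (k + n)" using p1 by (intro power_gt_expt) simp
      then show "K \<le> p ^ (k + n)" using that by simp
    qed
    then have "?e \<circ> (delta ?Z ^^ k) zvar = \<zero>\<^bsub>witt p R\<^esub>" by (auto simp: witt_zero)
    then show ?thesis
      using delta_hom_funpow[OF Z.delta_ring_axioms We C, of k zvar] X by simp
  qed
  then have "\<exists>N. \<forall>i\<ge>N. (delta (witt p R) ^^ i) x = \<zero>\<^bsub>witt p R\<^esub>" by blast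
  moreover have "(delta (witt p R) ^^ i) x \<in> witt_hat p R" for i
    by (induction i) (auto simp: x witt_hat_delta)
  ultimately show ?thesis using nilpotent_witt_hat by (simp add: delta_nilpotent_def)
qed

end


section \<open>The free \<open>\<delta>\<close>-ring over a \<open>\<delta>\<close>-ring\<close>

text \<open>
  Variable \<open>(a, n)\<close> stands for \<open>\<delta>\<^sup>n(a)\<close>; the generators \<open>a\<close> are the elements of a type.
\<close>

definition free_frob :: "nat \<Rightarrow> ('b \<times> nat) zpoly \<Rightarrow> ('b \<times> nat) zpoly" where
  "free_frob p = zsubst (\<lambda>(a, n). zvar (a, n) ^ p + of_nat p * zvar (a, Suc n))"

definition free_delta :: "nat \<Rightarrow> ('b \<times> nat) zpoly \<Rightarrow> ('b \<times> nat) zpoly" where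
  "free_delta p f = (THE g. free_frob p f = f ^ p + of_nat p * g)"

text \<open>
  The \<open>\<delta>\<close>-homomorphism to \<open>A\<close> that sends every generator in the carrier to itself, and all other
  generators to \<open>0\<close>.
\<close>

definition free_map :: "('b, 'm) dring_scheme \<Rightarrow> ('b \<times> nat) zpoly \<Rightarrow> 'b" where
  "free_map A = zpoly_eval A (\<lambda>(a, n). (delta A ^^ n) (if a \<in> carrier A then a else \<zero>\<^bsub>A\<^esub>))"

text \<open>
  The \<open>\<delta>\<close>-homomorphism \<open>A \<rightarrow> W(A)\<close> that lifts the identity of \<open>A\<close>.
\<close>

definition witt_lift :: "nat \<Rightarrow> ('b, 'm) dring_scheme \<Rightarrow> 'b \<Rightarrow> nat \<Rightarrow> 'b" where
  "witt_lift p A a = (\<lambda>n. zpoly_eval A (\<lambda>k. (delta A ^^ k) a) (theta p n))"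

text \<open>
  The same formula for the free \<open>\<delta>\<close>-ring, where its ghost components can be computed.
\<close>

definition free_lift :: "nat \<Rightarrow> ('b \<times> nat) zpoly \<Rightarrow> nat \<Rightarrow> ('b \<times> nat) zpoly" where
  "free_lift p f = (\<lambda>n. zsubst (\<lambda>k. (free_delta p ^^ k) f) (theta p n))"

context
  fixes p :: nat
  assumes p: "prime p"
begin

lemma free_frob_simps:
  "free_frob p (f + g) = free_frob p f + free_frob p g"
  "free_frob p (f * g) = free_frob p f * free_frob p g"
  "free_frob p (f ^ n) = free_frob p f ^ n"
  "free_frob p 0 = 0" "free_frob p 1 = 1" "free_frob p (of_nat n) = of_nat n"
  by (simp_all add: free_frob_def)

lemma free_cancel: "of_nat p * f = of_nat p * g \<Longrightarrow> f = (g :: 'v zpoly)"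
  using zpoly_mult_cancel[OF prime_gt_0_nat[OF p]] by blast

lemma free_delta_unique:
  assumes "free_frob p f = f ^ p + of_nat p * g"
  shows "free_delta p f = g"
  unfolding free_delta_def
  by (rule the_equality) (use assms free_cancel in \<open>auto\<close>)

lemma free_frob_expand:
  fixes f :: "('b \<times> nat) zpoly"
  shows "free_frob p f = f ^ p + of_nat p * free_delta p f"
proof -
  have "frobenius_lift p (free_frob p :: ('b \<times> nat) zpoly \<Rightarrow> _)"
    unfolding free_frob_def by (rule frobenius_lift_zsubst[OF p]) (auto split: prod.split)
  then have "of_nat p dvd free_frob p f - f ^ p" by (simp add: frobenius_lift_def)
  then obtain g where g: "free_frob p f - f ^ p = of_nat p * g" by (auto elim: dvdE)
  then have "free_frob p f = f ^ p + of_nat p * g" by (metis add.commute diff_add_cancel)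
  then show ?thesis using free_delta_unique by metis
qed

lemma free_delta_simps:
  fixes f g :: "('b \<times> nat) zpoly" and a :: 'b
  shows "free_delta p (zvar (a, n)) = zvar (a, Suc n)"
  "free_delta p (0 :: ('b \<times> nat) zpoly) = 0"
  "free_delta p (1 :: ('b \<times> nat) zpoly) = 0"
  "free_delta p (f + g) = free_delta p f + free_delta p g - frob_defect p type_ring f g"
  "free_delta p (f * g) = f ^ p * free_delta p g + g ^ p * free_delta p f + of_nat p * (free_delta p f * free_delta p g)"
  "free_delta p (free_frob p f) = free_frob p (free_delta p f)"
proof -
  show "free_delta p (zvar (a, n)) = zvar (a, Suc n)"
    by (rule free_delta_unique) (simp add: free_frob_def)
  show "free_delta p (0 :: ('b \<times> nat) zpoly) = 0" "free_delta p (1 :: ('b \<times> nat) zpoly) = 0"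
    using prime_gt_0_nat[OF p] by (auto intro!: free_delta_unique simp: free_frob_simps zero_power)
  show "free_delta p (f + g) = free_delta p f + free_delta p g - frob_defect p type_ring f g"
    by (rule free_delta_unique)
      (simp add: free_frob_simps free_frob_expand[of f] free_frob_expand[of g] binomial_prime_expansion[OF p] frob_defect_def algebra_simps)
  show "free_delta p (f * g) = f ^ p * free_delta p g + g ^ p * free_delta p f + of_nat p * (free_delta p f * free_delta p g)"
    by (rule free_delta_unique)
      (simp add: free_frob_simps free_frob_expand[of f] free_frob_expand[of g] power_mult_distrib algebra_simps)
  show "free_delta p (free_frob p f) = free_frob p (free_delta p f)"
    using arg_cong[OF free_frob_expand[of f], of "free_frob p"]
    by (intro free_delta_unique) (simp only: free_frob_simps)
qed

lemma ghost_free_lift: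
  fixes f :: "('b \<times> nat) zpoly"
  shows "ghost p n (free_lift p f) = (free_frob p ^^ n) f"
proof -
  have hom: "(free_frob p ^^ n) (g ^ p + of_nat p * h) = (free_frob p ^^ n) g ^ p + of_nat p * (free_frob p ^^ n) h"
    for n and g h :: "('b \<times> nat) zpoly"
    by (induction n) (auto simp: free_frob_simps)
  show ?thesis
    using ghost_theta[OF p, of "\<lambda>n k. (free_frob p ^^ n) ((free_delta p ^^ k) f)" n]
    by (simp add: free_lift_def funpow_Suc_right free_frob_expand hom del: funpow.simps(2))
      (simp add: funpow_swap1[symmetric])
qed

context
  fixes A :: "('b, 'm) dring_scheme" (structure)
  assumes A: "delta_ring p A"
begin

interpretation A: delta_ring p A by (rule A)

lemma free_map_hom: "ring_hom_cring type_ring A (free_map A)"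
  unfolding free_map_def
  by (rule A.ring_hom_zpoly_eval) (auto intro: A.delta_funpow_closed split: prod.split)

interpretation \<pi>: ring_hom_cring type_ring A "free_map A" by (rule free_map_hom)

lemma free_map_zvar: "free_map A (zvar (a, n)) = (delta A ^^ n) (if a \<in> carrier A then a else \<zero>)"
  unfolding free_map_def
  by (subst A.zpoly_eval_zvar) (auto intro: A.delta_funpow_closed split: prod.split)

lemma free_map_surj: "a \<in> carrier A \<Longrightarrow> \<exists>f. free_map A f = a"
  by (rule exI[of _ "zvar (a, 0)"]) (simp add: free_map_zvar)

text \<open>
  By induction on \<open>f\<close>. For \<open>-f\<close>, both sides are found by expanding \<open>\<delta>(f + (-f)) = 0\<close>.
\<close>

lemma free_map_delta: "free_map A (free_delta p f) = \<delta> (free_map A f)"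
proof -
  note hom = \<pi>.hom_add[simplified] \<pi>.hom_mult[simplified] \<pi>.hom_one[simplified] \<pi>.hom_zero[simplified]
    \<pi>.hom_a_inv[simplified] \<pi>.hom_a_minus[simplified] \<pi>.hom_nat_power[simplified]
    \<pi>.hom_frob_defect[simplified] \<pi>.hom_add_pow[simplified]
  have C [simp]: "free_map A f \<in> carrier A" for f using \<pi>.hom_closed by simp
  show ?thesis
  proof (induction f rule: zpoly_induct)
    case (var i)
    obtain a n where "i = (a, n)" by (cases i)
    then show ?case by (simp add: free_delta_simps free_map_zvar)
  next
    case one
    then show ?case by (simp add: free_delta_simps hom A.delta_one)
  next
    case (add f g)
    then show ?case by (simp add: free_delta_simps hom A.delta_add_defect)
  next
    case (minus f)
    have "free_delta p (- f) = frob_defect p type_ring f (- f) - free_delta p f"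
    proof -
      have "free_delta p f + free_delta p (- f) - frob_defect p type_ring f (- f) = 0"
        using free_delta_simps(4)[of f "- f"] by (simp add: free_delta_simps(2))
      then show ?thesis by (simp add: algebra_simps)
    qed
    then have 1: "free_map A (free_delta p (- f)) = frob_defect p A (free_map A f) (\<ominus> free_map A f) \<ominus> \<delta> (free_map A f)"
      using minus by (simp add: hom)
    have "\<delta> (free_map A f) \<oplus> \<delta> (\<ominus> free_map A f) \<ominus> frob_defect p A (free_map A f) (\<ominus> free_map A f) = \<zero>"
      using A.delta_add_defect[of "free_map A f" "\<ominus> free_map A f"] by (simp add: A.r_neg A.delta_zero)
    moreover have "y = z \<ominus> x" if "x \<oplus> y \<ominus> z = \<zero>" "x \<in> carrier A" "y \<in> carrier A" "z \<in> carrier A" for x y z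
    proof -
      have "z \<ominus> x = (x \<oplus> y \<ominus> z) \<oplus> (z \<ominus> x)" unfolding that(1) using that by simp
      also have "\<dots> = y" using that(2-4) by algebra
      finally show ?thesis ..
    qed
    ultimately have "\<delta> (\<ominus> free_map A f) = frob_defect p A (free_map A f) (\<ominus> free_map A f) \<ominus> \<delta> (free_map A f)"
      by (simp add: A.delta_closed)
    then show ?case using 1 by (simp add: hom)
  next
    case (mult f g)
    have "of_nat p * (free_delta p f * free_delta p g) = [p] \<cdot>\<^bsub>type_ring\<^esub> (free_delta p f * free_delta p g)" by simp
    then have "free_map A (of_nat p * (free_delta p f * free_delta p g)) = [p] \<cdot> (free_map A (free_delta p f) \<otimes> free_map A (free_delta p g))"
      by (simp only: \<pi>.hom_add_pow type_ring_simps UNIV_I hom)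
    with mult show ?case by (simp add: free_delta_simps hom A.delta_mult)
  qed
qed

lemma free_map_frob: "free_map A (free_frob p f) = frobenius p A (free_map A f)"
proof -
  have "free_map A (f ^ p) = free_map A f [^] p"
    "free_map A (of_nat p * free_delta p f) = [p] \<cdot> free_map A (free_delta p f)"
    using \<pi>.hom_nat_power[of f p] \<pi>.hom_add_pow[of "free_delta p f" p] by simp_all
  then show ?thesis
    using \<pi>.hom_add[of "f ^ p" "of_nat p * free_delta p f"]
    by (simp add: free_frob_expand frobenius_def free_map_delta)
qed

lemma frobenius_ring_hom: "frobenius p A \<in> ring_hom A A"
proof (rule ring_hom_memI)
  note hom = \<pi>.hom_add[simplified] \<pi>.hom_mult[simplified] \<pi>.hom_one[simplified]
  fix x y assume "x \<in> carrier A" "y \<in> carrier A"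
  then obtain f g where fg: "x = free_map A f" "y = free_map A g" using free_map_surj by metis
  show "frobenius p A x \<in> carrier A"
    using \<open>x \<in> carrier A\<close> by (simp add: frobenius_def A.delta_closed)
  show "frobenius p A (x \<otimes> y) = frobenius p A x \<otimes> frobenius p A y"
    unfolding fg hom[symmetric] free_map_frob[symmetric] free_frob_simps ..
  show "frobenius p A (x \<oplus> y) = frobenius p A x \<oplus> frobenius p A y"
    unfolding fg hom[symmetric] free_map_frob[symmetric] free_frob_simps ..
next
  show "frobenius p A \<one> = \<one>"
    unfolding \<pi>.hom_one[symmetric, simplified] free_map_frob[symmetric] free_frob_simps ..
qed

text \<open>
  In the free \<open>\<delta>\<close>-ring this follows on applying the ring homomorphism \<open>\<phi>\<close> to \<open>\<phi>(f) = f\<^sup>p + p \<delta>(f)\<close>, as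
  there is no torsion; it descends to every \<open>\<delta>\<close>-ring.
\<close>

lemma delta_frobenius:
  assumes "x \<in> carrier A"
  shows "\<delta> (frobenius p A x) = frobenius p A (\<delta> x)"
proof -
  obtain f where f: "x = free_map A f" using assms free_map_surj by metis
  show ?thesis
    unfolding f free_map_frob[symmetric] free_map_delta[symmetric] free_delta_simps ..
qed

lemma witt_lift_free_map: "witt_lift p A (free_map A f) = free_map A \<circ> free_lift p f"
proof -
  have "free_map A ((free_delta p ^^ k) f) = (delta A ^^ k) (free_map A f)" for k
    by (induction k) (simp_all add: free_map_delta)
  then show ?thesis
    by (simp add: witt_lift_def free_lift_def fun_eq_iff zsubst_natural[OF free_map_hom])
qed

text \<open>
  On the free \<open>\<delta>\<close>-ring the ghost components of the lift of \<open>f\<close> are \<open>\<phi>\<^sup>n(f)\<close>, which shows that it is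
  compatible with the operations. Since the lift is expressed through the iterates of \<open>\<delta>\<close>, it is
  compatible with the surjection from the free \<open>\<delta>\<close>-ring.
\<close>

lemma witt_lift_delta_hom: "witt_lift p A \<in> delta_hom A (witt p A)"
proof -
  let ?W = "witt p (type_ring :: ('b \<times> nat) zpoly ring)"
  have C: "x \<in> carrier ?W" for x by (simp add: witt_carrier)
  have hom: "(free_frob p ^^ n) (f + g) = (free_frob p ^^ n) f + (free_frob p ^^ n) g"
    "(free_frob p ^^ n) (f * g) = (free_frob p ^^ n) f * (free_frob p ^^ n) g"
    "(free_frob p ^^ n) 1 = 1"
    "(free_frob p ^^ n) (f ^ k) = (free_frob p ^^ n) f ^ k"
    "(free_frob p ^^ n) (of_nat k) = of_nat k"
    for n k and f g :: "('b \<times> nat) zpoly"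
    by (induction n) (auto simp: free_frob_simps)
  have add: "free_lift p (f + g) = free_lift p f \<oplus>\<^bsub>?W\<^esub> free_lift p g" for f g
    by (rule ghost_inj[OF p]) (simp add: ghost_free_lift ghost_witt[OF p] hom)
  have mult: "free_lift p (f * g) = free_lift p f \<otimes>\<^bsub>?W\<^esub> free_lift p g" for f g
    by (rule ghost_inj[OF p]) (simp add: ghost_free_lift ghost_witt[OF p] hom)
  have one: "free_lift p 1 = \<one>\<^bsub>?W\<^esub>"
    by (rule ghost_inj[OF p]) (simp add: ghost_free_lift ghost_witt[OF p] hom)
  have delta: "free_lift p (free_delta p f) = \<delta>\<^bsub>?W\<^esub> (free_lift p f)" for f
  proof (rule ghost_inj[OF p], rule free_cancel)
    fix n
    have "(free_frob p ^^ Suc n) f = (free_frob p ^^ n) f ^ p + of_nat p * (free_frob p ^^ n) (free_delta p f)"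
      by (simp add: funpow_Suc_right free_frob_expand hom del: funpow.simps)
    then show "of_nat p * ghost p n (free_lift p (free_delta p f)) = of_nat p * ghost p n (\<delta>\<^bsub>?W\<^esub> (free_lift p f))"
      using ghost_witt(5)[OF p, of n "free_lift p f"] by (simp add: ghost_free_lift del: funpow.simps)
  qed
  note pull = \<pi>.hom_add[simplified, symmetric] \<pi>.hom_mult[simplified, symmetric]
  show ?thesis
    unfolding delta_hom_def
  proof (intro CollectI conjI ring_hom_memI ballI)
    fix x y assume "x \<in> carrier A" "y \<in> carrier A"
    then obtain f g where fg: "x = free_map A f" "y = free_map A g" using free_map_surj by metis
    show "witt_lift p A x \<in> carrier (witt p A)"
      unfolding fg witt_lift_free_map by (rule \<pi>.witt_map_unary) (rule C)
    show "witt_lift p A (x \<otimes> y) = witt_lift p A x \<otimes>\<^bsub>witt p A\<^esub> witt_lift p A y"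
      unfolding fg pull witt_lift_free_map mult by (rule \<pi>.witt_map_binary[OF C C])
    show "witt_lift p A (x \<oplus> y) = witt_lift p A x \<oplus>\<^bsub>witt p A\<^esub> witt_lift p A y"
      unfolding fg pull witt_lift_free_map add by (rule \<pi>.witt_map_binary[OF C C])
  next
    show "witt_lift p A \<one> = \<one>\<^bsub>witt p A\<^esub>"
      unfolding \<pi>.hom_one[simplified, symmetric] witt_lift_free_map one by (rule \<pi>.witt_map_consts)
  next
    fix x assume "x \<in> carrier A"
    then obtain f where f: "x = free_map A f" using free_map_surj by metis
    show "witt_lift p A (\<delta> x) = \<delta>\<^bsub>witt p A\<^esub> (witt_lift p A x)"
      unfolding f free_map_delta[symmetric] witt_lift_free_map delta by (rule \<pi>.witt_map_unary[OF C])
  qed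
qed

lemma witt_lift_0: "a \<in> carrier A \<Longrightarrow> witt_lift p A a 0 = a"
  using A.delta_funpow_closed
  by (simp add: witt_lift_def theta_0[OF p] A.zpoly_eval_zvar)

subsection \<open>The \<open>\<delta>\<close>-nilradical\<close>

text \<open>
  Forwards, the polynomials \<open>\<theta>\<^sub>n\<close> have weight \<open>p\<^sup>n\<close>; backwards, \<open>\<delta>\<^sup>i(a)\<close> is the zeroth component of
  \<open>\<delta>\<^sup>i\<close> of the lift. This describes the \<open>\<delta>\<close>-nilradical as the preimage of an ideal.
\<close>

lemma delta_nilpotent_iff_witt_lift:
  assumes a: "a \<in> carrier A"
  shows "delta_nilpotent A a \<longleftrightarrow> witt_lift p A a \<in> witt_hat p A"
proof
  assume nil: "delta_nilpotent A a"
  then obtain N where N: "\<And>i. i \<ge> N \<Longrightarrow> (delta A ^^ i) a = \<zero>" by (auto simp: delta_nilpotent_def)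
  have "{i. (delta A ^^ i) a \<noteq> \<zero>} \<subseteq> {..<N}"
  proof
    fix i assume "i \<in> {i. (delta A ^^ i) a \<noteq> \<zero>}"
    then have "\<not> i \<ge> N" using N[of i] by blast
    then show "i \<in> {..<N}" by simp
  qed
  then have fin: "finite {i. (delta A ^^ i) a \<noteq> \<zero>}" by (rule finite_subset) simp
  show "witt_lift p A a \<in> witt_hat p A"
    unfolding witt_lift_def
    by (rule homogeneous_eval_hat[OF p A.is_cring, where w = "\<lambda>i. p ^ i" and c = 1])
      (use nil fin homogeneous_theta[OF p] A.delta_funpow_closed[OF a] in \<open>auto simp: delta_nilpotent_def intro: rev_finite_subset\<close>)
next
  assume "witt_lift p A a \<in> witt_hat p A"
  then have nil: "delta_nilpotent (witt p A) (witt_lift p A a)"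
    by (rule delta_nilpotent_witt_hat[OF p A.is_cring])
  interpret W: delta_ring p "witt p A" by (rule delta_ring_witt[OF p A.is_cring])
  interpret e: ring_hom_cring "witt p A" A "\<lambda>x. x 0"
    using witt_zeroth_hom[OF p A.is_cring] by unfold_locales
  have "(delta A ^^ i) a = (delta (witt p A) ^^ i) (witt_lift p A a) 0" for i
    using delta_hom_funpow[OF A witt_lift_delta_hom a] witt_lift_0 A.delta_funpow_closed[OF a] by metis
  then show "delta_nilpotent A a"
    using nil e.nilpotent_hom e.hom_zero unfolding delta_nilpotent_def by metis
qed

lemma ideal_delta_nilradical: "ideal (delta_nilradical A) A"
proof -
  interpret W: delta_ring p "witt p A" by (rule delta_ring_witt[OF p A.is_cring])
  interpret l: ring_hom_ring A "witt p A" "witt_lift p A"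
    using witt_lift_delta_hom by (intro ring_hom_ringI2) (auto simp: delta_hom_def A.ring_axioms W.ring_axioms)
  have "delta_nilradical A = {a \<in> carrier A. witt_lift p A a \<in> witt_hat p A}"
    by (auto simp: delta_nilradical_def delta_nilpotent_iff_witt_lift)
  then show ?thesis using l.ideal_vimage[OF ideal_witt_hat[OF p A.is_cring]] by simp
qed

lemma delta_nilradical_delta:
  assumes "a \<in> delta_nilradical A"
  shows "\<delta> a \<in> delta_nilradical A"
proof -
  have eq: "(delta A ^^ i) (\<delta> a) = (delta A ^^ Suc i) a" for i
    by (simp add: funpow_swap1)
  have nil: "delta_nilpotent A a" and a: "a \<in> carrier A"
    using assms by (auto simp: delta_nilradical_def)
  then obtain N where "\<And>i. i \<ge> N \<Longrightarrow> (delta A ^^ i) a = \<zero>" by (auto simp: delta_nilpotent_def)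
  then have "\<forall>i\<ge>N. (delta A ^^ Suc i) a = \<zero>" by (metis le_SucI)
  moreover have "\<forall>i. nilpotent A ((delta A ^^ Suc i) a)" using nil unfolding delta_nilpotent_def by blast
  ultimately have "(\<forall>i. nilpotent A ((delta A ^^ i) (\<delta> a))) \<and> (\<exists>N. \<forall>i\<ge>N. (delta A ^^ i) (\<delta> a) = \<zero>)"
    unfolding eq by blast
  then show ?thesis
    using A.delta_closed[OF a] by (simp add: delta_nilradical_def delta_nilpotent_def)
qed

end

end

lemma delta_hom_nilpotent:
  assumes "delta_ring p A" "delta_ring p B" "h \<in> delta_hom A B" "x \<in> carrier A" "delta_nilpotent A x"
  shows "delta_nilpotent B (h x)"
proof -
  interpret A: delta_ring p A by fact
  interpret B: delta_ring p B by fact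
  interpret h: ring_hom_cring A B h using assms(3) by unfold_locales (simp add: delta_hom_def)
  show ?thesis
    using assms(5) h.nilpotent_hom h.hom_zero delta_hom_funpow[OF assms(1,3,4)]
    unfolding delta_nilpotent_def by metis
qed

text \<open>
  The components of \<open>x\<close> are the polynomials \<open>\<theta>\<^sub>n\<close>, of weight \<open>p\<^sup>n\<close>, in these finitely many nilpotent
  elements.
\<close>

lemma witt_hat_of_delta_components:
  assumes p: "prime p" and R: "cring R" and x: "x \<in> carrier (witt p R)"
    and nil: "\<And>k. nilpotent R ((delta (witt p R) ^^ k) x 0)"
    and zero: "\<And>k. k \<ge> N \<Longrightarrow> (delta (witt p R) ^^ k) x 0 = \<zero>\<^bsub>R\<^esub>"
  shows "x \<in> witt_hat p R"
proof -
  let ?d = "\<lambda>k. (delta (witt p R) ^^ k) x 0"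
  have "{k. ?d k \<noteq> \<zero>\<^bsub>R\<^esub>} \<subseteq> {..<N}"
  proof
    fix k assume "k \<in> {k. ?d k \<noteq> \<zero>\<^bsub>R\<^esub>}"
    then have "\<not> k \<ge> N" using zero[of k] by auto
    then show "k \<in> {..<N}" by simp
  qed
  then have fin: "finite {k. ?d k \<noteq> \<zero>\<^bsub>R\<^esub>}" by (rule finite_subset) simp
  have eq: "x = (\<lambda>n. zpoly_eval R ?d (theta p n))"
    by (rule ext) (rule witt_eq_theta[OF p R x])
  have "(\<lambda>n. zpoly_eval R ?d (theta p n)) \<in> witt_hat p R"
    by (rule homogeneous_eval_hat[OF p R, where w = "\<lambda>i. p ^ i" and c = 1])
      (use nil fin homogeneous_theta[OF p] in \<open>auto simp: nilpotent_def intro: rev_finite_subset\<close>)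
  then show "x \<in> witt_hat p R"
    by (rule back_subst[where P = "\<lambda>y. y \<in> witt_hat p R"]) (rule eq[symmetric])
qed

lemma delta_nilradical_witt:
  assumes p: "prime p" and R: "cring R"
  shows "delta_nilradical (witt p R) = witt_hat p R"
proof (intro equalityI subsetI)
  interpret R: cring R by (rule R)
  interpret W: delta_ring p "witt p R" by (rule delta_ring_witt[OF p R])
  interpret e: ring_hom_cring "witt p R" R "\<lambda>x. x 0"
    using witt_zeroth_hom[OF p R] by unfold_locales
  show "x \<in> delta_nilradical (witt p R)" if "x \<in> witt_hat p R" for x
    using that witt_hat_carrier[OF p R that] delta_nilpotent_witt_hat[OF p R that]
    by (simp add: delta_nilradical_def)
  fix x assume x: "x \<in> delta_nilradical (witt p R)"
  then have xc: "x \<in> carrier (witt p R)" and nil: "delta_nilpotent (witt p R) x"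
    by (auto simp: delta_nilradical_def)
  obtain N where N: "\<And>i. i \<ge> N \<Longrightarrow> (delta (witt p R) ^^ i) x = \<zero>\<^bsub>witt p R\<^esub>"
    using nil by (auto simp: delta_nilpotent_def)
  show "x \<in> witt_hat p R"
  proof (rule witt_hat_of_delta_components[OF p R xc])
    show "nilpotent R ((delta (witt p R) ^^ k) x 0)" for k
      using nil e.nilpotent_hom by (auto simp: delta_nilpotent_def)
    show "(delta (witt p R) ^^ k) x 0 = \<zero>\<^bsub>R\<^esub>" if "k \<ge> N" for k
      using N[OF that] by (simp add: witt_zero)
  qed
qed


section \<open>Quotients of \<open>\<delta>\<close>-rings\<close>

lemma coset_map_eq:
  assumes I: "ideal I A" and eq: "\<And>i. i \<in> I \<Longrightarrow> I +>\<^bsub>A\<^esub> f (i \<oplus>\<^bsub>A\<^esub> x) = I +>\<^bsub>A\<^esub> f x"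
  shows "coset_map A I f (I +>\<^bsub>A\<^esub> x) = I +>\<^bsub>A\<^esub> f x"
proof -
  interpret ideal I A by fact
  have const: "I +>\<^bsub>A\<^esub> f y = I +>\<^bsub>A\<^esub> f x" if y: "y \<in> I +>\<^bsub>A\<^esub> x" for y
  proof -
    obtain i where "i \<in> I" "y = i \<oplus>\<^bsub>A\<^esub> x" using y unfolding a_r_coset_def' by blast
    then show ?thesis using eq[of i] by simp
  qed
  have "\<zero>\<^bsub>A\<^esub> \<in> I" by (rule additive_subgroup.zero_closed[OF is_additive_subgroup])
  then have zero: "\<zero>\<^bsub>A\<^esub> \<oplus>\<^bsub>A\<^esub> x \<in> I +>\<^bsub>A\<^esub> x" unfolding a_r_coset_def' by (rule UN_I) simp
  have "(\<lambda>y. I +>\<^bsub>A\<^esub> f y) ` (I +>\<^bsub>A\<^esub> x) = {I +>\<^bsub>A\<^esub> f x}"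
    using const imageI[OF zero, of "\<lambda>y. I +>\<^bsub>A\<^esub> f y", unfolded const[OF zero]] by blast
  then show ?thesis by (simp add: coset_map_def)
qed

locale delta_ideal = delta_ring p A + ideal I A for p and A :: "('a, 'm) dring_scheme" (structure) and I +
  assumes I_delta: "x \<in> I \<Longrightarrow> \<delta> x \<in> I"
begin

lemma I_zero: "\<zero> \<in> I" by (rule additive_subgroup.zero_closed[OF is_additive_subgroup])

lemma I_add: "x \<in> I \<Longrightarrow> y \<in> I \<Longrightarrow> x \<oplus> y \<in> I"
  by (rule additive_subgroup.a_closed[OF is_additive_subgroup])

lemma I_minus: "x \<in> I \<Longrightarrow> y \<in> I \<Longrightarrow> x \<ominus> y \<in> I"
  unfolding a_minus_def by (intro I_add additive_subgroup.a_inv_closed[OF is_additive_subgroup])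

lemma I_add_pow: "x \<in> I \<Longrightarrow> [(n::nat)] \<cdot> x \<in> I"
  by (induction n) (auto intro: I_zero I_add)

lemma I_finsum: "(\<And>i. i \<in> S \<Longrightarrow> f i \<in> I) \<Longrightarrow> finsum A f S \<in> I"
proof (induction S rule: infinite_finite_induct)
  case (insert i S)
  then show ?case by (subst finsum_insert) (auto intro: I_add Icarr)
qed (auto intro: I_zero)

lemma I_frob_defect:
  assumes x: "x \<in> I" and y: "y \<in> carrier A"
  shows "frob_defect p A x y \<in> I"
  unfolding frob_defect_def
proof (intro I_finsum I_add_pow)
  fix i assume "i \<in> {1..p - 1}"
  then obtain j where "i = Suc j" by (cases i) auto
  then have "x [^] i \<in> I" using I_l_closed[OF x, of "x [^] j"] Icarr[OF x] by simp
  then show "x [^] i \<otimes> y [^] (p - i) \<in> I" using y by (intro I_r_closed) auto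
qed

lemma coset_eq_iff: "a \<in> carrier A \<Longrightarrow> b \<in> carrier A \<Longrightarrow> I +> a = I +> b \<longleftrightarrow> a \<ominus> b \<in> I"
  using quotient_eq_iff_same_a_r_cos[OF is_ideal] by blast

lemma delta_quot_simps:
  "carrier (delta_quot A I) = (+>) I ` carrier A"
  "mult (delta_quot A I) = rcoset_mult A I" "one (delta_quot A I) = I +> \<one>"
  "zero (delta_quot A I) = I" "add (delta_quot A I) = set_add A"
  "delta (delta_quot A I) = coset_map A I (delta A)"
  by (auto simp: delta_quot_def ring.extend_def FactRing_simps)

lemma delta_quot_delta:
  assumes x: "x \<in> carrier A"
  shows "coset_map A I (delta A) (I +> x) = I +> \<delta> x"
proof (rule coset_map_eq[OF is_ideal])
  fix i assume i: "i \<in> I"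
  have "\<delta> (i \<oplus> x) \<ominus> \<delta> x = \<delta> i \<ominus> frob_defect p A i x"
  proof -
    have "frob_defect p A i x \<in> carrier A" "\<delta> i \<in> carrier A" "\<delta> x \<in> carrier A"
      using i x by (auto intro: Icarr delta_closed)
    then show ?thesis unfolding delta_add_defect[OF Icarr[OF i] x] by algebra
  qed
  also have "\<dots> \<in> I" using i x by (intro I_minus I_delta I_frob_defect)
  finally show "I +> \<delta> (i \<oplus> x) = I +> \<delta> x"
    using i x by (subst coset_eq_iff) (auto intro: delta_closed Icarr)
qed

lemma delta_quot: "delta_ring p (delta_quot A I)" "(+>) I \<in> delta_hom A (delta_quot A I)"
proof -
  show "delta_ring p (delta_quot A I)" "(+>) I \<in> delta_hom A (delta_quot A I)"
    by (rule delta_ring_of_surj[OF delta_ring_axioms, where h = "(+>) I"];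
        simp add: delta_quot_simps rcoset_mult_add a_rcos_sum a_rcos_zero[OF is_ideal I_zero] delta_quot_delta)+
qed

lemma coset_zero_iff: "a \<in> carrier A \<Longrightarrow> I +> a = \<zero>\<^bsub>delta_quot A I\<^esub> \<longleftrightarrow> a \<in> I"
  using rcos_const_imp_mem a_rcos_zero[OF is_ideal] by (auto simp: delta_quot_simps)

lemma frobenius_delta_quot:
  "a \<in> carrier A \<Longrightarrow> frobenius p (delta_quot A I) (I +> a) = I +> frobenius p A a"
  using delta_hom_frobenius[OF delta_ring_axioms delta_quot] by simp

text \<open>
  This allows perfectness of the quotient to be used and proved with elements of \<open>A\<close> in place of
  cosets.
\<close>

lemma perfect_delta_quot_iff:
  "perfect_delta_ring p (delta_quot A I) \<longleftrightarrow>
    (\<forall>a\<in>carrier A. frobenius p A a \<in> I \<longrightarrow> a \<in> I) \<and>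
    (\<forall>a\<in>carrier A. \<exists>b\<in>carrier A. I +> a = I +> frobenius p A b)"
  (is "_ \<longleftrightarrow> ?inj \<and> ?surj")
proof -
  let ?Q = "delta_quot A I"
  have closed: "frobenius p A a \<in> carrier A" if "a \<in> carrier A" for a
    using frobenius_ring_hom[OF prime_p delta_ring_axioms] that by (rule ring_hom_closed)
  interpret Q: delta_ring p ?Q by (rule delta_quot)
  have hom: "frobenius p ?Q \<in> ring_hom ?Q ?Q"
    by (rule frobenius_ring_hom[OF prime_p delta_quot(1)])
  interpret F: ring_hom_ring ?Q ?Q "frobenius p ?Q"
    using hom by (intro ring_hom_ringI2 Q.ring_axioms)
  have zero: "\<zero>\<^bsub>?Q\<^esub> \<in> carrier ?Q" by simp
  have "inj_on (frobenius p ?Q) (carrier ?Q) \<longleftrightarrow> (\<forall>X\<in>carrier ?Q. frobenius p ?Q X = \<zero>\<^bsub>?Q\<^esub> \<longrightarrow> X = \<zero>\<^bsub>?Q\<^esub>)"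
  proof
    assume "inj_on (frobenius p ?Q) (carrier ?Q)"
    then show "\<forall>X\<in>carrier ?Q. frobenius p ?Q X = \<zero>\<^bsub>?Q\<^esub> \<longrightarrow> X = \<zero>\<^bsub>?Q\<^esub>"
      using zero F.hom_zero by (metis inj_onD)
  next
    assume *: "\<forall>X\<in>carrier ?Q. frobenius p ?Q X = \<zero>\<^bsub>?Q\<^esub> \<longrightarrow> X = \<zero>\<^bsub>?Q\<^esub>"
    then have "a_kernel ?Q ?Q (frobenius p ?Q) = {\<zero>\<^bsub>?Q\<^esub>}"
      using zero F.hom_zero unfolding a_kernel_def' by blast
    then show "inj_on (frobenius p ?Q) (carrier ?Q)" by (rule F.trivial_ker_imp_inj)
  qed
  also have "\<dots> \<longleftrightarrow> ?inj"
    by (simp add: delta_quot_simps(1) frobenius_delta_quot coset_zero_iff closed)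
  finally have inj: "inj_on (frobenius p ?Q) (carrier ?Q) \<longleftrightarrow> ?inj" .
  have "frobenius p ?Q ` carrier ?Q \<subseteq> carrier ?Q" using F.hom_closed by blast
  then have "frobenius p ?Q ` carrier ?Q = carrier ?Q \<longleftrightarrow> carrier ?Q \<subseteq> frobenius p ?Q ` carrier ?Q"
    by blast
  also have "\<dots> \<longleftrightarrow> ?surj"
    by (simp add: delta_quot_simps(1) image_image frobenius_delta_quot image_subset_iff image_iff)
  finally show ?thesis
    using inj hom delta_quot(1) by (auto simp: perfect_delta_ring_def ring_iso_def bij_betw_def)
qed

end

lemma delta_ideal_delta_nilradical:
  assumes "delta_ring p A"
  shows "delta_ideal p A (delta_nilradical A)"
proof -
  interpret A: delta_ring p A by fact
  show ?thesis
    by (intro delta_ideal.intro delta_ideal_axioms.intro assms ideal_delta_nilradical[OF A.prime_p assms]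
        delta_nilradical_delta[OF A.prime_p assms])
qed

text \<open>
  A fibre product with a limit lies in a product of \<open>\<delta>\<close>-rings, and equations can be checked on the
  factors. There are two kinds of projection, \<open>g\<close> and \<open>h i\<close>, because the factors have different types.
\<close>

lemma delta_ring_of_jointly_faithful:
  fixes B (structure)
  assumes C: "delta_ring p C" and D: "\<And>i. delta_ring p (D i)"
    and closed: "\<And>x y. x \<in> carrier B \<Longrightarrow> y \<in> carrier B \<Longrightarrow> x \<otimes>\<^bsub>B\<^esub> y \<in> carrier B"
      "\<And>x y. x \<in> carrier B \<Longrightarrow> y \<in> carrier B \<Longrightarrow> x \<oplus>\<^bsub>B\<^esub> y \<in> carrier B"
      "\<one>\<^bsub>B\<^esub> \<in> carrier B" "\<zero>\<^bsub>B\<^esub> \<in> carrier B" "\<And>x. x \<in> carrier B \<Longrightarrow> \<delta>\<^bsub>B\<^esub> x \<in> carrier B"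
    and neg: "\<And>x. x \<in> carrier B \<Longrightarrow> \<exists>y\<in>carrier B. y \<oplus>\<^bsub>B\<^esub> x = \<zero>\<^bsub>B\<^esub>"
    and g: "\<And>x. x \<in> carrier B \<Longrightarrow> g x \<in> carrier C"
      "\<And>x y. x \<in> carrier B \<Longrightarrow> y \<in> carrier B \<Longrightarrow> g (x \<otimes>\<^bsub>B\<^esub> y) = g x \<otimes>\<^bsub>C\<^esub> g y"
      "\<And>x y. x \<in> carrier B \<Longrightarrow> y \<in> carrier B \<Longrightarrow> g (x \<oplus>\<^bsub>B\<^esub> y) = g x \<oplus>\<^bsub>C\<^esub> g y"
      "g \<one>\<^bsub>B\<^esub> = \<one>\<^bsub>C\<^esub>" "g \<zero>\<^bsub>B\<^esub> = \<zero>\<^bsub>C\<^esub>" "\<And>x. x \<in> carrier B \<Longrightarrow> g (\<delta>\<^bsub>B\<^esub> x) = \<delta>\<^bsub>C\<^esub> (g x)"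
    and h: "\<And>i x. x \<in> carrier B \<Longrightarrow> h i x \<in> carrier (D i)"
      "\<And>i x y. x \<in> carrier B \<Longrightarrow> y \<in> carrier B \<Longrightarrow> h i (x \<otimes>\<^bsub>B\<^esub> y) = h i x \<otimes>\<^bsub>D i\<^esub> h i y"
      "\<And>i x y. x \<in> carrier B \<Longrightarrow> y \<in> carrier B \<Longrightarrow> h i (x \<oplus>\<^bsub>B\<^esub> y) = h i x \<oplus>\<^bsub>D i\<^esub> h i y"
      "\<And>i. h i \<one>\<^bsub>B\<^esub> = \<one>\<^bsub>D i\<^esub>" "\<And>i. h i \<zero>\<^bsub>B\<^esub> = \<zero>\<^bsub>D i\<^esub>"
      "\<And>i x. x \<in> carrier B \<Longrightarrow> h i (\<delta>\<^bsub>B\<^esub> x) = \<delta>\<^bsub>D i\<^esub> (h i x)"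
    and faithful: "\<And>x y. x \<in> carrier B \<Longrightarrow> y \<in> carrier B \<Longrightarrow> g x = g y \<Longrightarrow> (\<And>i. h i x = h i y) \<Longrightarrow> x = y"
  shows "delta_ring p B"
proof -
  interpret C: delta_ring p C by (rule C)
  interpret D: delta_ring p "D i" for i by (rule D)
  have "cring B"
    by (intro cringI abelian_groupI comm_monoidI; (rule neg closed; assumption)?)
      (auto intro!: faithful simp: closed g h C.a_ac C.m_ac C.l_distr C.r_distr D.a_ac D.m_ac D.l_distr D.r_distr)
  interpret B: cring B by (rule \<open>cring B\<close>)
  interpret g: ring_hom_cring B C g
    by unfold_locales (auto intro!: ring_hom_memI simp: g)
  interpret h: ring_hom_cring B "D i" "h i" for i
    by unfold_locales (auto intro!: ring_hom_memI simp: h)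
  show ?thesis
  proof (intro delta_ring.intro delta_ring_axioms.intro B.is_cring C.prime_p)
    show "\<delta>\<^bsub>B\<^esub> \<zero>\<^bsub>B\<^esub> = \<zero>\<^bsub>B\<^esub>" "\<delta>\<^bsub>B\<^esub> \<one>\<^bsub>B\<^esub> = \<zero>\<^bsub>B\<^esub>"
      by (auto intro!: faithful simp: closed g h C.delta_zero C.delta_one D.delta_zero D.delta_one)
    fix x y assume xy: "x \<in> carrier B" "y \<in> carrier B"
    show "\<delta>\<^bsub>B\<^esub> (x \<otimes>\<^bsub>B\<^esub> y) = x [^]\<^bsub>B\<^esub> p \<otimes>\<^bsub>B\<^esub> \<delta>\<^bsub>B\<^esub> y \<oplus>\<^bsub>B\<^esub> y [^]\<^bsub>B\<^esub> p \<otimes>\<^bsub>B\<^esub> \<delta>\<^bsub>B\<^esub> x \<oplus>\<^bsub>B\<^esub> [p] \<cdot>\<^bsub>B\<^esub> (\<delta>\<^bsub>B\<^esub> x \<otimes>\<^bsub>B\<^esub> \<delta>\<^bsub>B\<^esub> y)"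
      using xy by (intro faithful) (simp_all add: closed g(1,6) h(1,6) C.delta_mult D.delta_mult)
    have "\<delta>\<^bsub>B\<^esub> (x \<oplus>\<^bsub>B\<^esub> y) = \<delta>\<^bsub>B\<^esub> x \<oplus>\<^bsub>B\<^esub> \<delta>\<^bsub>B\<^esub> y \<ominus>\<^bsub>B\<^esub> frob_defect p B x y"
      using xy by (intro faithful) (simp_all add: closed g(1,6) h(1,6) C.delta_add_defect D.delta_add_defect g.hom_frob_defect h.hom_frob_defect)
    then show "\<delta>\<^bsub>B\<^esub> (x \<oplus>\<^bsub>B\<^esub> y) = \<delta>\<^bsub>B\<^esub> x \<oplus>\<^bsub>B\<^esub> \<delta>\<^bsub>B\<^esub> y \<ominus>\<^bsub>B\<^esub>
      (\<Oplus>\<^bsub>B\<^esub>i\<in>{1..p-1}. [((p choose i) div p)] \<cdot>\<^bsub>B\<^esub> (x [^]\<^bsub>B\<^esub> i \<otimes>\<^bsub>B\<^esub> y [^]\<^bsub>B\<^esub> (p - i)))"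
      unfolding frob_defect_def .
  qed (rule closed)
qed

section \<open>Sheared Witt vectors\<close>

locale witt_base =
  fixes p :: nat and R :: "('a, 'm) ring_scheme"
  assumes p: "prime p" and R: "cring R"
begin

abbreviation "W \<equiv> witt p R"
abbreviation "Q \<equiv> witt_Q p R"
abbreviation "S \<equiv> sheared_witt p R"
abbreviation "cls x \<equiv> witt_hat p R +>\<^bsub>witt p R\<^esub> x"

sublocale R: cring R by (rule R)
sublocale W: delta_ideal p W "witt_hat p R"
  by (intro delta_ideal.intro delta_ideal_axioms.intro delta_ring_witt[OF p R] ideal_witt_hat[OF p R]
      witt_hat_delta[OF p R])

lemma delta_ring_witt_Q: "delta_ring p Q"
  unfolding witt_Q_def by (rule W.delta_quot)

lemma cls_delta_hom: "(\<lambda>x. cls x) \<in> delta_hom W Q"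
  unfolding witt_Q_def by (rule W.delta_quot)

lemma witt_Q_carrier: "carrier Q = (\<lambda>x. cls x) ` carrier W"
  unfolding witt_Q_def by (rule W.delta_quot_simps)

lemma cls_zero_iff: "x \<in> carrier W \<Longrightarrow> cls x = \<zero>\<^bsub>Q\<^esub> \<longleftrightarrow> x \<in> witt_hat p R"
  unfolding witt_Q_def by (rule W.coset_zero_iff)

sublocale Q: delta_ring p Q by (rule delta_ring_witt_Q)
sublocale cls: ring_hom_cring W Q "\<lambda>x. cls x"
  using cls_delta_hom by unfold_locales (simp add: delta_hom_def)
sublocale FQ: ring_hom_cring Q Q "frobenius p Q"
  using frobenius_ring_hom[OF p delta_ring_witt_Q] by unfold_locales
sublocale e: ring_hom_cring W R "\<lambda>x. x 0"
  using witt_zeroth_hom[OF p R] by unfold_locales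

lemma cls_frobenius: "x \<in> carrier W \<Longrightarrow> frobenius p Q (cls x) = cls (frobenius p W x)"
  unfolding witt_Q_def by (rule W.frobenius_delta_quot)

text \<open>
  \<open>F\<close> is \<open>x \<mapsto> x\<^sup>p + p \<delta>(x)\<close> on Witt vectors, so the limit is formed along the Frobenius map of the
  \<open>\<delta>\<close>-ring \<open>Q(R)\<close>.
\<close>

lemma witt_Q_F_eq:
  assumes "X \<in> carrier Q"
  shows "witt_Q_F p R X = frobenius p Q X"
proof -
  obtain x where x: "x \<in> carrier W" "X = cls x" using assms by (auto simp: witt_Q_carrier)
  have F: "cls (witt_F p R y) = frobenius p Q (cls y)" if "y \<in> carrier W" for y
    using frobenius_witt[OF p R that] cls_frobenius[OF that] by simp
  have "witt_Q_F p R X = cls (witt_F p R x)"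
    unfolding witt_Q_F_def x(2)
  proof (rule coset_map_eq[OF W.is_ideal])
    fix i assume i: "i \<in> witt_hat p R"
    then have "cls (i \<oplus>\<^bsub>W\<^esub> x) = cls x"
      using W.Icarr[OF i] cls_zero_iff[OF W.Icarr[OF i]] x by simp
    then show "cls (witt_F p R (i \<oplus>\<^bsub>W\<^esub> x)) = cls (witt_F p R x)"
      using x W.Icarr[OF i] by (simp add: F)
  qed
  then show ?thesis using F x by simp
qed

text \<open>
  Let \<open>x\<close> represent \<open>X\<close>. Modulo \<^const>\<open>witt_hat\<close> the iterates \<open>\<delta>\<^sup>i(x)\<close> are nilpotent, so their zeroth components
  are nilpotent. Some iterate lies in \<^const>\<open>witt_hat\<close> and is therefore \<open>\<delta>\<close>-nilpotent itself, so the zeroth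
  components of later iterates are \<open>0\<close>. These zeroth components decide membership in \<^const>\<open>witt_hat\<close>.
\<close>

lemma witt_Q_delta_reduced:
  assumes X: "X \<in> carrier Q" and nil: "delta_nilpotent Q X"
  shows "X = \<zero>\<^bsub>Q\<^esub>"
proof -
  obtain x where x: "x \<in> carrier W" "X = cls x" using X by (auto simp: witt_Q_carrier)
  have d: "(delta Q ^^ i) X = cls ((delta W ^^ i) x)" for i
    using delta_hom_funpow[OF W.delta_ring_axioms cls_delta_hom x(1)] x(2) by simp
  note c = W.delta_funpow_closed[OF x(1)]
  have nilQ: "\<exists>n. cls ((delta W ^^ i) x [^]\<^bsub>W\<^esub> (n::nat)) = \<zero>\<^bsub>Q\<^esub>" for i
    using nil c[of i] unfolding delta_nilpotent_def d nilpotent_def by simp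
  have "nilpotent R ((delta W ^^ i) x 0)" for i
  proof -
    obtain n :: nat where "cls ((delta W ^^ i) x [^]\<^bsub>W\<^esub> n) = \<zero>\<^bsub>Q\<^esub>" using nilQ[of i] by blast
    then have "(delta W ^^ i) x [^]\<^bsub>W\<^esub> n \<in> witt_hat p R"
      by (rule iffD1[OF cls_zero_iff, rotated]) (simp add: c)
    then have "nilpotent R (((delta W ^^ i) x [^]\<^bsub>W\<^esub> n) 0)" by (simp add: witt_hat_iff[OF p R])
    then have "nilpotent R ((delta W ^^ i) x 0 [^]\<^bsub>R\<^esub> n)" using c[of i] by simp
    then show ?thesis
      using e.hom_closed[OF c[of i]] by (auto simp: nilpotent_def R.nat_pow_pow)
  qed
  moreover obtain N where "(delta Q ^^ N) X = \<zero>\<^bsub>Q\<^esub>" using nil by (auto simp: delta_nilpotent_def)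
  then have "(delta W ^^ N) x \<in> witt_hat p R" using d c by (simp add: cls_zero_iff)
  then have "delta_nilpotent W ((delta W ^^ N) x)" by (rule delta_nilpotent_witt_hat[OF p R])
  then obtain M where M: "\<And>i. i \<ge> M \<Longrightarrow> (delta W ^^ i) ((delta W ^^ N) x) = \<zero>\<^bsub>W\<^esub>"
    by (auto simp: delta_nilpotent_def)
  have "(delta W ^^ k) x 0 = \<zero>\<^bsub>R\<^esub>" if "k \<ge> M + N" for k
    using M[of "k - N"] that by (simp add: funpow_add[symmetric, THEN fun_cong, simplified] witt_zero)
  ultimately have "x \<in> witt_hat p R"
    by (rule witt_hat_of_delta_components[OF p R x(1)])
  then show ?thesis using x by (simp add: cls_zero_iff)
qed

lemma sheared_carrier:
  "z \<in> carrier S \<longleftrightarrow> fst z \<in> carrier W \<and> (\<forall>n. snd z n \<in> carrier Q) \<and>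
    (\<forall>n. frobenius p Q (snd z (Suc n)) = snd z n) \<and> cls (fst z) = snd z 0"
  using witt_Q_F_eq
  by (cases z) (auto simp: sheared_witt_def delta_fibre_product_def delta_tower_limit_def)

lemma sheared_ops:
  "fst (z \<otimes>\<^bsub>S\<^esub> w) = fst z \<otimes>\<^bsub>W\<^esub> fst w" "snd (z \<otimes>\<^bsub>S\<^esub> w) n = snd z n \<otimes>\<^bsub>Q\<^esub> snd w n"
  "fst (z \<oplus>\<^bsub>S\<^esub> w) = fst z \<oplus>\<^bsub>W\<^esub> fst w" "snd (z \<oplus>\<^bsub>S\<^esub> w) n = snd z n \<oplus>\<^bsub>Q\<^esub> snd w n"
  "fst \<one>\<^bsub>S\<^esub> = \<one>\<^bsub>W\<^esub>" "snd \<one>\<^bsub>S\<^esub> n = \<one>\<^bsub>Q\<^esub>"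
  "fst \<zero>\<^bsub>S\<^esub> = \<zero>\<^bsub>W\<^esub>" "snd \<zero>\<^bsub>S\<^esub> n = \<zero>\<^bsub>Q\<^esub>"
  "fst (\<delta>\<^bsub>S\<^esub> z) = \<delta>\<^bsub>W\<^esub> (fst z)" "snd (\<delta>\<^bsub>S\<^esub> z) n = \<delta>\<^bsub>Q\<^esub> (snd z n)"
  by (simp_all add: sheared_witt_def delta_fibre_product_def delta_tower_limit_def split: prod.split)

lemma sheared_eqI: "fst z = fst w \<Longrightarrow> (\<And>n. snd z n = snd w n) \<Longrightarrow> z = w"
  for z w :: "(nat \<Rightarrow> 'a) \<times> (nat \<Rightarrow> (nat \<Rightarrow> 'a) set)"
  by (auto intro: prod_eqI)

lemma delta_ring_sheared: "delta_ring p S"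
proof (rule delta_ring_of_jointly_faithful[where C = W and D = "\<lambda>_. Q" and g = fst and h = "\<lambda>n z. snd z n"])
  have delta_cls: "cls (\<delta>\<^bsub>W\<^esub> x) = \<delta>\<^bsub>Q\<^esub> (cls x)" if "x \<in> carrier W" for x
    using cls_delta_hom that by (simp add: delta_hom_def)
  show "z \<otimes>\<^bsub>S\<^esub> w \<in> carrier S" "z \<oplus>\<^bsub>S\<^esub> w \<in> carrier S" if "z \<in> carrier S" "w \<in> carrier S" for z w
    using that unfolding sheared_carrier sheared_ops by auto
  show "\<one>\<^bsub>S\<^esub> \<in> carrier S" "\<zero>\<^bsub>S\<^esub> \<in> carrier S"
    unfolding sheared_carrier sheared_ops using cls.hom_one cls.hom_zero by auto
  show "\<delta>\<^bsub>S\<^esub> z \<in> carrier S" if "z \<in> carrier S" for z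
    using that unfolding sheared_carrier sheared_ops
    by (auto simp: W.delta_closed Q.delta_closed delta_cls delta_frobenius[OF p delta_ring_witt_Q, symmetric])
  show "\<exists>w\<in>carrier S. w \<oplus>\<^bsub>S\<^esub> z = \<zero>\<^bsub>S\<^esub>" if "z \<in> carrier S" for z
  proof (rule bexI[of _ "(\<ominus>\<^bsub>W\<^esub> fst z, \<lambda>n. \<ominus>\<^bsub>Q\<^esub> snd z n)"])
    show "(\<ominus>\<^bsub>W\<^esub> fst z, \<lambda>n. \<ominus>\<^bsub>Q\<^esub> snd z n) \<in> carrier S"
      using that by (auto simp: sheared_carrier)
    show "(\<ominus>\<^bsub>W\<^esub> fst z, \<lambda>n. \<ominus>\<^bsub>Q\<^esub> snd z n) \<oplus>\<^bsub>S\<^esub> z = \<zero>\<^bsub>S\<^esub>"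
      using that by (intro sheared_eqI) (auto simp: sheared_carrier sheared_ops W.l_neg Q.l_neg)
  qed
qed (auto simp: sheared_ops sheared_carrier delta_ring_witt_Q W.delta_ring_axioms intro: sheared_eqI)

end


lemma (in ring) minus_eq_zeroD:
  assumes "x \<ominus> y = \<zero>" "x \<in> carrier R" "y \<in> carrier R"
  shows "x = y"
proof -
  have "x = (x \<ominus> y) \<oplus> y" using assms(2,3) by (simp add: minus_eq a_assoc l_neg)
  then show ?thesis using assms by simp
qed

lemma delta_nilradicalD: "a \<in> delta_nilradical A \<Longrightarrow> delta_nilpotent A a"
  by (simp add: delta_nilradical_def)

context witt_base
begin

sublocale S: delta_ring p S by (rule delta_ring_sheared)

lemma fst_delta_hom: "fst \<in> delta_hom S W"
  by (auto simp: delta_hom_def sheared_ops sheared_carrier intro!: ring_hom_memI)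

lemma snd_delta_hom: "(\<lambda>z. snd z n) \<in> delta_hom S Q"
  by (auto simp: delta_hom_def sheared_ops sheared_carrier intro!: ring_hom_memI)

sublocale fst: ring_hom_cring S W fst
  using fst_delta_hom by unfold_locales (simp add: delta_hom_def)

sublocale snd: ring_hom_cring S Q "\<lambda>z. snd z n" for n
  using snd_delta_hom by unfold_locales (simp add: delta_hom_def)

lemma witt_hat_of_delta_nilpotent:
  "x \<in> carrier W \<Longrightarrow> delta_nilpotent W x \<Longrightarrow> x \<in> witt_hat p R"
  unfolding delta_nilradical_witt[OF p R, symmetric] delta_nilradical_def by blast

lemma sheared_delta_nilradical:
  "delta_nilradical S = {z \<in> carrier S. fst z \<in> witt_hat p R \<and> (\<forall>n. snd z n = \<zero>\<^bsub>Q\<^esub>)}"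
proof (rule subset_antisym; rule subsetI)
  fix z assume z: "z \<in> delta_nilradical S"
  then have zc: "z \<in> carrier S" by (simp add: delta_nilradical_def)
  have nil: "delta_nilpotent S z" using z by (simp add: delta_nilradical_def)
  have "delta_nilpotent W (fst z)"
    by (rule delta_hom_nilpotent[OF delta_ring_sheared W.delta_ring_axioms fst_delta_hom zc nil])
  then have "fst z \<in> witt_hat p R"
    using fst.hom_closed[OF zc] by (intro witt_hat_of_delta_nilpotent)
  moreover have "snd z n = \<zero>\<^bsub>Q\<^esub>" for n
    by (rule witt_Q_delta_reduced[OF snd.hom_closed[OF zc]
          delta_hom_nilpotent[OF delta_ring_sheared delta_ring_witt_Q snd_delta_hom zc nil]])
  ultimately show "z \<in> {z \<in> carrier S. fst z \<in> witt_hat p R \<and> (\<forall>n. snd z n = \<zero>\<^bsub>Q\<^esub>)}"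
    using zc by blast
next
  fix z assume z: "z \<in> {z \<in> carrier S. fst z \<in> witt_hat p R \<and> (\<forall>n. snd z n = \<zero>\<^bsub>Q\<^esub>)}"
  then have zc: "z \<in> carrier S" by simp
  have nil: "delta_nilpotent W (fst z)" using z by (auto intro: delta_nilpotent_witt_hat[OF p R])
  have Q0: "(delta Q ^^ i) \<zero>\<^bsub>Q\<^esub> = \<zero>\<^bsub>Q\<^esub>" for i by (induction i) (simp_all add: Q.delta_zero)
  have c: "(delta S ^^ i) z \<in> carrier S" for i by (rule S.delta_funpow_closed[OF zc])
  have f: "fst ((delta S ^^ i) z) = (delta W ^^ i) (fst z)" for i
    by (rule delta_hom_funpow[OF delta_ring_sheared fst_delta_hom zc])
  have s: "snd ((delta S ^^ i) z) n = \<zero>\<^bsub>Q\<^esub>" for i n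
    using delta_hom_funpow[OF delta_ring_sheared snd_delta_hom zc, of i n] z by (simp add: Q0)
  have "nilpotent S ((delta S ^^ i) z)" for i
  proof -
    obtain n :: nat where n: "(delta W ^^ i) (fst z) [^]\<^bsub>W\<^esub> n = \<zero>\<^bsub>W\<^esub>"
      using nil by (auto simp: delta_nilpotent_def nilpotent_def)
    \<comment> \<open>The exponent is positive so that the power vanishes in \<open>Q(R)\<close> as well.\<close>
    have "(delta S ^^ i) z [^]\<^bsub>S\<^esub> Suc n = \<zero>\<^bsub>S\<^esub>"
    proof (rule sheared_eqI)
      show "fst ((delta S ^^ i) z [^]\<^bsub>S\<^esub> Suc n) = fst \<zero>\<^bsub>S\<^esub>"
        using c[of i] n W.delta_funpow_closed[OF fst.hom_closed[OF zc]] by (simp add: sheared_ops f)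
      show "snd ((delta S ^^ i) z [^]\<^bsub>S\<^esub> Suc n) m = snd \<zero>\<^bsub>S\<^esub> m" for m
        using c[of i] by (simp add: sheared_ops s)
    qed
    then show ?thesis using c[of i] unfolding nilpotent_def by blast
  qed
  moreover obtain N where N: "\<And>i. i \<ge> N \<Longrightarrow> (delta W ^^ i) (fst z) = \<zero>\<^bsub>W\<^esub>"
    using nil by (auto simp: delta_nilpotent_def)
  have "(delta S ^^ i) z = \<zero>\<^bsub>S\<^esub>" if "i \<ge> N" for i
    by (rule sheared_eqI) (simp_all add: f s N[OF that] sheared_ops)
  ultimately show "z \<in> delta_nilradical S"
    using zc unfolding delta_nilradical_def delta_nilpotent_def by blast
qed

text \<open>
  The shifted sequence, together with any Witt vector in the class that is then required, is a
  Frobenius preimage up to an element \<open>(x, 0)\<close> of the \<open>\<delta>\<close>-nilradical.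
\<close>

lemma sheared_delta_nilperfect: "delta_nilperfect p S"
proof -
  interpret N: delta_ideal p S "delta_nilradical S"
    by (rule delta_ideal_delta_nilradical[OF delta_ring_sheared])
  have Fc: "frobenius p S z \<in> carrier S" if "z \<in> carrier S" for z
    using frobenius_ring_hom[OF p delta_ring_sheared] that by (rule ring_hom_closed)
  have f: "fst (frobenius p S z) = frobenius p W (fst z)" if "z \<in> carrier S" for z
    by (rule delta_hom_frobenius[OF delta_ring_sheared W.delta_ring_axioms fst_delta_hom that])
  have s: "snd (frobenius p S z) n = frobenius p Q (snd z n)" if "z \<in> carrier S" for z n
    by (rule delta_hom_frobenius[OF delta_ring_sheared delta_ring_witt_Q snd_delta_hom that])
  have "z \<in> delta_nilradical S" if z: "z \<in> carrier S" "frobenius p S z \<in> delta_nilradical S" for z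
  proof -
    have z0: "snd z n = \<zero>\<^bsub>Q\<^esub>" for n
    proof -
      have "snd z n = snd (frobenius p S z) (Suc n)" using z(1) unfolding s[OF z(1)] sheared_carrier by metis
      also have "\<dots> = \<zero>\<^bsub>Q\<^esub>" using z(2) unfolding sheared_delta_nilradical by blast
      finally show ?thesis .
    qed
    moreover have "fst z \<in> witt_hat p R"
    proof -
      have "fst z \<in> carrier W" "cls (fst z) = snd z 0" using z(1) unfolding sheared_carrier by blast+
      then show ?thesis using cls_zero_iff z0[of 0] by metis
    qed
    ultimately show ?thesis using z(1) unfolding sheared_delta_nilradical by blast
  qed
  moreover have "\<exists>w\<in>carrier S. delta_nilradical S +>\<^bsub>S\<^esub> z = delta_nilradical S +>\<^bsub>S\<^esub> frobenius p S w"
    if z: "z \<in> carrier S" for z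
  proof -
    \<comment> \<open>A preimage must have the shifted sequence as second component, hence first component over \<open>snd z 1\<close>.\<close>
    have "snd z 1 \<in> carrier Q" by (rule snd.hom_closed[OF z])
    then obtain x where x: "x \<in> carrier W" "snd z 1 = cls x" by (auto simp: witt_Q_carrier)
    define w where "w = (x, \<lambda>n. snd z (Suc n))"
    have zF: "frobenius p Q (snd z (Suc n)) = snd z n" and z0: "cls (fst z) = snd z 0" for n
      using z unfolding sheared_carrier by blast+
    have w: "w \<in> carrier S"
      unfolding sheared_carrier w_def fst_conv snd_conv using x zF snd.hom_closed[OF z] by auto
    have fx: "frobenius p W x \<in> carrier W"
      using frobenius_ring_hom[OF p W.delta_ring_axioms] x(1) by (rule ring_hom_closed)
    have "cls (frobenius p W x) = cls (fst z)"
      using x zF[of 0] z0 by (simp add: cls_frobenius[symmetric])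
    then have "fst z \<ominus>\<^bsub>W\<^esub> frobenius p W x \<in> witt_hat p R"
      using z fx by (subst W.coset_eq_iff[symmetric]) auto
    then have "fst (z \<ominus>\<^bsub>S\<^esub> frobenius p S w) \<in> witt_hat p R"
      using z Fc[OF w] f[OF w] by (simp add: w_def)
    moreover have "snd (z \<ominus>\<^bsub>S\<^esub> frobenius p S w) n = \<zero>\<^bsub>Q\<^esub>" for n
    proof -
      have "snd (frobenius p S w) n = snd z n"
        using s[OF w, of n] zF[of n] by (simp add: w_def)
      then show ?thesis
        using snd.hom_a_minus[OF z Fc[OF w], of n] snd.hom_closed[OF z, of n] by (simp add: Q.minus_eq Q.r_neg)
    qed
    ultimately have "z \<ominus>\<^bsub>S\<^esub> frobenius p S w \<in> delta_nilradical S"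
      using S.minus_closed[OF z Fc[OF w]] unfolding sheared_delta_nilradical by blast
    then show ?thesis using w z Fc[OF w] N.coset_eq_iff by blast
  qed
  ultimately have "perfect_delta_ring p (delta_quot S (delta_nilradical S))"
    unfolding N.perfect_delta_quot_iff by blast
  then show ?thesis using delta_ring_sheared by (simp add: delta_nilperfect_def)
qed

lemma sheared_witt_proj_hom: "sheared_witt_proj \<in> ring_hom S R"
proof -
  have "sheared_witt_proj = (\<lambda>x. x 0) \<circ> (fst :: _ \<Rightarrow> nat \<Rightarrow> 'a)"
    by (auto simp: sheared_witt_proj_def)
  then show ?thesis using ring_hom_trans[OF fst.homh e.homh] by metis
qed

lemma frobenius_funpow_snd:
  assumes "z \<in> carrier S"
  shows "(frobenius p Q ^^ n) (snd z n) = snd z 0"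
proof (induction n)
  case (Suc n)
  have "frobenius p Q (snd z (Suc n)) = snd z n" using assms unfolding sheared_carrier by blast
  then show ?case using Suc unfolding funpow_Suc_right comp_def by simp
qed simp

end

lemma delta_hom_comp: "g \<in> delta_hom A B \<Longrightarrow> h \<in> delta_hom B C \<Longrightarrow> h \<circ> g \<in> delta_hom A C"
  by (auto simp: delta_hom_def ring_hom_closed intro: ring_hom_trans)

lemma delta_hom_frobenius_funpow:
  assumes "prime p" "delta_ring p A"
  shows "(frobenius p A ^^ n) \<in> delta_hom A A"
proof (induction n)
  case 0
  show ?case by (auto simp: delta_hom_def intro: ring_hom_memI)
next
  case (Suc n)
  have "frobenius p A \<in> delta_hom A A"
    using frobenius_ring_hom[OF assms] delta_frobenius[OF assms] by (simp add: delta_hom_def)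
  then show ?case using delta_hom_comp[OF Suc] by (simp add: comp_def)
qed

lemma delta_hom_frobenius_iterate:
  assumes "prime p" "delta_ring p A" "delta_ring p B" "h \<in> delta_hom A B" "x \<in> carrier A"
  shows "h ((frobenius p A ^^ n) x) = (frobenius p B ^^ n) (h x)"
proof (induction n)
  case (Suc n)
  have "(frobenius p A ^^ n) x \<in> carrier A"
    using delta_hom_frobenius_funpow[OF assms(1,2), of n] assms(5)
    by (auto simp: delta_hom_def dest: ring_hom_closed)
  then show ?case using delta_hom_frobenius[OF assms(2-4)] Suc by simp
qed simp

locale nilperfect_source = witt_base p R for p and R :: "('a, 'm) ring_scheme" +
  fixes A :: "('b, 'k) dring_scheme"
  assumes A_nilperfect: "delta_nilperfect p A"
begin

abbreviation "N \<equiv> delta_nilradical A"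

lemma delta_ring_A: "delta_ring p A"
  using A_nilperfect by (simp add: delta_nilperfect_def)

sublocale A: delta_ideal p A N
  by (rule delta_ideal_delta_nilradical[OF delta_ring_A])

abbreviation "\<phi> \<equiv> frobenius p A"

lemma phi_closed: "a \<in> carrier A \<Longrightarrow> (\<phi> ^^ n) a \<in> carrier A"
  using delta_hom_frobenius_funpow[OF p delta_ring_A, of n]
  by (auto simp: delta_hom_def dest: ring_hom_closed)

lemma phi_inj: "a \<in> carrier A \<Longrightarrow> (\<phi> ^^ n) a \<in> N \<Longrightarrow> a \<in> N"
proof (induction n)
  case (Suc n)
  have "\<phi> b \<in> N \<Longrightarrow> b \<in> N" if "b \<in> carrier A" for b
    using A_nilperfect that unfolding delta_nilperfect_def A.perfect_delta_quot_iff by blast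
  moreover have "\<phi> ((\<phi> ^^ n) a) \<in> N" using Suc.prems(2) by simp
  ultimately show ?case using Suc.IH Suc.prems(1) phi_closed by blast
qed simp

lemma phi_surj: "a \<in> carrier A \<Longrightarrow> \<exists>b\<in>carrier A. N +>\<^bsub>A\<^esub> a = N +>\<^bsub>A\<^esub> (\<phi> ^^ n) b"
proof (induction n arbitrary: a)
  case 0
  then show ?case by auto
next
  case (Suc n)
  obtain b where b: "b \<in> carrier A" "N +>\<^bsub>A\<^esub> a = N +>\<^bsub>A\<^esub> \<phi> b"
    using A_nilperfect Suc.prems unfolding delta_nilperfect_def A.perfect_delta_quot_iff by blast
  obtain c where c: "c \<in> carrier A" "N +>\<^bsub>A\<^esub> b = N +>\<^bsub>A\<^esub> (\<phi> ^^ n) c"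
    using Suc.IH[OF b(1)] by blast
  have "N +>\<^bsub>A\<^esub> \<phi> b = N +>\<^bsub>A\<^esub> \<phi> ((\<phi> ^^ n) c)"
    using A.frobenius_delta_quot[OF b(1)] A.frobenius_delta_quot[OF phi_closed[OF c(1)]] c(2) by metis
  then show ?case using b c by auto
qed

lemma phi_coset_inj:
  assumes "a \<in> carrier A" "b \<in> carrier A" "N +>\<^bsub>A\<^esub> (\<phi> ^^ n) a = N +>\<^bsub>A\<^esub> (\<phi> ^^ n) b"
  shows "N +>\<^bsub>A\<^esub> a = N +>\<^bsub>A\<^esub> b"
proof -
  interpret h: ring_hom_cring A A "\<phi> ^^ n"
    using delta_hom_frobenius_funpow[OF p delta_ring_A, of n] by unfold_locales (simp add: delta_hom_def)
  have "(\<phi> ^^ n) (a \<ominus>\<^bsub>A\<^esub> b) \<in> N"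
    using assms by (simp add: A.coset_eq_iff)
  then show ?thesis using phi_inj[of "a \<ominus>\<^bsub>A\<^esub> b" n] assms by (simp add: A.coset_eq_iff)
qed

text \<open>
  The first components agree because they are polynomials in the zeroth components at the iterates
  of \<open>\<delta>\<close>. For the sequence in \<open>Q(R)\<close>, write \<open>a\<close> as \<open>\<phi>\<^sup>n(b)\<close> modulo \<open>N\<close>: term \<open>n\<close> of its value kills \<open>N\<close>, and
  at \<open>\<phi>\<^sup>n(b)\<close> it is \<open>F\<^sup>n\<close> of the term \<open>n\<close> at \<open>b\<close>, which is the last term at \<open>b\<close>. This is the class of the
  first component at \<open>b\<close>.
\<close>

lemma delta_hom_determined:
  assumes h: "h \<in> delta_hom A S" and g: "g \<in> delta_hom A S"
    and eq: "\<And>a. a \<in> carrier A \<Longrightarrow> sheared_witt_proj (h a) = sheared_witt_proj (g a)"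
    and a: "a \<in> carrier A"
  shows "h a = g a"
proof -
  have fst_theta: "fst (k b) = (\<lambda>n. zpoly_eval R (\<lambda>i. sheared_witt_proj (k ((delta A ^^ i) b))) (theta p n))"
    if k: "k \<in> delta_hom A S" and b: "b \<in> carrier A" for k b
  proof -
    have fk: "fst \<circ> k \<in> delta_hom A W" by (rule delta_hom_comp[OF k fst_delta_hom])
    have W: "fst (k b) \<in> carrier W"
      using k b by (auto simp: delta_hom_def dest: ring_hom_closed)
    have "(delta W ^^ i) (fst (k b)) = fst (k ((delta A ^^ i) b))" for i
      using delta_hom_funpow[OF delta_ring_A fk b, of i] by simp
    then show ?thesis
      by (subst witt_eq_theta[OF p R W, THEN ext]) (simp add: sheared_witt_proj_def)
  qed
  have fst_eq: "fst (h b) = fst (g b)" if b: "b \<in> carrier A" for b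
    using eq A.delta_funpow_closed[OF b] by (simp add: fst_theta[OF h b] fst_theta[OF g b])
  have snd_eq: "snd (k a) n = cls (fst (k b))"
    if k: "k \<in> delta_hom A S" and b: "b \<in> carrier A" "N +>\<^bsub>A\<^esub> a = N +>\<^bsub>A\<^esub> (\<phi> ^^ n) b" for k b n
  proof -
    have sk: "(\<lambda>z. snd z n) \<circ> k \<in> delta_hom A Q" by (rule delta_hom_comp[OF k snd_delta_hom])
    interpret sk: ring_hom_cring A Q "(\<lambda>z. snd z n) \<circ> k"
      using sk by unfold_locales (simp add: delta_hom_def)
    have kb: "k b \<in> carrier S" using k b by (auto simp: delta_hom_def dest: ring_hom_closed)
    let ?c = "(\<phi> ^^ n) b"
    have c: "?c \<in> carrier A" by (rule phi_closed[OF b(1)])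
    have "a \<ominus>\<^bsub>A\<^esub> ?c \<in> N" using b(2) A.coset_eq_iff[OF a c] by simp
    then have "delta_nilpotent A (a \<ominus>\<^bsub>A\<^esub> ?c)" by (rule delta_nilradicalD)
    with a c have "delta_nilpotent Q (((\<lambda>z. snd z n) \<circ> k) (a \<ominus>\<^bsub>A\<^esub> ?c))"
      by (intro delta_hom_nilpotent[OF delta_ring_A delta_ring_witt_Q sk]) auto
    then have "((\<lambda>z. snd z n) \<circ> k) (a \<ominus>\<^bsub>A\<^esub> ?c) = \<zero>\<^bsub>Q\<^esub>"
      using a c by (intro witt_Q_delta_reduced sk.hom_closed) auto
    then have "snd (k a) n = snd (k ?c) n"
      using sk.hom_a_minus[OF a c] sk.hom_closed[OF a] sk.hom_closed[OF c]
      unfolding comp_def by (metis Q.minus_eq_zeroD)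
    also have "\<dots> = (frobenius p Q ^^ n) (snd (k b) n)"
      using delta_hom_frobenius_iterate[OF p delta_ring_A delta_ring_witt_Q sk b(1), of n] by simp
    also have "\<dots> = snd (k b) 0" by (rule frobenius_funpow_snd[OF kb])
    also have "\<dots> = cls (fst (k b))" using kb unfolding sheared_carrier by metis
    finally show ?thesis .
  qed
  show ?thesis
  proof (rule sheared_eqI)
    show "fst (h a) = fst (g a)" by (rule fst_eq[OF a])
    fix n
    obtain b where "b \<in> carrier A" "N +>\<^bsub>A\<^esub> a = N +>\<^bsub>A\<^esub> (\<phi> ^^ n) b" using phi_surj[OF a] by blast
    then show "snd (h a) n = snd (g a) n" using snd_eq[OF h] snd_eq[OF g] fst_eq by metis
  qed
qed

context
  fixes f assumes f: "f \<in> ring_hom A R"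
begin

interpretation f: ring_hom_cring A R f using f by unfold_locales

definition lift_fst :: "'b \<Rightarrow> nat \<Rightarrow> 'a" where
  "lift_fst a = f \<circ> witt_lift p A a"

lemma lift_fst_delta_hom: "lift_fst \<in> delta_hom A W"
proof -
  have "lift_fst = (\<circ>) f \<circ> witt_lift p A" by (auto simp: lift_fst_def)
  then show ?thesis
    using delta_hom_comp[OF witt_lift_delta_hom[OF p delta_ring_A] witt_map_delta_hom[OF p R f.ring_hom_cring_axioms]]
    by simp
qed

interpretation lift_fst: ring_hom_cring A W lift_fst
  using lift_fst_delta_hom by unfold_locales (simp add: delta_hom_def)

lemma cls_lift_fst_cong:
  assumes "a \<in> carrier A" "b \<in> carrier A" "N +>\<^bsub>A\<^esub> a = N +>\<^bsub>A\<^esub> b"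
  shows "cls (lift_fst a) = cls (lift_fst b)"
proof -
  have "a \<ominus>\<^bsub>A\<^esub> b \<in> N" using assms by (simp add: A.coset_eq_iff)
  then have "delta_nilpotent A (a \<ominus>\<^bsub>A\<^esub> b)" by (rule delta_nilradicalD)
  then have "delta_nilpotent W (lift_fst (a \<ominus>\<^bsub>A\<^esub> b))"
    using assms by (intro delta_hom_nilpotent[OF delta_ring_A W.delta_ring_axioms lift_fst_delta_hom]) auto
  then have "lift_fst (a \<ominus>\<^bsub>A\<^esub> b) \<in> witt_hat p R"
    using assms by (intro witt_hat_of_delta_nilpotent) auto
  then show ?thesis using assms by (subst W.coset_eq_iff) auto
qed

text \<open>
  Term \<open>n\<close> is the class of the lift of \<open>\<phi>\<^sup>-\<^sup>n(a)\<close>. Such a preimage exists and is unique modulo \<open>N\<close>, and the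
  class depends only on its residue class.
\<close>

definition lift_snd :: "'b \<Rightarrow> nat \<Rightarrow> (nat \<Rightarrow> 'a) set" where
  "lift_snd a n = cls (lift_fst (SOME b. b \<in> carrier A \<and> N +>\<^bsub>A\<^esub> a = N +>\<^bsub>A\<^esub> (\<phi> ^^ n) b))"

lemma lift_snd_eq:
  assumes a: "a \<in> carrier A" and b: "b \<in> carrier A" "N +>\<^bsub>A\<^esub> a = N +>\<^bsub>A\<^esub> (\<phi> ^^ n) b"
  shows "lift_snd a n = cls (lift_fst b)"
proof -
  define c where "c = (SOME b. b \<in> carrier A \<and> N +>\<^bsub>A\<^esub> a = N +>\<^bsub>A\<^esub> (\<phi> ^^ n) b)"
  have c: "c \<in> carrier A" "N +>\<^bsub>A\<^esub> a = N +>\<^bsub>A\<^esub> (\<phi> ^^ n) c"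
    unfolding c_def using someI_ex[of "\<lambda>b. b \<in> carrier A \<and> N +>\<^bsub>A\<^esub> a = N +>\<^bsub>A\<^esub> (\<phi> ^^ n) b"] b by blast+
  have "N +>\<^bsub>A\<^esub> c = N +>\<^bsub>A\<^esub> b" by (rule phi_coset_inj[of _ _ n]) (use b c in auto)
  then show ?thesis
    unfolding lift_snd_def c_def[symmetric] by (rule cls_lift_fst_cong[OF c(1) b(1)])
qed

lemma lift_snd_delta_hom: "(\<lambda>a. lift_snd a n) \<in> delta_hom A Q"
proof -
  let ?q = "\<lambda>b. N +>\<^bsub>A\<^esub> (\<phi> ^^ n) b"
  have "((+>\<^bsub>A\<^esub>) N) \<circ> (\<phi> ^^ n) \<in> delta_hom A (delta_quot A N)"
    by (rule delta_hom_comp[OF delta_hom_frobenius_funpow[OF p delta_ring_A] A.delta_quot(2)])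
  then have q: "?q \<in> delta_hom A (delta_quot A N)" by (simp add: comp_def)
  have pr: "(\<lambda>a. N +>\<^bsub>A\<^esub> a) \<in> delta_hom A (delta_quot A N)" by (rule A.delta_quot(2))
  have lc: "(\<lambda>b. cls (lift_fst b)) \<in> delta_hom A Q"
    using delta_hom_comp[OF lift_fst_delta_hom cls_delta_hom] by (simp add: comp_def)
  interpret AN: delta_ring p "delta_quot A N" by (rule A.delta_quot(1))
  interpret q: ring_hom_cring A "delta_quot A N" ?q
    using q by unfold_locales (simp add: delta_hom_def)
  interpret pr: ring_hom_cring A "delta_quot A N" "\<lambda>a. N +>\<^bsub>A\<^esub> a"
    using pr by unfold_locales (simp add: delta_hom_def)
  note D = delta_hom_def mem_Collect_eq
  show ?thesis
    unfolding D
  proof (intro conjI ring_hom_memI ballI)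
    fix x y assume x: "x \<in> carrier A" and y: "y \<in> carrier A"
    obtain b where b: "b \<in> carrier A" "N +>\<^bsub>A\<^esub> x = ?q b" using phi_surj[OF x] by blast
    obtain c where c: "c \<in> carrier A" "N +>\<^bsub>A\<^esub> y = ?q c" using phi_surj[OF y] by blast
    have xb: "lift_snd x n = cls (lift_fst b)" by (rule lift_snd_eq[OF x b])
    have yc: "lift_snd y n = cls (lift_fst c)" by (rule lift_snd_eq[OF y c])
    show "lift_snd x n \<in> carrier Q" unfolding xb using b by simp
    have "N +>\<^bsub>A\<^esub> (x \<otimes>\<^bsub>A\<^esub> y) = ?q (b \<otimes>\<^bsub>A\<^esub> c)"
      unfolding pr.hom_mult[OF x y] q.hom_mult[OF b(1) c(1)] b(2) c(2) ..
    then have "lift_snd (x \<otimes>\<^bsub>A\<^esub> y) n = cls (lift_fst (b \<otimes>\<^bsub>A\<^esub> c))"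
      using x y b(1) c(1) by (intro lift_snd_eq A.m_closed)
    then show "lift_snd (x \<otimes>\<^bsub>A\<^esub> y) n = lift_snd x n \<otimes>\<^bsub>Q\<^esub> lift_snd y n"
      unfolding xb yc using b(1) c(1) by simp
    have "N +>\<^bsub>A\<^esub> (x \<oplus>\<^bsub>A\<^esub> y) = ?q (b \<oplus>\<^bsub>A\<^esub> c)"
      unfolding pr.hom_add[OF x y] q.hom_add[OF b(1) c(1)] b(2) c(2) ..
    then have "lift_snd (x \<oplus>\<^bsub>A\<^esub> y) n = cls (lift_fst (b \<oplus>\<^bsub>A\<^esub> c))"
      using x y b(1) c(1) by (intro lift_snd_eq A.add.m_closed)
    then show "lift_snd (x \<oplus>\<^bsub>A\<^esub> y) n = lift_snd x n \<oplus>\<^bsub>Q\<^esub> lift_snd y n"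
      unfolding xb yc using b(1) c(1) by simp
  next
    have "N +>\<^bsub>A\<^esub> \<one>\<^bsub>A\<^esub> = ?q \<one>\<^bsub>A\<^esub>"
      unfolding pr.hom_one q.hom_one ..
    then have "lift_snd \<one>\<^bsub>A\<^esub> n = cls (lift_fst \<one>\<^bsub>A\<^esub>)" by (intro lift_snd_eq A.one_closed)
    then show "lift_snd \<one>\<^bsub>A\<^esub> n = \<one>\<^bsub>Q\<^esub>" using cls.hom_one by simp
  next
    fix x assume x: "x \<in> carrier A"
    obtain b where b: "b \<in> carrier A" "N +>\<^bsub>A\<^esub> x = ?q b" using phi_surj[OF x] by blast
    have xb: "lift_snd x n = cls (lift_fst b)" by (rule lift_snd_eq[OF x b])
    have "N +>\<^bsub>A\<^esub> (\<delta>\<^bsub>A\<^esub> x) = ?q (\<delta>\<^bsub>A\<^esub> b)"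
      using q pr x b unfolding D by metis
    then have "lift_snd (\<delta>\<^bsub>A\<^esub> x) n = cls (lift_fst (\<delta>\<^bsub>A\<^esub> b))"
      using x b(1) by (intro lift_snd_eq A.delta_closed)
    then show "lift_snd (\<delta>\<^bsub>A\<^esub> x) n = \<delta>\<^bsub>Q\<^esub> (lift_snd x n)"
      using lc b(1) unfolding xb D by simp
  qed
qed

lemma lift_in_sheared:
  assumes a: "a \<in> carrier A"
  shows "(lift_fst a, lift_snd a) \<in> carrier S"
proof -
  have "frobenius p Q (lift_snd a (Suc n)) = lift_snd a n" for n
  proof -
    obtain b where b: "b \<in> carrier A" "N +>\<^bsub>A\<^esub> a = N +>\<^bsub>A\<^esub> (\<phi> ^^ Suc n) b" using phi_surj[OF a] by blast
    have pb: "\<phi> b \<in> carrier A" using phi_closed[OF b(1), of 1] by simp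
    have "frobenius p Q (lift_snd a (Suc n)) = cls (frobenius p W (lift_fst b))"
      using b by (simp add: lift_snd_eq[OF a b] cls_frobenius)
    also have "\<dots> = cls (lift_fst (\<phi> b))"
      using delta_hom_frobenius[OF delta_ring_A W.delta_ring_axioms lift_fst_delta_hom b(1)] by simp
    also have "\<dots> = lift_snd a n"
      using b pb by (intro lift_snd_eq[OF a, symmetric]) (simp_all add: funpow_swap1)
    finally show ?thesis .
  qed
  moreover have "lift_snd a 0 = cls (lift_fst a)" by (rule lift_snd_eq[OF a a]) simp
  moreover have "lift_snd a n \<in> carrier Q" for n
    using lift_snd_delta_hom[of n] a by (auto simp: delta_hom_def dest: ring_hom_closed)
  ultimately show ?thesis using a unfolding sheared_carrier fst_conv snd_conv by auto
qed

lemma lift_delta_hom: "(\<lambda>a. (lift_fst a, lift_snd a)) \<in> delta_hom A S"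
proof -
  interpret ls: ring_hom_cring A Q "\<lambda>a. lift_snd a n" for n
    using lift_snd_delta_hom[of n] by unfold_locales (simp add: delta_hom_def)
  have "lift_fst (\<delta>\<^bsub>A\<^esub> x) = \<delta>\<^bsub>W\<^esub> (lift_fst x)" "lift_snd (\<delta>\<^bsub>A\<^esub> x) n = \<delta>\<^bsub>Q\<^esub> (lift_snd x n)"
    if "x \<in> carrier A" for x n
    using that lift_fst_delta_hom lift_snd_delta_hom[of n] by (auto simp: delta_hom_def)
  then show ?thesis
    unfolding delta_hom_def mem_Collect_eq
    by (intro conjI ring_hom_memI ballI lift_in_sheared; (intro sheared_eqI)?)
      (simp_all add: sheared_ops ls.hom_one)
qed

lemma sheared_witt_proj_lift: "a \<in> carrier A \<Longrightarrow> sheared_witt_proj (lift_fst a, lift_snd a) = f a"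
  by (simp add: sheared_witt_proj_def lift_fst_def witt_lift_0[OF p delta_ring_A])

end

theorem bij_betw_Hom:
  "bij_betw (\<lambda>h. compose (carrier A) sheared_witt_proj h) (Hom_delta_Ring A S) (Hom_Ring A R)"
proof (rule bij_betw_imageI)
  have mem: "h \<in> Hom_delta_Ring A S \<longleftrightarrow> h \<in> delta_hom A S \<and> h \<in> extensional (carrier A)" for h
    by (auto simp: Hom_delta_Ring_def Hom_Ring_def delta_hom_def)
  show "inj_on (\<lambda>h. compose (carrier A) sheared_witt_proj h) (Hom_delta_Ring A S)"
  proof (rule inj_onI)
    fix h g assume h: "h \<in> Hom_delta_Ring A S" and g: "g \<in> Hom_delta_Ring A S"
      and eq: "compose (carrier A) sheared_witt_proj h = compose (carrier A) sheared_witt_proj g"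
    have "sheared_witt_proj (h a) = sheared_witt_proj (g a)" if "a \<in> carrier A" for a
      using fun_cong[OF eq, of a] that by (simp add: compose_eq)
    then have "h a = g a" if "a \<in> carrier A" for a
      using h g that by (intro delta_hom_determined[of h g]) (auto simp: mem)
    then show "h = g" using h g by (intro extensionalityI[of _ "carrier A"]) (auto simp: mem)
  qed
  show "(\<lambda>h. compose (carrier A) sheared_witt_proj h) ` Hom_delta_Ring A S = Hom_Ring A R"
  proof (intro equalityI subsetI)
    fix f assume "f \<in> (\<lambda>h. compose (carrier A) sheared_witt_proj h) ` Hom_delta_Ring A S"
    then obtain h where h: "h \<in> ring_hom A S" "f = compose (carrier A) sheared_witt_proj h"
      by (auto simp: Hom_delta_Ring_def Hom_Ring_def)
    have "sheared_witt_proj \<circ> h \<in> ring_hom A R" by (rule ring_hom_trans[OF h(1) sheared_witt_proj_hom])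
    then have "f \<in> ring_hom A R"
      unfolding h(2) by (auto simp: ring_hom_def compose_def Pi_iff)
    then show "f \<in> Hom_Ring A R" by (simp add: Hom_Ring_def h(2))
  next
    fix f assume "f \<in> Hom_Ring A R"
    then have f: "f \<in> ring_hom A R" "f \<in> extensional (carrier A)" by (auto simp: Hom_Ring_def)
    define h where "h = restrict (\<lambda>a. (lift_fst f a, lift_snd f a)) (carrier A)"
    have "h \<in> delta_hom A S"
      using lift_delta_hom[OF f(1)]
      by (auto simp: delta_hom_def ring_hom_def h_def Pi_iff A.delta_closed)
    then have "h \<in> Hom_delta_Ring A S" by (simp add: mem h_def)
    moreover have "f = compose (carrier A) sheared_witt_proj h"
      using f by (intro extensionalityI[of _ "carrier A"]) (auto simp: compose_eq h_def sheared_witt_proj_lift[OF f(1)])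
    ultimately show "f \<in> (\<lambda>h. compose (carrier A) sheared_witt_proj h) ` Hom_delta_Ring A S" by blast
  qed
qed

end

theorem theorem1p11:
  fixes R :: "('a, 'm) ring_scheme" and p :: nat
  assumes "prime p" and "cring R" and "nilperfect p R"
  shows "delta_nilperfect p (sheared_witt p R) \<and>
    sheared_witt_proj \<in> ring_hom (sheared_witt p R) R \<and>
    (\<forall>A :: ('b, 'k) dring_scheme. delta_nilperfect p A \<longrightarrow>
      bij_betw (\<lambda>h. compose (carrier A) sheared_witt_proj h)
        (Hom_delta_Ring A (sheared_witt p R)) (Hom_Ring A R))"
proof -
  interpret witt_base p R using assms(1,2) by (rule witt_base.intro)
  show ?thesis
  proof (intro conjI allI impI sheared_delta_nilperfect sheared_witt_proj_hom)
    fix A :: "('b, 'k) dring_scheme" assume "delta_nilperfect p A"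
    then interpret nilperfect_source p R A by unfold_locales
    show "bij_betw (\<lambda>h. compose (carrier A) sheared_witt_proj h)
        (Hom_delta_Ring A (sheared_witt p R)) (Hom_Ring A R)" by (rule bij_betw_Hom)
  qed
qed

end
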